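(* Let $q$ be a power of a prime $p$, let $\mathbb{F}_q$ be the finite field with $q$ elements, let $V$ be an $\mathbb{F}_q$-vector space of finite dimension $d$, and let $G \subseteq GL(V)$ be a subgroup. Let $R = \mathbb{F}_q[V] = \operatorname{Sym}(V^* )$, let $S = R^G$ be the ring of invariants, and let $\mathbf{d}_{d,0} = \prod_{0 \neq v \in V^*} v \in S$. Let $S_+ = \bigoplus_{n \geq 1} S_n$ be the irrelevant maximal ideal of $S$ and let $H^j_{S_+}(S)$ be the $j$-th local cohomology module of $S$ with respect to $S_+$. Then for all $0 \leq j \leq d-1$, $$\mathbf{d}_{d,0} \in \sqrt{\operatorname{ann}_S H^j_{S_+}(S)}.$$
   Context: The group $G$ (which is finite) acts on $V^*$ by the dual action and on $R = \operatorname{Sym}(V^* )$ by the induced $\mathbb{F}_q$-algebra automorphisms. $R$ is graded with the elements of $V^*$ in degree $1$, and $S = R^G$ is a graded subring with $S_0 = \mathbb{F}_q$. The element $\mathbf{d}_{d,0}$, the product of all nonzero linear forms $v \in V^*$, is called the top Dickson class; it is invariant under $GL(V)$, so it lies in $S$. $\sqrt{J}$ denotes the radical of the ideal $J$ in $S$. *)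

theory Defs
  imports Complex_Main "HOL-Algebra.Algebra" "HOL-Library.Poly_Mapping"
begin

section \<open>Annihilators, radicals and module homomorphisms\<close>

definition ring_module :: "('a, 'c) ring_scheme \<Rightarrow> ('a, 'a) module" where
  "ring_module S = \<lparr>carrier = carrier S, monoid.mult = (\<otimes>\<^bsub>S\<^esub>), one = \<one>\<^bsub>S\<^esub>,
     ring.zero = \<zero>\<^bsub>S\<^esub>, add = (\<oplus>\<^bsub>S\<^esub>), smult = (\<otimes>\<^bsub>S\<^esub>)\<rparr>"

definition annihilator :: "('a, 'c) ring_scheme \<Rightarrow> ('a, 'b) module \<Rightarrow> 'a set" where
  "annihilator S M = {s \<in> carrier S. \<forall>x \<in> carrier M. s \<odot>\<^bsub>M\<^esub> x = \<zero>\<^bsub>M\<^esub>}"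

definition ideal_radical :: "('a, 'c) ring_scheme \<Rightarrow> 'a set \<Rightarrow> 'a set" where
  "ideal_radical S J = {s \<in> carrier S. \<exists>n::nat. s [^]\<^bsub>S\<^esub> n \<in> J}"

definition module_homs ::
    "('a, 'c) ring_scheme \<Rightarrow> ('a, 'b) module \<Rightarrow> ('a, 'm) module \<Rightarrow> ('b \<Rightarrow> 'm) set" where
  "module_homs S M N = {h \<in> carrier M \<rightarrow> carrier N.
     (\<forall>x \<in> carrier M. \<forall>y \<in> carrier M. h (x \<oplus>\<^bsub>M\<^esub> y) = h x \<oplus>\<^bsub>N\<^esub> h y) \<and>
     (\<forall>a \<in> carrier S. \<forall>x \<in> carrier M. h (a \<odot>\<^bsub>M\<^esub> x) = a \<odot>\<^bsub>N\<^esub> h x)}"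

text \<open>The fields \<open>mult\<close> and \<open>one\<close> of a module record carry no information here.\<close>

definition quotient_module :: "('a, 'b) module \<Rightarrow> 'b set \<Rightarrow> ('a, 'b set) module" where
  "quotient_module M N = \<lparr>carrier = a_rcosets\<^bsub>M\<^esub> N, monoid.mult = undefined, one = undefined,
     ring.zero = N, add = set_add M,
     smult = (\<lambda>a C. \<Union>x\<in>C. N +>\<^bsub>M\<^esub> (a \<odot>\<^bsub>M\<^esub> x))\<rparr>"


section \<open>Local cohomology\<close>

text \<open>
  Local cohomology is the right derived functor of the torsion functor
  \<open>\<Gamma>\<^sub>I(M) = {x \<in> M. I\<^sup>n x = 0 for some n}\<close>: the cohomology of \<open>\<Gamma>\<^sub>I(E\<^sup>\<bullet>)\<close> for an injective
  resolution \<open>E\<^sup>\<bullet>\<close> of the module. It does not depend on the resolution up to isomorphism,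
  so statements about it are made for every injective resolution.

  As HOL cannot quantify over types inside a formula, injectivity is the lifting property in the
  category of \<open>S\<close>-modules with carrier in the type \<open>'m\<close> of the module itself. If \<open>'m\<close> is large
  enough to contain a copy of \<open>S\<close> (which an injective resolution of \<open>S\<close> forces), all ideals
  of \<open>S\<close> occur as test modules, so by Baer's criterion this is injectivity among all modules.
\<close>

definition injective_module :: "('a, 'c) ring_scheme \<Rightarrow> ('a, 'm) module \<Rightarrow> bool" where
  "injective_module S E \<longleftrightarrow> Module.module S E \<and>
     (\<forall>(A :: ('a, 'm) module) (B :: ('a, 'm) module) i f.
        Module.module S A \<and> Module.module S B \<and>
        i \<in> module_homs S A B \<and> inj_on i (carrier A) \<and> f \<in> module_homs S A E \<longrightarrow>
        (\<exists>h \<in> module_homs S B E. \<forall>x \<in> carrier A. h (i x) = f x))"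

text \<open>\<open>0 \<rightarrow> M \<rightarrow> E 0 \<rightarrow> E 1 \<rightarrow> \<dots>\<close> is exact, with augmentation \<open>\<epsilon>\<close> and differentials \<open>\<delta>\<close>.\<close>

definition injective_resolution ::
    "('a, 'c) ring_scheme \<Rightarrow> ('a, 'b) module \<Rightarrow> ('b \<Rightarrow> 'm) \<Rightarrow> (nat \<Rightarrow> ('a, 'm) module) \<Rightarrow>
     (nat \<Rightarrow> 'm \<Rightarrow> 'm) \<Rightarrow> bool" where
  "injective_resolution S M \<epsilon> E \<delta> \<longleftrightarrow>
     (\<forall>n. injective_module S (E n)) \<and>
     \<epsilon> \<in> module_homs S M (E 0) \<and> inj_on \<epsilon> (carrier M) \<and>
     (\<forall>n. \<delta> n \<in> module_homs S (E n) (E (Suc n))) \<and>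
     \<epsilon> ` carrier M = {x \<in> carrier (E 0). \<delta> 0 x = \<zero>\<^bsub>E 1\<^esub>} \<and>
     (\<forall>n. \<delta> n ` carrier (E n) = {x \<in> carrier (E (Suc n)). \<delta> (Suc n) x = \<zero>\<^bsub>E (Suc (Suc n))\<^esub>})"

definition torsion :: "('a, 'c) ring_scheme \<Rightarrow> 'a set \<Rightarrow> ('a, 'm) module \<Rightarrow> ('a, 'm) module" where
  "torsion S I M = M\<lparr>carrier := {x \<in> carrier M.
     \<exists>n::nat. \<forall>a \<in> I [^]\<^bsub>ideals_set S\<^esub> n. a \<odot>\<^bsub>M\<^esub> x = \<zero>\<^bsub>M\<^esub>}\<rparr>"

text \<open>The \<open>j\<close>-th cohomology of \<open>0 \<rightarrow> C 0 \<rightarrow> C 1 \<rightarrow> \<dots>\<close>.\<close>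

definition cohomology ::
    "(nat \<Rightarrow> ('a, 'm) module) \<Rightarrow> (nat \<Rightarrow> 'm \<Rightarrow> 'm) \<Rightarrow> nat \<Rightarrow> ('a, 'm set) module" where
  "cohomology C \<delta> j = quotient_module
     ((C j)\<lparr>carrier := {x \<in> carrier (C j). \<delta> j x = \<zero>\<^bsub>C (Suc j)\<^esub>}\<rparr>)
     (case j of 0 \<Rightarrow> {\<zero>\<^bsub>C 0\<^esub>} | Suc i \<Rightarrow> \<delta> i ` carrier (C i))"

text \<open>\<open>H\<^sup>j\<^sub>I(M)\<close>, computed from an injective resolution \<open>(E, \<delta>)\<close> of \<open>M\<close>.\<close>

definition local_cohomology ::
    "('a, 'c) ring_scheme \<Rightarrow> 'a set \<Rightarrow> (nat \<Rightarrow> ('a, 'm) module) \<Rightarrow> (nat \<Rightarrow> 'm \<Rightarrow> 'm) \<Rightarrow>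
     nat \<Rightarrow> ('a, 'm set) module" where
  "local_cohomology S I E \<delta> j = cohomology (\<lambda>n. torsion S I (E n)) \<delta> j"


section \<open>Symmetric algebras\<close>

text \<open>Polynomials over \<open>'k\<close> in variables \<open>'i\<close>; monomials are exponent functions \<open>'i \<Rightarrow>\<^sub>0 nat\<close>.\<close>

type_synonym ('i, 'k) mpoly = "('i \<Rightarrow>\<^sub>0 nat) \<Rightarrow>\<^sub>0 'k"

definition Const :: "'k::comm_ring_1 \<Rightarrow> ('i, 'k) mpoly" where
  "Const c = Poly_Mapping.single 0 c"

definition Var :: "'i \<Rightarrow> ('i, 'k::comm_ring_1) mpoly" where
  "Var i = Poly_Mapping.single (Poly_Mapping.single i 1) 1"

definition mpoly_ring :: "'i set \<Rightarrow> ('i, 'k::comm_ring_1) mpoly ring" where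
  "mpoly_ring U = \<lparr>carrier = {p. \<forall>m \<in> Poly_Mapping.keys p. Poly_Mapping.keys m \<subseteq> U},
     monoid.mult = (\<lambda>p r. p * r), one = 1, ring.zero = 0, add = (\<lambda>p r. p + r)\<rparr>"

definition mdegree :: "('i \<Rightarrow>\<^sub>0 nat) \<Rightarrow> nat" where
  "mdegree m = (\<Sum>i \<in> Poly_Mapping.keys m. Poly_Mapping.lookup m i)"

text \<open>The algebra homomorphism with \<open>Var i \<mapsto> Var (\<sigma> i)\<close>.\<close>

definition rename :: "('i \<Rightarrow> 'j) \<Rightarrow> ('i, 'k::comm_ring_1) mpoly \<Rightarrow> ('j, 'k) mpoly" where
  "rename \<sigma> p = (\<Sum>m \<in> Poly_Mapping.keys p. Const (Poly_Mapping.lookup p m) *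
     (\<Prod>i \<in> Poly_Mapping.keys m. Var (\<sigma> i) ^ Poly_Mapping.lookup m i))"

text \<open>
  \<open>Sym(W)\<close> for a vector space \<open>W\<close> of \<open>'k\<close>-valued functions (below, \<open>W = V\<^sup>*\<close>): the polynomial
  ring with one variable for every element of \<open>W\<close>, modulo the ideal that makes
  \<open>W \<rightarrow> Sym(W)\<close>, \<open>f \<mapsto> [Var f]\<close>, linear.
\<close>

definition sym_relations :: "('v \<Rightarrow> 'k::field) set \<Rightarrow> ('v \<Rightarrow> 'k, 'k) mpoly set" where
  "sym_relations W =
     {Var (\<lambda>v. f v + h v) - Var f - Var h | f h. f \<in> W \<and> h \<in> W} \<union>
     {Var (\<lambda>v. c * f v) - Const c * Var f | c f. f \<in> W}"

definition sym_ideal :: "('v \<Rightarrow> 'k::field) set \<Rightarrow> ('v \<Rightarrow> 'k, 'k) mpoly set" where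
  "sym_ideal W = Idl\<^bsub>mpoly_ring W\<^esub> (sym_relations W)"

definition sym_algebra :: "('v \<Rightarrow> 'k::field) set \<Rightarrow> ('v \<Rightarrow> 'k, 'k) mpoly set ring" where
  "sym_algebra W = mpoly_ring W Quot sym_ideal W"

definition sym_class ::
    "('v \<Rightarrow> 'k::field) set \<Rightarrow> ('v \<Rightarrow> 'k, 'k) mpoly \<Rightarrow> ('v \<Rightarrow> 'k, 'k) mpoly set" where
  "sym_class W p = sym_ideal W +>\<^bsub>mpoly_ring W\<^esub> p"

definition sym_degree :: "('v \<Rightarrow> 'k::field) set \<Rightarrow> nat \<Rightarrow> ('v \<Rightarrow> 'k, 'k) mpoly set set" where
  "sym_degree W n = sym_class W `
     {p \<in> carrier (mpoly_ring W). \<forall>m \<in> Poly_Mapping.keys p. mdegree m = n}"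


section \<open>Rings of invariants\<close>

text \<open>Throughout, a vector space \<open>V\<close> is a type \<open>'v\<close> with scalar multiplication \<open>scale\<close>.\<close>

definition dual_space :: "('k::field \<Rightarrow> 'v::ab_group_add \<Rightarrow> 'v) \<Rightarrow> ('v \<Rightarrow> 'k) set" where
  "dual_space scale = {f. Vector_Spaces.linear scale (*) f}"

definition general_linear :: "('k::field \<Rightarrow> 'v::ab_group_add \<Rightarrow> 'v) \<Rightarrow> ('v \<Rightarrow> 'v) monoid" where
  "general_linear scale = \<lparr>carrier = {g. Vector_Spaces.linear scale scale g \<and> bij g},
     monoid.mult = (\<circ>), one = id\<rparr>"

definition dual_action :: "('v \<Rightarrow> 'v) \<Rightarrow> ('v \<Rightarrow> 'k) \<Rightarrow> ('v \<Rightarrow> 'k)" where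
  "dual_action g f = f \<circ> inv_into UNIV g"

text \<open>
  For \<open>g \<in> GL(V)\<close>, \<open>rename (dual_action g)\<close> preserves \<open>sym_ideal (dual_space scale)\<close>, so taking
  images of cosets is the induced automorphism of \<open>Sym(V\<^sup>*)\<close>.
\<close>

definition sym_action ::
    "('v \<Rightarrow> 'v) \<Rightarrow> ('v \<Rightarrow> 'k::field, 'k) mpoly set \<Rightarrow> ('v \<Rightarrow> 'k, 'k) mpoly set" where
  "sym_action g C = rename (dual_action g) ` C"

definition invariant_ring ::
    "('k::field \<Rightarrow> 'v::ab_group_add \<Rightarrow> 'v) \<Rightarrow> ('v \<Rightarrow> 'v) set \<Rightarrow> ('v \<Rightarrow> 'k, 'k) mpoly set ring" where
  "invariant_ring scale G = (sym_algebra (dual_space scale))\<lparr>carrier :=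
     {x \<in> carrier (sym_algebra (dual_space scale)). \<forall>g \<in> G. sym_action g x = x}\<rparr>"

definition invariant_degree ::
    "('k::field \<Rightarrow> 'v::ab_group_add \<Rightarrow> 'v) \<Rightarrow> ('v \<Rightarrow> 'v) set \<Rightarrow> nat \<Rightarrow>
     ('v \<Rightarrow> 'k, 'k) mpoly set set" where
  "invariant_degree scale G n =
     carrier (invariant_ring scale G) \<inter> sym_degree (dual_space scale) n"

text \<open>\<open>S\<^sub>+\<close>, the direct sum of the \<open>S\<^sub>n\<close> with \<open>n \<ge> 1\<close>.\<close>

definition irrelevant_ideal ::
    "('k::field \<Rightarrow> 'v::ab_group_add \<Rightarrow> 'v) \<Rightarrow> ('v \<Rightarrow> 'v) set \<Rightarrow> ('v \<Rightarrow> 'k, 'k) mpoly set set" where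
  "irrelevant_ideal scale G =
     {finsum (invariant_ring scale G) s {1..N} | s N.
        \<forall>n \<in> {1..N}. s n \<in> invariant_degree scale G n}"

definition top_dickson ::
    "('k::field \<Rightarrow> 'v::ab_group_add \<Rightarrow> 'v) \<Rightarrow> ('v \<Rightarrow> 'k, 'k) mpoly set" where
  "top_dickson scale = finprod (sym_algebra (dual_space scale))
     (\<lambda>f. sym_class (dual_space scale) (Var f)) (dual_space scale - {\<lambda>_. 0})"

end

theory Submission
  imports Defs "HOL-Library.Countable_Set" "HOL-Computational_Algebra.Polynomial"
begin

text \<open>
  Write \<open>R = Sym(V\<^sup>*)\<close>, \<open>S = R\<^sup>G\<close>, let \<open>D\<close> be the top Dickson class and \<open>Q\<close> the number of elements of
  \<open>V\<^sup>*\<close>. The group acts freely away from the zero set of \<open>D\<close>, so after inverting \<open>D\<close> the ring \<open>R\<close> is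
  a Galois extension of \<open>S\<close> and the trace \<open>R \<rightarrow> S\<close> is onto. In fact some \<open>r\<close> in \<open>R\<close> has trace
  exactly \<open>D\<^sup>d\<close> (\<open>trace_power\<close>). Multiplication by \<open>D\<^sup>d\<close> on \<open>S\<close> therefore factors through
  \<open>R\<close> as an \<open>S\<close>-linear map: multiply by \<open>r\<close>, then take the trace. Since \<open>R\<close> is a polynomial ring in
  \<open>d\<close> variables and integral over \<open>S\<close>, its local cohomology vanishes below degree \<open>d\<close>, and so
  \<open>D\<^sup>d\<close> kills the local cohomology of \<open>S\<close> in these degrees (\<open>dickson_power_annihilates\<close>).

  The element \<open>r\<close> is explicit. Lagrange interpolation shows that a monic polynomial \<open>p\<close> of degree
  \<open>Q - 1\<close> over \<open>R\<close> satisfies \<open>\<Sum> p(u) = D\<close>, summed over \<open>u \<in> V\<^sup>*\<close> (\<open>sum_monic_eq_prod_nonzero\<close>).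
  Applied \<open>d\<close> times, this evaluates to \<open>D\<^sup>d\<close> the sum over all lists \<open>u\<^sub>1, \<dots>, u\<^sub>d\<close> of a product of
  such polynomials, the \<open>i\<close>-th of which is chosen to vanish when \<open>u\<^sub>i\<close> lies in the span of its
  predecessors. Only bases contribute to the sum, the group permutes the bases freely, and
  summing over orbit representatives gives \<open>r\<close> (\<open>trace_eq_power\<close>).

  The vanishing for \<open>R\<close> is brought to bear on the given injective resolution \<open>E\<close> of \<open>S\<close> as follows.
  A local cohomology class is represented by a cocycle \<open>x\<close> in \<open>E\<^sup>j\<close> that is killed by \<open>S\<^sub>+\<^sup>n\<close>. Take a
  resolution of the cyclic module \<open>S x\<close> by free modules of countable rank. Moving along the two
  resolutions in turn (\<open>cocycle_boundary\<close>) converts \<open>x\<close> into a cocycle of the free resolution with values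
  in \<open>S\<close>, and \<open>D\<^sup>d\<close> times it is a coboundary because this holds for values in \<open>R\<close>. The way back
  gives a map \<open>S x \<rightarrow> E\<^sup>j\<^sup>-\<^sup>1\<close>; the image \<open>y\<close> of the generator has boundary \<open>D\<^sup>d x\<close> and is
  again killed by \<open>S\<^sub>+\<^sup>n\<close>.

  For values in \<open>R\<close> the argument is that of Rees (\<open>cochain_exact\<close>): every element of \<open>S\<^sub>+\<^sup>n R\<close> acts on
  \<open>R\<close>-valued cochains by a map that is homotopic to zero, and \<open>S\<^sub>+\<^sup>n R\<close> contains a regular
  sequence of length \<open>d\<close>. Indeed each variable is a root of \<open>\<Prod> (X - u)\<close>, whose lower coefficients are
  invariants of positive degree, so its power with exponent \<open>Q n\<close> lies in \<open>S\<^sub>+\<^sup>n R\<close>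
  (\<open>Var_power_in_span\<close>).
\<close>

section \<open>Homomorphisms and submodules\<close>

lemma module_homs_closed: "h \<in> module_homs S M N \<Longrightarrow> x \<in> carrier M \<Longrightarrow> h x \<in> carrier N"
  by (auto simp: module_homs_def)

lemma module_homs_add:
  "h \<in> module_homs S M N \<Longrightarrow> x \<in> carrier M \<Longrightarrow> y \<in> carrier M \<Longrightarrow>
    h (x \<oplus>\<^bsub>M\<^esub> y) = h x \<oplus>\<^bsub>N\<^esub> h y"
  by (auto simp: module_homs_def)

lemma module_homs_smult:
  "h \<in> module_homs S M N \<Longrightarrow> a \<in> carrier S \<Longrightarrow> x \<in> carrier M \<Longrightarrow>
    h (a \<odot>\<^bsub>M\<^esub> x) = a \<odot>\<^bsub>N\<^esub> h x"
  by (auto simp: module_homs_def)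

lemma module_homsI:
  assumes "\<And>x. x \<in> carrier M \<Longrightarrow> h x \<in> carrier N"
    and "\<And>x y. x \<in> carrier M \<Longrightarrow> y \<in> carrier M \<Longrightarrow> h (x \<oplus>\<^bsub>M\<^esub> y) = h x \<oplus>\<^bsub>N\<^esub> h y"
    and "\<And>a x. a \<in> carrier S \<Longrightarrow> x \<in> carrier M \<Longrightarrow> h (a \<odot>\<^bsub>M\<^esub> x) = a \<odot>\<^bsub>N\<^esub> h x"
  shows "h \<in> module_homs S M N"
  using assms by (auto simp: module_homs_def)

lemma module_homs_zero:
  assumes "Module.module S M" "Module.module S N" "h \<in> module_homs S M N"
  shows "h \<zero>\<^bsub>M\<^esub> = \<zero>\<^bsub>N\<^esub>"
proof -
  interpret M: Module.module S M by fact
  interpret N: Module.module S N by fact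
  have "h (\<zero>\<^bsub>S\<^esub> \<odot>\<^bsub>M\<^esub> \<zero>\<^bsub>M\<^esub>) = \<zero>\<^bsub>S\<^esub> \<odot>\<^bsub>N\<^esub> h \<zero>\<^bsub>M\<^esub>"
    by (rule module_homs_smult[OF assms(3)]) auto
  then show ?thesis using module_homs_closed[OF assms(3), of "\<zero>\<^bsub>M\<^esub>"] by simp
qed

lemma module_homs_uminus:
  assumes "Module.module S M" "Module.module S N" "h \<in> module_homs S M N" "x \<in> carrier M"
  shows "h (\<ominus>\<^bsub>M\<^esub> x) = \<ominus>\<^bsub>N\<^esub> h x"
proof -
  interpret M: Module.module S M by fact
  interpret N: Module.module S N by fact
  have "h (\<ominus>\<^bsub>M\<^esub> x) \<oplus>\<^bsub>N\<^esub> h x = h (\<ominus>\<^bsub>M\<^esub> x \<oplus>\<^bsub>M\<^esub> x)"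
    using assms(4) by (simp add: module_homs_add[OF assms(3)])
  also have "\<dots> = \<zero>\<^bsub>N\<^esub>"
    using assms by (simp add: M.M.l_neg module_homs_zero)
  finally show ?thesis
    using module_homs_closed[OF assms(3)] assms(4) by (simp add: N.M.minus_equality)
qed

lemma module_homs_minus:
  assumes "Module.module S M" "Module.module S N" "h \<in> module_homs S M N"
    and "x \<in> carrier M" "y \<in> carrier M"
  shows "h (x \<ominus>\<^bsub>M\<^esub> y) = h x \<ominus>\<^bsub>N\<^esub> h y"
proof -
  interpret M: Module.module S M by fact
  interpret N: Module.module S N by fact
  show ?thesis
    using assms by (simp add: a_minus_def module_homs_add[OF assms(3)] module_homs_uminus)
qed

lemma module_homs_comp:
  "g \<in> module_homs S M N \<Longrightarrow> f \<in> module_homs S L M \<Longrightarrow> (\<lambda>x. g (f x)) \<in> module_homs S L N"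
  by (auto simp: module_homs_def Pi_def)

lemma module_homs_plus:
  assumes "Module.module S N" "f \<in> module_homs S M N" "g \<in> module_homs S M N"
  shows "(\<lambda>x. f x \<oplus>\<^bsub>N\<^esub> g x) \<in> module_homs S M N"
proof -
  interpret N: Module.module S N by fact
  show ?thesis
    using assms(2,3)
    by (intro module_homsI)
      (auto simp: module_homs_closed module_homs_add module_homs_smult N.M.a_ac N.smult_r_distr)
qed

lemma module_homs_diff:
  assumes "Module.module S N" "f \<in> module_homs S M N" "g \<in> module_homs S M N"
  shows "(\<lambda>x. f x \<ominus>\<^bsub>N\<^esub> g x) \<in> module_homs S M N"
proof -
  interpret N: Module.module S N by fact
  show ?thesis
    using assms(2,3)
    by (intro module_homsI)
      (auto simp: module_homs_closed module_homs_add module_homs_smult N.M.a_ac N.smult_r_distr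
        a_minus_def N.M.minus_add N.smult_r_minus)
qed

lemma module_homs_scale:
  assumes "Module.module S N" "f \<in> module_homs S M N" "a \<in> carrier S"
  shows "(\<lambda>x. a \<odot>\<^bsub>N\<^esub> f x) \<in> module_homs S M N"
proof -
  interpret N: Module.module S N by fact
  show ?thesis
    using assms(2,3)
    by (intro module_homsI)
      (auto simp: module_homs_closed module_homs_add module_homs_smult N.smult_r_distr
        N.smult_assoc1[symmetric] N.R.m_comm)
qed

lemma module_homs_const_zero:
  assumes "Module.module S N"
  shows "(\<lambda>x. \<zero>\<^bsub>N\<^esub>) \<in> module_homs S M N"
proof -
  interpret N: Module.module S N by fact
  show ?thesis by (intro module_homsI) auto
qed

definition submodule_set :: "('a, 'c) ring_scheme \<Rightarrow> ('a, 'b) module \<Rightarrow> 'b set \<Rightarrow> bool" where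
  "submodule_set S M K \<longleftrightarrow> K \<subseteq> carrier M \<and> \<zero>\<^bsub>M\<^esub> \<in> K \<and>
     (\<forall>x\<in>K. \<forall>y\<in>K. x \<oplus>\<^bsub>M\<^esub> y \<in> K) \<and> (\<forall>a\<in>carrier S. \<forall>x\<in>K. a \<odot>\<^bsub>M\<^esub> x \<in> K)"

lemma submodule_set_kernel:
  assumes "Module.module S M" "Module.module S N" "h \<in> module_homs S M N"
  shows "submodule_set S M {x \<in> carrier M. h x = \<zero>\<^bsub>N\<^esub>}"
proof -
  interpret M: Module.module S M by fact
  interpret N: Module.module S N by fact
  show ?thesis
    using assms by (auto simp: submodule_set_def module_homs_zero module_homs_add[OF assms(3)]
        module_homs_smult[OF assms(3)])
qed

lemma submodule_set_image:
  assumes "Module.module S M" "Module.module S N" "h \<in> module_homs S M N"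
  shows "submodule_set S N (h ` carrier M)"
proof -
  interpret M: Module.module S M by fact
  interpret N: Module.module S N by fact
  have "\<zero>\<^bsub>N\<^esub> \<in> h ` carrier M"
    using module_homs_zero[OF assms] M.M.zero_closed by (metis imageI)
  moreover have "h x \<oplus>\<^bsub>N\<^esub> h y \<in> h ` carrier M" if "x \<in> carrier M" "y \<in> carrier M" for x y
    using that module_homs_add[OF assms(3)] M.M.add.m_closed by (metis imageI)
  moreover have "a \<odot>\<^bsub>N\<^esub> h x \<in> h ` carrier M" if "x \<in> carrier M" "a \<in> carrier S" for x a
    using that module_homs_smult[OF assms(3)] M.smult_closed by (metis imageI)
  ultimately show ?thesis
    using assms(3) by (auto simp: submodule_set_def module_homs_closed)
qed

lemma submodule_module:
  assumes "Module.module S M" "submodule_set S M K"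
  shows "Module.module S (M\<lparr>carrier := K\<rparr>)"
proof -
  interpret M: Module.module S M by fact
  have K: "x \<in> carrier M" if "x \<in> K" for x using that assms(2) by (auto simp: submodule_set_def)
  show ?thesis
  proof (rule moduleI[OF M.R.is_cring])
    show "abelian_group (M\<lparr>carrier := K\<rparr>)"
    proof (rule abelian_groupI)
      fix x assume x: "x \<in> carrier (M\<lparr>carrier := K\<rparr>)"
      have "(\<ominus>\<^bsub>S\<^esub> \<one>\<^bsub>S\<^esub>) \<odot>\<^bsub>M\<^esub> x = \<ominus>\<^bsub>M\<^esub> x"
        using x K by (simp add: M.smult_l_minus)
      moreover have "(\<ominus>\<^bsub>S\<^esub> \<one>\<^bsub>S\<^esub>) \<odot>\<^bsub>M\<^esub> x \<in> K"
        using x assms(2) by (simp add: submodule_set_def)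
      ultimately show "\<exists>y\<in>carrier (M\<lparr>carrier := K\<rparr>). y \<oplus>\<^bsub>M\<lparr>carrier := K\<rparr>\<^esub> x = \<zero>\<^bsub>M\<lparr>carrier := K\<rparr>\<^esub>"
        using x K by (intro bexI[of _ "\<ominus>\<^bsub>M\<^esub> x"]) (auto simp: M.M.l_neg)
    qed (use assms(2) K in \<open>auto simp: submodule_set_def M.M.a_ac\<close>)
  qed (use assms(2) K in \<open>auto simp: submodule_set_def M.smult_l_distr M.smult_r_distr M.smult_assoc1\<close>)
qed

text \<open>
  The injectivity assumption only speaks about modules with carrier in the type \<open>'m\<close>. A countable
  module is brought into that type along an injection \<open>\<tau>\<close>.
\<close>
definition transport_module :: "('b \<Rightarrow> 'm) \<Rightarrow> ('a, 'b) module \<Rightarrow> ('a, 'm) module" where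
  "transport_module \<tau> M = \<lparr>carrier = \<tau> ` carrier M, monoid.mult = undefined, one = undefined,
     ring.zero = \<tau> \<zero>\<^bsub>M\<^esub>,
     add = (\<lambda>x y. \<tau> (inv_into (carrier M) \<tau> x \<oplus>\<^bsub>M\<^esub> inv_into (carrier M) \<tau> y)),
     module.smult = (\<lambda>a x. \<tau> (a \<odot>\<^bsub>M\<^esub> inv_into (carrier M) \<tau> x))\<rparr>"

lemma transport_module:
  assumes "Module.module S M" "inj_on \<tau> (carrier M)"
  shows "Module.module S (transport_module \<tau> M)" "\<tau> \<in> module_homs S M (transport_module \<tau> M)"
proof -
  interpret M: Module.module S M by fact
  have [simp]: "inv_into (carrier M) \<tau> (\<tau> x) = x" if "x \<in> carrier M" for x
    using assms(2) that by simp
  show "Module.module S (transport_module \<tau> M)"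
  proof (rule moduleI[OF M.R.is_cring])
    show "abelian_group (transport_module \<tau> M)"
    proof (rule abelian_groupI)
      fix x assume "x \<in> carrier (transport_module \<tau> M)"
      then obtain m where m: "m \<in> carrier M" "x = \<tau> m" by (auto simp: transport_module_def)
      have "\<tau> (\<ominus>\<^bsub>M\<^esub> m) \<in> carrier (transport_module \<tau> M)"
        using m by (auto simp: transport_module_def)
      moreover have "\<tau> (\<ominus>\<^bsub>M\<^esub> m) \<oplus>\<^bsub>transport_module \<tau> M\<^esub> x = \<zero>\<^bsub>transport_module \<tau> M\<^esub>"
        using m by (simp add: transport_module_def M.M.l_neg)
      ultimately show "\<exists>y\<in>carrier (transport_module \<tau> M).
          y \<oplus>\<^bsub>transport_module \<tau> M\<^esub> x = \<zero>\<^bsub>transport_module \<tau> M\<^esub>"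
        by blast
    qed (auto simp: transport_module_def M.M.a_ac)
  qed (auto simp: transport_module_def M.smult_l_distr M.smult_r_distr M.smult_assoc1)
  show "\<tau> \<in> module_homs S M (transport_module \<tau> M)"
    by (intro module_homsI) (auto simp: transport_module_def)
qed

section \<open>Free modules of countable rank\<close>

text \<open>
  Every free module is taken to be the one of countable rank: when the ring is countable, each
  submodule is countable and hence again a quotient of it. A free resolution then stays inside one
  type.
\<close>
definition free_module :: "('a, 'c) ring_scheme \<Rightarrow> ('a, nat \<Rightarrow> 'a) module" where
  "free_module S = \<lparr>carrier = {f. (\<forall>i. f i \<in> carrier S) \<and> finite {i. f i \<noteq> \<zero>\<^bsub>S\<^esub>}},
     monoid.mult = undefined, one = undefined, ring.zero = (\<lambda>_. \<zero>\<^bsub>S\<^esub>),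
     add = (\<lambda>f g i. f i \<oplus>\<^bsub>S\<^esub> g i), module.smult = (\<lambda>a f i. a \<otimes>\<^bsub>S\<^esub> f i)\<rparr>"

definition unit_vector :: "('a, 'c) ring_scheme \<Rightarrow> nat \<Rightarrow> nat \<Rightarrow> 'a" where
  "unit_vector S i = (\<lambda>_. \<zero>\<^bsub>S\<^esub>)(i := \<one>\<^bsub>S\<^esub>)"

context cring begin

abbreviation "F \<equiv> free_module R"

lemma free_module_simps:
  "f \<in> carrier F \<longleftrightarrow> (\<forall>i. f i \<in> carrier R) \<and> finite {i. f i \<noteq> \<zero>}"
  "\<zero>\<^bsub>F\<^esub> = (\<lambda>_. \<zero>)" "f \<oplus>\<^bsub>F\<^esub> g = (\<lambda>i. f i \<oplus> g i)" "a \<odot>\<^bsub>F\<^esub> f = (\<lambda>i. a \<otimes> f i)"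
  by (auto simp: free_module_def)

lemma free_module_module: "Module.module R F"
proof (rule moduleI[OF is_cring])
  have fin_add: "finite {i. f i \<oplus> g i \<noteq> \<zero>}" if "finite {i. f i \<noteq> \<zero>}" "finite {i. g i \<noteq> \<zero>}"
    for f g :: "nat \<Rightarrow> 'a"
    by (rule finite_subset[OF _ finite_UnI[OF that]]) auto
  have fin_neg: "finite {i. \<ominus> f i \<noteq> \<zero>}" if "finite {i. f i \<noteq> \<zero>}" for f :: "nat \<Rightarrow> 'a"
    by (rule finite_subset[OF _ that]) auto
  show "abelian_group F"
  proof (rule abelian_groupI)
    fix x assume x: "x \<in> carrier F"
    show "\<exists>y\<in>carrier F. y \<oplus>\<^bsub>F\<^esub> x = \<zero>\<^bsub>F\<^esub>"
      using x fin_neg by (intro bexI[of _ "\<lambda>i. \<ominus> x i"]) (auto simp: free_module_simps l_neg)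
  qed (auto simp: free_module_simps a_ac fin_add)
  fix a x assume "a \<in> carrier R" "x \<in> carrier F"
  moreover have "{i. a \<otimes> x i \<noteq> \<zero>} \<subseteq> {i. x i \<noteq> \<zero>}" using \<open>a \<in> carrier R\<close> by auto
  then have "finite {i. a \<otimes> x i \<noteq> \<zero>}"
    by (rule finite_subset) (use \<open>x \<in> carrier F\<close> in \<open>simp add: free_module_simps\<close>)
  ultimately show "a \<odot>\<^bsub>F\<^esub> x \<in> carrier F"
    by (auto simp: free_module_simps)
qed (auto simp: free_module_simps l_distr r_distr m_assoc)

lemma unit_vector_closed [simp]: "unit_vector R i \<in> carrier F"
  by (auto simp: free_module_simps unit_vector_def)

lemma free_module_induct [consumes 1, case_names zero add]:
  assumes "f \<in> carrier F"
    and "P \<zero>\<^bsub>F\<^esub>"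
    and "\<And>g a i. g \<in> carrier F \<Longrightarrow> P g \<Longrightarrow> a \<in> carrier R \<Longrightarrow> P (g \<oplus>\<^bsub>F\<^esub> a \<odot>\<^bsub>F\<^esub> unit_vector R i)"
  shows "P f"
proof -
  have "finite {i. f i \<noteq> \<zero>}" using assms(1) by (simp add: free_module_simps)
  moreover have "{i. f i \<noteq> \<zero>} \<subseteq> T \<Longrightarrow> f \<in> carrier F \<Longrightarrow> P f" if "finite T" for T f
    using that
  proof (induction T arbitrary: f rule: finite_induct)
    case empty
    then have "f = \<zero>\<^bsub>F\<^esub>" by (auto simp: free_module_simps)
    then show ?case using assms(2) by simp
  next
    case (insert j T)
    define g where "g = f(j := \<zero>)"
    have g: "g \<in> carrier F" "{i. g i \<noteq> \<zero>} \<subseteq> T"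
      using insert.prems by (auto simp: g_def free_module_simps elim!: rev_finite_subset)
    have "f = g \<oplus>\<^bsub>F\<^esub> f j \<odot>\<^bsub>F\<^esub> unit_vector R j"
      using insert.prems by (auto simp: g_def free_module_simps unit_vector_def fun_eq_iff)
    then show ?case
      using assms(3)[OF g(1) insert.IH[OF g(2,1)], of "f j" j] insert.prems
      by (auto simp: free_module_simps)
  qed
  ultimately show ?thesis using assms(1) by blast
qed

lemma free_module_hom_image_subset:
  assumes "Module.module R N" "h \<in> module_homs R F N" "submodule_set R N K"
    and "\<And>i. h (unit_vector R i) \<in> K" "f \<in> carrier F"
  shows "h f \<in> K"
  using assms(5)
proof (induction f rule: free_module_induct)
  case zero
  then show ?case
    using assms(3) by (simp add: module_homs_zero[OF free_module_module assms(1,2)] submodule_set_def)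
next
  case (add g a i)
  interpret F: Module.module R F by (rule free_module_module)
  have "h (g \<oplus>\<^bsub>F\<^esub> a \<odot>\<^bsub>F\<^esub> unit_vector R i) = h g \<oplus>\<^bsub>N\<^esub> a \<odot>\<^bsub>N\<^esub> h (unit_vector R i)"
    using add by (simp add: module_homs_add[OF assms(2)] module_homs_smult[OF assms(2)])
  then show ?case using add assms(3,4) by (simp add: submodule_set_def)
qed

lemma free_module_hom_eq:
  assumes "Module.module R N" "h \<in> module_homs R F N" "h' \<in> module_homs R F N"
    and "\<And>i. h (unit_vector R i) = h' (unit_vector R i)" "f \<in> carrier F"
  shows "h f = h' f"
  using assms(5)
proof (induction f rule: free_module_induct)
  case zero
  then show ?case
    by (simp add: module_homs_zero[OF free_module_module assms(1)] assms(2,3))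
next
  case (add g a i)
  interpret F: Module.module R F by (rule free_module_module)
  show ?case
    using add by (simp add: module_homs_add[OF assms(2)] module_homs_smult[OF assms(2)]
      module_homs_add[OF assms(3)] module_homs_smult[OF assms(3)] assms(4))
qed

lemma free_module_hom_ex:
  assumes "Module.module R N" "\<And>i. x i \<in> carrier N"
  shows "\<exists>h\<in>module_homs R F N. \<forall>i. h (unit_vector R i) = x i"
proof -
  interpret N: Module.module R N by fact
  define h where "h f = finsum N (\<lambda>i. f i \<odot>\<^bsub>N\<^esub> x i) {i. f i \<noteq> \<zero>}" for f
  have h_eq: "h f = finsum N (\<lambda>i. f i \<odot>\<^bsub>N\<^esub> x i) T"
    if "f \<in> carrier F" "finite T" "{i. f i \<noteq> \<zero>} \<subseteq> T" for f T
    unfolding h_def using that assms(2)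
    by (intro N.M.add.finprod_mono_neutral_cong_left) (auto simp: free_module_simps)
  have add: "h (f \<oplus>\<^bsub>F\<^esub> g) = h f \<oplus>\<^bsub>N\<^esub> h g" if f: "f \<in> carrier F" and g: "g \<in> carrier F" for f g
  proof -
    interpret F: Module.module R F by (rule free_module_module)
    define T where "T = {i. f i \<noteq> \<zero>} \<union> {i. g i \<noteq> \<zero>}"
    have T: "finite T" using f g by (auto simp: T_def free_module_simps)
    have "h (f \<oplus>\<^bsub>F\<^esub> g) = finsum N (\<lambda>i. (f \<oplus>\<^bsub>F\<^esub> g) i \<odot>\<^bsub>N\<^esub> x i) T"
      using F.M.add.m_closed[OF f g] T by (intro h_eq) (auto simp: T_def free_module_simps(3))
    also have "\<dots> = finsum N (\<lambda>i. f i \<odot>\<^bsub>N\<^esub> x i \<oplus>\<^bsub>N\<^esub> g i \<odot>\<^bsub>N\<^esub> x i) T"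
      using f g assms(2)
      by (intro N.M.finsum_cong') (auto simp: free_module_simps N.smult_l_distr)
    also have "\<dots> = finsum N (\<lambda>i. f i \<odot>\<^bsub>N\<^esub> x i) T \<oplus>\<^bsub>N\<^esub> finsum N (\<lambda>i. g i \<odot>\<^bsub>N\<^esub> x i) T"
      using f g assms(2) by (intro N.M.finsum_addf) (auto simp: free_module_simps)
    also have "\<dots> = h f \<oplus>\<^bsub>N\<^esub> h g"
      using f g T by (subst (1 2) h_eq[of _ T]) (auto simp: T_def)
    finally show ?thesis .
  qed
  have smult: "h (a \<odot>\<^bsub>F\<^esub> f) = a \<odot>\<^bsub>N\<^esub> h f" if f: "f \<in> carrier F" and a: "a \<in> carrier R" for f a
  proof -
    interpret F: Module.module R F by (rule free_module_module)
    have "h (a \<odot>\<^bsub>F\<^esub> f) = finsum N (\<lambda>i. (a \<odot>\<^bsub>F\<^esub> f) i \<odot>\<^bsub>N\<^esub> x i) {i. f i \<noteq> \<zero>}"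
    proof (rule h_eq)
      show "a \<odot>\<^bsub>F\<^esub> f \<in> carrier F" using f a by simp
      show "finite {i. f i \<noteq> \<zero>}" using f by (simp add: free_module_simps)
      show "{i. (a \<odot>\<^bsub>F\<^esub> f) i \<noteq> \<zero>} \<subseteq> {i. f i \<noteq> \<zero>}" using a by (auto simp: free_module_simps)
    qed
    also have "\<dots> = finsum N (\<lambda>i. a \<odot>\<^bsub>N\<^esub> (f i \<odot>\<^bsub>N\<^esub> x i)) {i. f i \<noteq> \<zero>}"
      using f a assms(2)
      by (intro N.M.finsum_cong') (auto simp: free_module_simps N.smult_assoc1)
    also have "\<dots> = a \<odot>\<^bsub>N\<^esub> h f"
      unfolding h_def using f a assms(2)
      by (intro N.finsum_smult_ldistr[symmetric]) (auto simp: free_module_simps)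
    finally show ?thesis .
  qed
  have "h f \<in> carrier N" if "f \<in> carrier F" for f
    unfolding h_def using that assms(2) by (intro N.M.finsum_closed) (auto simp: free_module_simps)
  then have "h \<in> module_homs R F N" by (intro module_homsI) (auto simp: add smult)
  moreover have "h (unit_vector R i) = x i" for i
  proof -
    have "h (unit_vector R i) = finsum N (\<lambda>j. unit_vector R i j \<odot>\<^bsub>N\<^esub> x j) {i}"
      by (rule h_eq[OF unit_vector_closed]) (auto simp: unit_vector_def)
    then show ?thesis using assms(2) by (simp add: unit_vector_def)
  qed
  ultimately show ?thesis by blast
qed

text \<open>
  Projectivity: it is enough to lift the images of the unit vectors.
\<close>
lemma free_module_lift:
  assumes "Module.module R N" "Module.module R M" "\<delta> \<in> module_homs R M N" "\<phi> \<in> module_homs R F N"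
    and "\<And>f. f \<in> carrier F \<Longrightarrow> \<phi> f \<in> \<delta> ` carrier M"
  obtains u where "u \<in> module_homs R F M" "\<And>f. f \<in> carrier F \<Longrightarrow> \<delta> (u f) = \<phi> f"
proof -
  have "\<forall>i. \<exists>y\<in>carrier M. \<delta> y = \<phi> (unit_vector R i)" using assms(5)[OF unit_vector_closed] by (metis imageE)
  then obtain y where y: "\<And>i. y i \<in> carrier M" "\<And>i. \<delta> (y i) = \<phi> (unit_vector R i)" by metis
  obtain u where u: "u \<in> module_homs R F M" "\<And>i. u (unit_vector R i) = y i"
    using free_module_hom_ex[OF assms(2), of y] y(1) by blast
  have "\<delta> (u f) = \<phi> f" if "f \<in> carrier F" for f
    by (rule free_module_hom_eq[OF assms(1) module_homs_comp[OF assms(3) u(1)] assms(4) _ that])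
      (simp add: u y)
  with u(1) show thesis by (rule that)
qed

lemma countable_free_module:
  assumes "countable (carrier R)"
  shows "countable (carrier F)"
proof -
  let ?graph = "\<lambda>f. {(i, f i) | i. f i \<noteq> \<zero>}"
  have "inj_on ?graph (carrier F)"
  proof (rule inj_onI)
    fix f g assume "?graph f = ?graph g"
    then have "f i = g i" for i by (cases "f i = \<zero>"; cases "g i = \<zero>") (auto simp: set_eq_iff)
    then show "f = g" by auto
  qed
  moreover have "?graph ` carrier F \<subseteq> {A. finite A \<and> A \<subseteq> UNIV \<times> carrier R}"
    by (auto simp: free_module_simps)
  moreover have "countable {A. finite A \<and> A \<subseteq> (UNIV :: nat set) \<times> carrier R}"
    using assms by (intro countable_Collect_finite_subset) auto
  ultimately show ?thesis using countable_image_inj_on[of ?graph "carrier F"] countable_subset by blast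
qed

lemma free_module_cover:
  assumes "countable (carrier R)" "submodule_set R F K"
  obtains p where "p \<in> module_homs R F F" "p ` carrier F = K"
proof -
  interpret F: Module.module R F by (rule free_module_module)
  have K: "K \<subseteq> carrier F" "K \<noteq> {}" using assms(2) by (auto simp: submodule_set_def)
  have "countable K" using K(1) countable_free_module[OF assms(1)] by (rule countable_subset)
  then obtain k :: "nat \<Rightarrow> nat \<Rightarrow> 'a" where k: "range k = K"
    using K(2) by (metis range_from_nat_into)
  then have "k i \<in> carrier F" for i using K(1) by blast
  then obtain p where p: "p \<in> module_homs R F F" "\<And>i. p (unit_vector R i) = k i"
    using free_module_hom_ex[OF free_module_module, of k] by blast
  have "p ` carrier F \<subseteq> K"
    using free_module_hom_image_subset[OF free_module_module p(1) assms(2)] k p(2) by blast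
  moreover have "K \<subseteq> p ` carrier F"
  proof
    fix x assume "x \<in> K"
    then obtain i where "x = k i" using k by blast
    then have "x = p (unit_vector R i)" by (simp add: p(2))
    then show "x \<in> p ` carrier F" using unit_vector_closed by blast
  qed
  ultimately show thesis using that p(1) by blast
qed

end

section \<open>Injective modules and free resolutions\<close>

lemma (in abelian_group) diff_eq_zero_iff:
  assumes "x \<in> carrier G" "y \<in> carrier G"
  shows "x \<ominus> y = \<zero> \<longleftrightarrow> x = y"
proof
  assume "x \<ominus> y = \<zero>"
  then have "\<ominus> (\<ominus> y) = x" using assms by (intro minus_equality) (auto simp: a_minus_def)
  then show "x = y" using assms by simp
qed (use assms in \<open>simp add: a_minus_def r_neg\<close>)

context cring begin
text \<open>
  The map \<open>\<chi>\<close> induces a map on the submodule \<open>p F\<close> of \<open>F\<close>, and injectivity extends it to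
  \<open>F\<close>. Both modules are countable, so they have copies inside the infinite type \<open>'m\<close>.
\<close>
lemma injective_module_extend:
  fixes E :: "('a, 'm) module"
  assumes "injective_module R E" "countable (carrier R)" "infinite (UNIV :: 'm set)"
    and "\<chi> \<in> module_homs R F E" "p \<in> module_homs R F F"
    and "\<And>f. f \<in> carrier F \<Longrightarrow> p f = \<zero>\<^bsub>F\<^esub> \<Longrightarrow> \<chi> f = \<zero>\<^bsub>E\<^esub>"
  obtains v where "v \<in> module_homs R F E" "\<And>f. f \<in> carrier F \<Longrightarrow> v (p f) = \<chi> f"
proof -
  note Fm = free_module_module
  interpret F: Module.module R F by (rule Fm)
  have E: "Module.module R E" using assms(1) by (simp add: injective_module_def)
  interpret E: Module.module R E by (rule E)
  have "countable (carrier F)" by (rule countable_free_module[OF assms(2)])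
  then have "inj_on (to_nat_on (carrier F)) (carrier F)" by (rule inj_on_to_nat_on)
  moreover obtain c :: "nat \<Rightarrow> 'm" where c: "inj c" using assms(3) infinite_countable_subset by blast
  ultimately have "inj_on (c \<circ> to_nat_on (carrier F)) (carrier F)"
    by (intro comp_inj_on inj_on_subset[OF c]) auto
  then obtain \<tau> :: "(nat \<Rightarrow> 'a) \<Rightarrow> 'm" where \<tau>: "inj_on \<tau> (carrier F)" by blast
  define K where "K = p ` carrier F"
  have K: "submodule_set R F K" unfolding K_def by (rule submodule_set_image[OF Fm Fm assms(5)])
  have KF: "K \<subseteq> carrier F" using K by (simp add: submodule_set_def)
  have \<tau>K: "inj_on \<tau> (carrier (F\<lparr>carrier := K\<rparr>))" using \<tau> KF by (auto intro: inj_on_subset)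
  define A where "A = transport_module \<tau> (F\<lparr>carrier := K\<rparr>)"
  define B where "B = transport_module \<tau> F"
  have A: "Module.module R A" unfolding A_def
    by (intro transport_module submodule_module Fm K \<tau>K)
  have B: "Module.module R B" "\<tau> \<in> module_homs R F B" unfolding B_def
    by (intro transport_module Fm \<tau>)+
  \<comment> \<open>the map \<open>p f \<mapsto> \<chi> f\<close>, well defined by the assumption on kernels\<close>
  define g where "g k = \<chi> (SOME f. f \<in> carrier F \<and> p f = k)" for k
  have g: "g (p f) = \<chi> f" if f: "f \<in> carrier F" for f
  proof -
    define f' where "f' = (SOME f'. f' \<in> carrier F \<and> p f' = p f)"
    have f': "f' \<in> carrier F" "p f' = p f"
      unfolding f'_def by (rule someI2[of _ f]; use f in simp)+
    have "p (f' \<ominus>\<^bsub>F\<^esub> f) = p f \<ominus>\<^bsub>F\<^esub> p f"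
      using f f' by (simp add: module_homs_minus[OF Fm Fm assms(5)])
    also have "\<dots> = \<zero>\<^bsub>F\<^esub>"
      using module_homs_closed[OF assms(5) f] by (simp add: a_minus_def F.M.r_neg)
    finally have "p (f' \<ominus>\<^bsub>F\<^esub> f) = \<zero>\<^bsub>F\<^esub>" .
    then have "\<chi> (f' \<ominus>\<^bsub>F\<^esub> f) = \<zero>\<^bsub>E\<^esub>" using f f' assms(6) by simp
    then have "\<chi> f' \<ominus>\<^bsub>E\<^esub> \<chi> f = \<zero>\<^bsub>E\<^esub>"
      using f f' by (simp add: module_homs_minus[OF Fm E assms(4)])
    then have "\<chi> f' = \<chi> f"
      using f f' module_homs_closed[OF assms(4)] by (simp add: E.M.diff_eq_zero_iff)
    then show ?thesis by (simp add: g_def f'_def)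
  qed
  have gK: "g (k \<oplus>\<^bsub>F\<^esub> l) = g k \<oplus>\<^bsub>E\<^esub> g l" "g (a \<odot>\<^bsub>F\<^esub> k) = a \<odot>\<^bsub>E\<^esub> g k" "g k \<in> carrier E"
    if kl: "k \<in> K" "l \<in> K" and a: "a \<in> carrier R" for k l a
  proof -
    obtain x y where xy: "x \<in> carrier F" "y \<in> carrier F" "k = p x" "l = p y"
      using kl by (auto simp: K_def)
    show "g (k \<oplus>\<^bsub>F\<^esub> l) = g k \<oplus>\<^bsub>E\<^esub> g l"
      using xy g[of "x \<oplus>\<^bsub>F\<^esub> y"]
      by (simp add: g module_homs_add[OF assms(5)] module_homs_add[OF assms(4)])
    show "g (a \<odot>\<^bsub>F\<^esub> k) = a \<odot>\<^bsub>E\<^esub> g k"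
      using xy a g[of "a \<odot>\<^bsub>F\<^esub> x"]
      by (simp add: g module_homs_smult[OF assms(5)] module_homs_smult[OF assms(4)])
    show "g k \<in> carrier E" using xy g module_homs_closed[OF assms(4)] by simp
  qed
  have invK [simp]: "inv_into K \<tau> (\<tau> k) = k" if "k \<in> K" for k
    using \<tau>K that by simp
  have invF [simp]: "inv_into (carrier F) \<tau> (\<tau> k) = k" if "k \<in> carrier F" for k
    using \<tau> that by simp
  have "(\<lambda>x. g (inv_into K \<tau> x)) \<in> module_homs R A E"
    using K gK(1)[OF _ _ zero_closed] gK(2)[of _ _] gK(3)[OF _ _ zero_closed]
    by (intro module_homsI) (auto simp: A_def transport_module_def submodule_set_def)
  moreover have "(\<lambda>x. x) \<in> module_homs R A B"
    using KF K by (intro module_homsI)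
      (auto simp: A_def B_def transport_module_def submodule_set_def subset_iff)
  ultimately obtain h where h: "h \<in> module_homs R B E" "\<forall>x\<in>carrier A. h x = g (inv_into K \<tau> x)"
    using assms(1)[unfolded injective_module_def, THEN conjunct2, rule_format,
        of A B "\<lambda>x. x" "\<lambda>x. g (inv_into K \<tau> x)"] A B(1) by auto
  have "h (\<tau> (p f)) = \<chi> f" if f: "f \<in> carrier F" for f
  proof -
    have "p f \<in> K" using f by (simp add: K_def)
    then show ?thesis using h(2) g[OF f] by (simp add: A_def transport_module_def)
  qed
  then show thesis using that[OF module_homs_comp[OF h(1) B(2)]] by simp
qed

text \<open>
  A resolution of \<open>F / K\<close>. The map \<open>p (Suc i)\<close> goes from the \<open>(i + 1)\<close>-st to the \<open>i\<close>-th copy of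
  \<open>F\<close>, and \<open>p 0\<close> is zero, which makes the formulas for cochains of degree \<open>0\<close> instances of the
  general ones.
\<close>
definition free_resolution :: "(nat \<Rightarrow> 'a) set \<Rightarrow> (nat \<Rightarrow> (nat \<Rightarrow> 'a) \<Rightarrow> nat \<Rightarrow> 'a) \<Rightarrow> bool" where
  "free_resolution K p \<longleftrightarrow> p 0 = (\<lambda>_. \<zero>\<^bsub>F\<^esub>) \<and> (\<forall>i. p i \<in> module_homs R F F) \<and>
     p 1 ` carrier F = K \<and>
     (\<forall>i. p (Suc (Suc i)) ` carrier F = {f \<in> carrier F. p (Suc i) f = \<zero>\<^bsub>F\<^esub>})"

lemma free_resolution_ex:
  assumes "countable (carrier R)" "submodule_set R F K"
  obtains p where "free_resolution K p"
proof -
  note Fm = free_module_module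
  obtain p1 where p1: "p1 \<in> module_homs R F F" "p1 ` carrier F = K"
    using free_module_cover[OF assms] .
  define Q where "Q i p \<longleftrightarrow> p \<in> module_homs R F F \<and> (i = 0 \<longrightarrow> p = p1)" for i :: nat and p
  have "\<exists>p. \<forall>i. Q i (p i) \<and> p (Suc i) ` carrier F = {f \<in> carrier F. p i f = \<zero>\<^bsub>F\<^esub>}"
  proof (rule dependent_nat_choice)
    show "\<exists>p. Q 0 p" using p1 by (auto simp: Q_def)
    fix p i assume "Q i p"
    then have p: "p \<in> module_homs R F F" by (simp add: Q_def)
    obtain p' where "p' \<in> module_homs R F F" "p' ` carrier F = {f \<in> carrier F. p f = \<zero>\<^bsub>F\<^esub>}"
      using free_module_cover[OF assms(1) submodule_set_kernel[OF Fm Fm p]] .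
    then show "\<exists>p'. Q (Suc i) p' \<and> p' ` carrier F = {f \<in> carrier F. p f = \<zero>\<^bsub>F\<^esub>}"
      by (auto simp: Q_def)
  qed
  then obtain p where p: "\<And>i. Q i (p i)" "\<And>i. p (Suc i) ` carrier F = {f \<in> carrier F. p i f = \<zero>\<^bsub>F\<^esub>}"
    by blast
  have "free_resolution K (\<lambda>i. case i of 0 \<Rightarrow> (\<lambda>_. \<zero>\<^bsub>F\<^esub>) | Suc i \<Rightarrow> p i)"
    using p p1(2) p(1)[of 0] module_homs_const_zero[OF Fm]
    by (auto simp: free_resolution_def Q_def split: nat.split)
  then show thesis by (rule that)
qed

end

section \<open>Regular sequences and the vanishing of cohomology\<close>

definition ring_algebra :: "('a \<Rightarrow> 'r::comm_ring_1) \<Rightarrow> ('a, 'r) module" where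
  "ring_algebra \<iota> = \<lparr>carrier = UNIV, monoid.mult = undefined, one = undefined,
     ring.zero = 0, add = (+), module.smult = (\<lambda>a x. \<iota> a * x)\<rparr>"

lemma ring_algebra_simps [simp]:
  "carrier (ring_algebra \<iota>) = UNIV" "\<zero>\<^bsub>ring_algebra \<iota>\<^esub> = 0" "x \<oplus>\<^bsub>ring_algebra \<iota>\<^esub> y = x + y"
  "a \<odot>\<^bsub>ring_algebra \<iota>\<^esub> x = \<iota> a * x"
  by (simp_all add: ring_algebra_def)

abbreviation ring_ideal :: "'r::comm_ring_1 set \<Rightarrow> bool" where
  "ring_ideal \<equiv> Modules.module.subspace (*)"

abbreviation ideal_span :: "'r::comm_ring_1 set \<Rightarrow> 'r set" where
  "ideal_span \<equiv> Modules.module.span (*)"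

lemma module_mult: "Modules.module ((*) :: 'r::comm_ring_1 \<Rightarrow> 'r \<Rightarrow> 'r)"
  by unfold_locales (auto simp: algebra_simps)

lemmas ideal_span_add = Modules.module.span_add[OF module_mult]
lemmas ideal_span_base = Modules.module.span_base[OF module_mult]
lemmas ideal_span_empty = Modules.module.span_empty[OF module_mult]
lemmas ideal_span_induct = Modules.module.span_induct[OF module_mult]
lemmas ideal_span_induct_alt = Modules.module.span_induct_alt[OF module_mult]
lemmas ideal_span_insert = Modules.module.span_insert[OF module_mult]
lemmas ideal_span_minimal = Modules.module.span_minimal[OF module_mult]
lemmas ideal_span_mono = Modules.module.span_mono[OF module_mult]
lemmas ideal_span_neg = Modules.module.span_neg[OF module_mult]
lemmas ideal_span_scale = Modules.module.span_scale[OF module_mult]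
lemmas ideal_span_sum = Modules.module.span_sum[OF module_mult]
lemmas ideal_span_zero = Modules.module.span_zero[OF module_mult]
lemmas ring_ideal_span = Modules.module.subspace_span[OF module_mult]

lemma ring_ideal_iff:
  "ring_ideal J \<longleftrightarrow> 0 \<in> J \<and> (\<forall>x\<in>J. \<forall>y\<in>J. x + y \<in> J) \<and> (\<forall>c. \<forall>x\<in>J. c * x \<in> J)"
  by (rule Modules.module.subspace_def[OF module_mult])

lemma ring_ideal_diff: "ring_ideal J \<Longrightarrow> x \<in> J \<Longrightarrow> y \<in> J \<Longrightarrow> x - y \<in> J"
  by (rule Modules.module.subspace_diff[OF module_mult])

lemma ring_ideal_add: "ring_ideal J \<Longrightarrow> x \<in> J \<Longrightarrow> y \<in> J \<Longrightarrow> x + y \<in> J"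
  by (simp add: ring_ideal_iff)

lemma ring_ideal_mult: "ring_ideal J \<Longrightarrow> x \<in> J \<Longrightarrow> c * x \<in> J"
  by (simp add: ring_ideal_iff)

context cring begin

definition ring_hom_into :: "('a \<Rightarrow> 'r::comm_ring_1) \<Rightarrow> bool" where
  "ring_hom_into \<iota> \<longleftrightarrow> \<iota> \<one> = 1 \<and> (\<forall>a\<in>carrier R. \<forall>b\<in>carrier R.
     \<iota> (a \<oplus> b) = \<iota> a + \<iota> b \<and> \<iota> (a \<otimes> b) = \<iota> a * \<iota> b)"

lemma ring_algebra_module:
  assumes "ring_hom_into \<iota>"
  shows "Module.module R (ring_algebra \<iota>)"
proof (rule moduleI[OF is_cring])
  show "abelian_group (ring_algebra \<iota>)"
    by (rule abelian_groupI) (auto simp: algebra_simps intro: exI[of _ "- _"])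
qed (use assms in \<open>auto simp: ring_hom_into_def algebra_simps\<close>)

lemma ring_algebra_homsI:
  assumes "\<And>x y. x \<in> carrier F \<Longrightarrow> y \<in> carrier F \<Longrightarrow> f (x \<oplus>\<^bsub>F\<^esub> y) = f x + f y"
    and "\<And>a x. a \<in> carrier R \<Longrightarrow> x \<in> carrier F \<Longrightarrow> f (a \<odot>\<^bsub>F\<^esub> x) = \<iota> a * f x"
  shows "f \<in> module_homs R F (ring_algebra \<iota>)"
  using assms by (intro module_homsI) auto

lemma free_resolution_hom: "free_resolution K p \<Longrightarrow> p i \<in> module_homs R F F"
  by (simp add: free_resolution_def)

lemma free_resolution_closed:
  "free_resolution K p \<Longrightarrow> f \<in> carrier F \<Longrightarrow> p i f \<in> carrier F"
  using free_resolution_hom module_homs_closed by metis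

lemma free_resolution_complex:
  assumes "free_resolution K p" "f \<in> carrier F"
  shows "p i (p (Suc i) f) = \<zero>\<^bsub>F\<^esub>"
proof (cases i)
  case 0
  then show ?thesis using assms(1) by (simp add: free_resolution_def)
next
  case (Suc l)
  have "p (Suc (Suc l)) f \<in> p (Suc (Suc l)) ` carrier F" using assms(2) by blast
  then show ?thesis using assms(1) Suc by (auto simp: free_resolution_def)
qed

text \<open>
  A scalar that maps \<open>F\<close> into \<open>K\<close> acts as zero on \<open>F / K\<close>, so its action on the resolution is
  homotopic to zero by the usual lifting construction.
\<close>
lemma null_homotopy_ex:
  assumes p: "free_resolution K p" and s: "s \<in> carrier R"
    and sK: "\<And>f. f \<in> carrier F \<Longrightarrow> s \<odot>\<^bsub>F\<^esub> f \<in> K"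
  obtains h where "\<And>i. h i \<in> module_homs R F F"
    "\<And>f. f \<in> carrier F \<Longrightarrow> p 1 (h 0 f) = s \<odot>\<^bsub>F\<^esub> f"
    "\<And>i f. f \<in> carrier F \<Longrightarrow> p (Suc (Suc i)) (h (Suc i) f) \<oplus>\<^bsub>F\<^esub> h i (p (Suc i) f) = s \<odot>\<^bsub>F\<^esub> f"
proof -
  note Fm = free_module_module
  interpret F: Module.module R F by (rule Fm)
  note ph = free_resolution_hom[OF p] and pc = free_resolution_closed[OF p]
  have id_hom: "(\<lambda>f. f) \<in> module_homs R F F" by (intro module_homsI) auto
  have s_hom: "(\<lambda>f. s \<odot>\<^bsub>F\<^esub> f) \<in> module_homs R F F" by (rule module_homs_scale[OF Fm id_hom s])
  \<comment> \<open>\<open>h i\<close> is a homotopy on boundaries; this is what makes the next step possible\<close>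
  define Q where "Q i h \<longleftrightarrow> h \<in> module_homs R F F \<and>
      (\<forall>f\<in>carrier F. p (Suc i) (h (p (Suc i) f)) = s \<odot>\<^bsub>F\<^esub> p (Suc i) f) \<and>
      (i = 0 \<longrightarrow> (\<forall>f\<in>carrier F. p 1 (h f) = s \<odot>\<^bsub>F\<^esub> f))" for i h
  have "\<exists>h. \<forall>i. Q i (h i) \<and>
      (\<forall>f\<in>carrier F. p (Suc (Suc i)) (h (Suc i) f) \<oplus>\<^bsub>F\<^esub> h i (p (Suc i) f) = s \<odot>\<^bsub>F\<^esub> f)"
  proof (rule dependent_nat_choice)
    have "s \<odot>\<^bsub>F\<^esub> f \<in> p 1 ` carrier F" if "f \<in> carrier F" for f
      using sK[OF that] p by (simp add: free_resolution_def)
    then obtain h where h: "h \<in> module_homs R F F" "\<And>f. f \<in> carrier F \<Longrightarrow> p 1 (h f) = s \<odot>\<^bsub>F\<^esub> f"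
      using free_module_lift[OF Fm Fm ph s_hom] by metis
    then have "Q 0 h" by (auto simp: Q_def pc)
    then show "\<exists>h. Q 0 h" by blast
  next
    fix h i assume Q: "Q i h"
    then have h: "h \<in> module_homs R F F" by (simp add: Q_def)
    have hc: "h f \<in> carrier F" if "f \<in> carrier F" for f using module_homs_closed[OF h that] .
    let ?\<phi> = "\<lambda>f. s \<odot>\<^bsub>F\<^esub> f \<ominus>\<^bsub>F\<^esub> h (p (Suc i) f)"
    have \<phi>: "?\<phi> \<in> module_homs R F F"
      by (intro module_homs_diff Fm s_hom module_homs_comp[OF h] ph)
    have "?\<phi> f \<in> p (Suc (Suc i)) ` carrier F" if f: "f \<in> carrier F" for f
    proof -
      have "p (Suc i) (?\<phi> f) = p (Suc i) (s \<odot>\<^bsub>F\<^esub> f) \<ominus>\<^bsub>F\<^esub> p (Suc i) (h (p (Suc i) f))"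
        using f s pc hc by (intro module_homs_minus[OF Fm Fm ph]) auto
      also have "\<dots> = s \<odot>\<^bsub>F\<^esub> p (Suc i) f \<ominus>\<^bsub>F\<^esub> s \<odot>\<^bsub>F\<^esub> p (Suc i) f"
        using Q f s by (simp add: Q_def module_homs_smult[OF ph])
      also have "\<dots> = \<zero>\<^bsub>F\<^esub>"
        using f s pc by (simp add: F.M.diff_eq_zero_iff)
      finally show ?thesis using p module_homs_closed[OF \<phi> f] by (simp add: free_resolution_def)
    qed
    then obtain h' where h': "h' \<in> module_homs R F F"
        "\<And>f. f \<in> carrier F \<Longrightarrow> p (Suc (Suc i)) (h' f) = ?\<phi> f"
      using free_module_lift[OF Fm Fm ph \<phi>] by metis
    have eq: "p (Suc (Suc i)) (h' f) \<oplus>\<^bsub>F\<^esub> h (p (Suc i) f) = s \<odot>\<^bsub>F\<^esub> f" if f: "f \<in> carrier F" for f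
      using f s hc[OF pc[OF f]] by (simp add: h'(2) a_minus_def F.M.a_assoc F.M.l_neg)
    have "p (Suc (Suc i)) (h' (p (Suc (Suc i)) f)) = s \<odot>\<^bsub>F\<^esub> p (Suc (Suc i)) f" if f: "f \<in> carrier F" for f
      using f s h'(2)[OF pc[OF f]] pc[OF f]
      by (simp add: free_resolution_complex[OF p] module_homs_zero[OF Fm Fm h] a_minus_def)
    then have "Q (Suc i) h'" using h'(1) by (simp add: Q_def)
    then show "\<exists>h'. Q (Suc i) h' \<and> (\<forall>f\<in>carrier F.
        p (Suc (Suc i)) (h' f) \<oplus>\<^bsub>F\<^esub> h (p (Suc i) f) = s \<odot>\<^bsub>F\<^esub> f)"
      using eq by blast
  qed
  then obtain h where "\<And>i. Q i (h i)" and
    "\<And>i f. f \<in> carrier F \<Longrightarrow> p (Suc (Suc i)) (h (Suc i) f) \<oplus>\<^bsub>F\<^esub> h i (p (Suc i) f) = s \<odot>\<^bsub>F\<^esub> f"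
    by metis
  then show thesis using that[of h] by (auto simp: Q_def)
qed

abbreviation cochains :: "('a \<Rightarrow> 'r::comm_ring_1) \<Rightarrow> ((nat \<Rightarrow> 'a) \<Rightarrow> 'r) set" where
  "cochains \<iota> \<equiv> module_homs R F (ring_algebra \<iota>)"

text \<open>
  Homotopies are operators on cochains with values in an algebra, because scalars of the algebra act
  on these but not on the resolution. They have to preserve cochains with values in an ideal \<open>J\<close>, as
  cochains with values in the quotient by \<open>J\<close> are treated as cochains modulo \<open>J\<close>.
\<close>
definition null_homotopy :: "('a \<Rightarrow> 'r::comm_ring_1) \<Rightarrow> (nat \<Rightarrow> (nat \<Rightarrow> 'a) \<Rightarrow> nat \<Rightarrow> 'a) \<Rightarrow> 'r \<Rightarrow>
    (nat \<Rightarrow> ((nat \<Rightarrow> 'a) \<Rightarrow> 'r) \<Rightarrow> (nat \<Rightarrow> 'a) \<Rightarrow> 'r) \<Rightarrow> bool" where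
  "null_homotopy \<iota> p t H \<longleftrightarrow>
     (\<forall>i. \<forall>f\<in>cochains \<iota>. H i f \<in> cochains \<iota> \<and>
        (\<forall>J. ring_ideal J \<longrightarrow> f ` carrier F \<subseteq> J \<longrightarrow> H i f ` carrier F \<subseteq> J)) \<and>
     (\<forall>f\<in>cochains \<iota>. \<forall>x\<in>carrier F.
        t * f x = H 0 (\<lambda>y. f (p 1 y)) x \<and>
        (\<forall>i. t * f x = H (Suc i) (\<lambda>y. f (p (Suc (Suc i)) y)) x + H i f (p (Suc i) x)))"

lemma null_homotopyD:
  assumes "null_homotopy \<iota> p t H" "f \<in> cochains \<iota>"
  shows "H i f \<in> cochains \<iota>"
    and "ring_ideal J \<Longrightarrow> f ` carrier F \<subseteq> J \<Longrightarrow> H i f ` carrier F \<subseteq> J"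
    and "x \<in> carrier F \<Longrightarrow> t * f x = H 0 (\<lambda>y. f (p 1 y)) x"
    and "x \<in> carrier F \<Longrightarrow>
      t * f x = H (Suc i) (\<lambda>y. f (p (Suc (Suc i)) y)) x + H i f (p (Suc i) x)"
  using assms unfolding null_homotopy_def by blast+

lemma null_homotopyI:
  assumes "\<And>i f. f \<in> cochains \<iota> \<Longrightarrow> H i f \<in> cochains \<iota>"
    and "\<And>i f J. f \<in> cochains \<iota> \<Longrightarrow> ring_ideal J \<Longrightarrow> f ` carrier F \<subseteq> J \<Longrightarrow>
      H i f ` carrier F \<subseteq> J"
    and "\<And>f x. f \<in> cochains \<iota> \<Longrightarrow> x \<in> carrier F \<Longrightarrow>
      t * f x = H 0 (\<lambda>y. f (p 1 y)) x"
    and "\<And>i f x. f \<in> cochains \<iota> \<Longrightarrow> x \<in> carrier F \<Longrightarrow>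
      t * f x = H (Suc i) (\<lambda>y. f (p (Suc (Suc i)) y)) x + H i f (p (Suc i) x)"
  shows "null_homotopy \<iota> p t H"
  using assms unfolding null_homotopy_def by blast

definition null_homotopic ::
    "('a \<Rightarrow> 'r::comm_ring_1) \<Rightarrow> (nat \<Rightarrow> (nat \<Rightarrow> 'a) \<Rightarrow> nat \<Rightarrow> 'a) \<Rightarrow> 'r \<Rightarrow> bool" where
  "null_homotopic \<iota> p t \<longleftrightarrow> (\<exists>H. null_homotopy \<iota> p t H)"

text \<open>
  The elements that are homotopic to zero form an ideal of the algebra, not only of the base ring.
  This is what admits regular sequences outside the base ring.
\<close>
lemma null_homotopic_span:
  assumes \<iota>: "ring_hom_into \<iota>" and p: "free_resolution K p"
    and t: "t \<in> ideal_span (\<iota> ` {s \<in> carrier R. \<forall>f\<in>carrier F. s \<odot>\<^bsub>F\<^esub> f \<in> K})"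
  shows "null_homotopic \<iota> p t"
proof -
  let ?C = "cochains \<iota>"
  note Fm = free_module_module and Am = ring_algebra_module[OF \<iota>]
  interpret F: Module.module R F by (rule Fm)
  note ph = free_resolution_hom[OF p] and pc = free_resolution_closed[OF p]
  have add: "(\<lambda>x. f x + g x) \<in> ?C" if "f \<in> ?C" "g \<in> ?C" for f g
    using module_homs_plus[OF Am that] by simp
  have cmult: "(\<lambda>x. c * f x) \<in> ?C" if "f \<in> ?C" for f c
    using that by (intro ring_algebra_homsI)
      (auto simp: module_homs_add[OF that] module_homs_smult[OF that] algebra_simps)
  have zero: "(\<lambda>x. 0) \<in> ?C" using module_homs_const_zero[OF Am] by simp
  show ?thesis
  proof (rule ideal_span_induct_alt[OF t])
    show "null_homotopic \<iota> p 0"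
      unfolding null_homotopic_def
      by (rule exI[of _ "\<lambda>i f x. 0"], rule null_homotopyI) (auto simp: zero ring_ideal_iff)
  next
    fix c t u assume "t \<in> \<iota> ` {s \<in> carrier R. \<forall>f\<in>carrier F. s \<odot>\<^bsub>F\<^esub> f \<in> K}"
    then obtain s where s: "s \<in> carrier R" "\<And>f. f \<in> carrier F \<Longrightarrow> s \<odot>\<^bsub>F\<^esub> f \<in> K" "t = \<iota> s" by blast
    obtain h where h: "\<And>i. h i \<in> module_homs R F F"
      "\<And>f. f \<in> carrier F \<Longrightarrow> p 1 (h 0 f) = s \<odot>\<^bsub>F\<^esub> f"
      "\<And>i f. f \<in> carrier F \<Longrightarrow> p (Suc (Suc i)) (h (Suc i) f) \<oplus>\<^bsub>F\<^esub> h i (p (Suc i) f) = s \<odot>\<^bsub>F\<^esub> f"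
      using null_homotopy_ex[OF p s(1,2)] by blast
    have hc: "h i f \<in> carrier F" if "f \<in> carrier F" for i f using module_homs_closed[OF h(1) that] .
    have ts: "t * f x = f (s \<odot>\<^bsub>F\<^esub> x)" if "f \<in> ?C" "x \<in> carrier F" for f x
      using module_homs_smult[OF that(1) s(1) that(2)] s(3) by simp
    assume "null_homotopic \<iota> p u"
    then obtain H where H: "null_homotopy \<iota> p u H" unfolding null_homotopic_def by blast
    note H = null_homotopyD[OF H]
    show "null_homotopic \<iota> p (c * t + u)"
      unfolding null_homotopic_def
    proof (rule exI[of _ "\<lambda>i f x. c * f (h i x) + H i f x"], rule null_homotopyI)
      fix i f assume f: "f \<in> ?C"
      show "(\<lambda>x. c * f (h i x) + H i f x) \<in> ?C"
        by (rule add[OF cmult[OF module_homs_comp[OF f h(1)]] H(1)[OF f]])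
    next
      fix i f J assume f: "f \<in> ?C" and J: "ring_ideal J" "f ` carrier F \<subseteq> J"
      show "(\<lambda>x. c * f (h i x) + H i f x) ` carrier F \<subseteq> J"
        using H(2)[OF f J, of i] J(2) hc
        by (auto simp: image_subset_iff intro!: ring_ideal_add[OF J(1)] ring_ideal_mult[OF J(1)])
    next
      fix f x assume f: "f \<in> ?C" and x: "x \<in> carrier F"
      show "(c * t + u) * f x = c * f (p 1 (h 0 x)) + H 0 (\<lambda>y. f (p 1 y)) x"
        by (simp only: distrib_right mult.assoc ts[OF f x] h(2)[OF x] H(3)[OF f x])
    next
      fix i f x assume f: "f \<in> ?C" and x: "x \<in> carrier F"
      have "t * f x = f (p (Suc (Suc i)) (h (Suc i) x)) + f (h i (p (Suc i) x))"
        using module_homs_add[OF f, of "p (Suc (Suc i)) (h (Suc i) x)" "h i (p (Suc i) x)"]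
        by (simp only: ts[OF f x] h(3)[OF x, of i] pc hc x ring_algebra_simps)
      then show "(c * t + u) * f x =
          c * f (p (Suc (Suc i)) (h (Suc i) x)) + H (Suc i) (\<lambda>y. f (p (Suc (Suc i)) y)) x +
          (c * f (h i (p (Suc i) x)) + H i f (p (Suc i) x))"
        using H(4)[OF f x, of i] by (simp add: algebra_simps)
    qed
  qed
qed

text \<open>
  Rees' argument. The ideal \<open>J m\<close> plays the role of \<open>(t 0, \<dots>, t (m - 1))\<close>. If \<open>f\<close> is a cocycle
  modulo \<open>J m\<close>, the homotopy for \<open>t m\<close> makes \<open>t m \<cdot> f\<close> congruent to the coboundary of some \<open>g\<close>. Then \<open>g\<close>
  is a cocycle modulo \<open>J (Suc m)\<close> of one degree less, hence by induction of the form coboundary plus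
  \<open>t m \<cdot> w\<close> modulo \<open>J m\<close>. Cancelling the nonzerodivisor \<open>t m\<close> shows that \<open>f\<close> is the coboundary of \<open>w\<close>.
  Homomorphisms from free modules lift along quotients, so \<open>w\<close> exists as an honest cochain.
\<close>
lemma cochain_exact:
  fixes J :: "nat \<Rightarrow> 'r::comm_ring_1 set"
  assumes \<iota>: "ring_hom_into \<iota>" and p: "free_resolution K p"
    and J: "\<And>m. ring_ideal (J m)"
    and t: "\<And>m. m < d \<Longrightarrow> null_homotopic \<iota> p (t m)"
    and regular: "\<And>m a. m < d \<Longrightarrow> t m * a \<in> J m \<Longrightarrow> a \<in> J m"
    and J_Suc: "\<And>m. m < d \<Longrightarrow> J (Suc m) = {u + t m * v | u v. u \<in> J m}"
    and f: "f \<in> cochains \<iota>"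
    and fJ: "\<And>x. x \<in> carrier F \<Longrightarrow> f (p (Suc j) x) \<in> J m"
    and "j + m < d"
  shows "\<exists>g\<in>cochains \<iota>. \<forall>x\<in>carrier F. f x - g (p j x) \<in> J m"
  using f fJ \<open>j + m < d\<close>
proof (induction j arbitrary: f m)
  let ?C = "cochains \<iota>"
  note Fm = free_module_module and Am = ring_algebra_module[OF \<iota>]
  interpret F: Module.module R F by (rule Fm)
  note ph = free_resolution_hom[OF p] and pc = free_resolution_closed[OF p]
  {
    case 0
    have m: "m < d" using 0 by simp
    obtain H where H: "null_homotopy \<iota> p (t m) H" using t[OF m] unfolding null_homotopic_def by blast
    note H = null_homotopyD[OF H]
    have "f x \<in> J m" if x: "x \<in> carrier F" for x
    proof -
      have "H 0 (\<lambda>y. f (p 1 y)) ` carrier F \<subseteq> J m"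
        using 0 by (intro H(2) module_homs_comp[OF _ ph] J) auto
      then have "t m * f x \<in> J m" using H(3)[OF 0(1) x] x by auto
      then show ?thesis by (rule regular[OF m])
    qed
    then show ?case
      using module_homs_const_zero[OF Am, of F] by (intro bexI[of _ "\<lambda>x. 0"]) auto
  next
    case (Suc j)
    have m: "m < d" using Suc by simp
    obtain H where H: "null_homotopy \<iota> p (t m) H" using t[OF m] unfolding null_homotopic_def by blast
    note H = null_homotopyD[OF H]
    \<comment> \<open>modulo \<open>J m\<close>, the multiple \<open>t m \<cdot> f\<close> is the coboundary of \<open>g\<close>\<close>
    define g where "g = H j f"
    have g: "g \<in> ?C" unfolding g_def using H(1) Suc.prems(1) by blast
    have tf: "t m * f x - g (p (Suc j) x) \<in> J m" if x: "x \<in> carrier F" for x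
    proof -
      have "H (Suc j) (\<lambda>y. f (p (Suc (Suc j)) y)) ` carrier F \<subseteq> J m"
        using Suc.prems by (intro H(2) module_homs_comp[OF _ ph] J) auto
      then show ?thesis using H(4)[OF Suc.prems(1) x, of j] x by (auto simp: g_def)
    qed
    have "g (p (Suc j) x) \<in> J (Suc m)" if x: "x \<in> carrier F" for x
    proof -
      have "0 - (t m * f x - g (p (Suc j) x)) \<in> J m"
        using J[of m] by (intro ring_ideal_diff tf x) (auto simp: ring_ideal_iff)
      moreover have "g (p (Suc j) x) = (0 - (t m * f x - g (p (Suc j) x))) + t m * f x" by simp
      ultimately show ?thesis unfolding J_Suc[OF m] by blast
    qed
    then obtain g' where g': "g' \<in> ?C" "\<And>x. x \<in> carrier F \<Longrightarrow> g x - g' (p j x) \<in> J (Suc m)"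
      using Suc.IH[OF g, of "Suc m"] Suc.prems(3) by auto
    define k where "k x = g x - g' (p j x)" for x
    have "\<exists>w. k (unit_vector R i) - t m * w \<in> J m" for i
    proof -
      obtain u v where "k (unit_vector R i) = u + t m * v" "u \<in> J m"
        using g'(2)[OF unit_vector_closed] unfolding k_def J_Suc[OF m] by blast
      then have "k (unit_vector R i) - t m * v \<in> J m" by simp
      then show ?thesis by blast
    qed
    then obtain w0 where w0: "\<And>i. k (unit_vector R i) - t m * w0 i \<in> J m" by metis
    obtain w where w: "w \<in> ?C" "\<And>i. w (unit_vector R i) = w0 i"
      using free_module_hom_ex[OF Am, of w0] by auto
    have kw: "(\<lambda>x. k x - t m * w x) \<in> ?C"
      using module_homs_add[OF g] module_homs_smult[OF g] module_homs_add[OF ph]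
        module_homs_smult[OF ph] module_homs_add[OF g'(1)] module_homs_smult[OF g'(1)]
        module_homs_add[OF w(1)] module_homs_smult[OF w(1)]
      by (intro ring_algebra_homsI) (auto simp: k_def algebra_simps pc)
    have kwJ: "k x - t m * w x \<in> J m" if x: "x \<in> carrier F" for x
      by (rule free_module_hom_image_subset[OF Am kw _ _ x])
        (use J[of m] w w0 in \<open>auto simp: submodule_set_def ring_ideal_iff\<close>)
    have "f x - w (p (Suc j) x) \<in> J m" if x: "x \<in> carrier F" for x
    proof (rule regular[OF m])
      have "k (p (Suc j) x) = g (p (Suc j) x)"
        by (simp add: k_def free_resolution_complex[OF p x] module_homs_zero[OF Fm Am g'(1)])
      then have "g (p (Suc j) x) - t m * w (p (Suc j) x) \<in> J m" using kwJ[OF pc[OF x], of "Suc j"] by simp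
      from ring_ideal_add[OF J tf[OF x] this]
      show "t m * (f x - w (p (Suc j) x)) \<in> J m" by (simp add: algebra_simps)
    qed
    then show ?case using w(1) by blast
  }
qed

section \<open>Comparing free and injective resolutions\<close>

lemma ring_module_module: "Module.module R (ring_module R)"
proof (rule moduleI[OF is_cring])
  show "abelian_group (ring_module R)"
  proof (rule abelian_groupI)
    fix x assume "x \<in> carrier (ring_module R)"
    then show "\<exists>y\<in>carrier (ring_module R). y \<oplus>\<^bsub>ring_module R\<^esub> x = \<zero>\<^bsub>ring_module R\<^esub>"
      by (intro bexI[of _ "\<ominus> x"]) (auto simp: ring_module_def l_neg)
  qed (auto simp: ring_module_def a_ac)
qed (auto simp: ring_module_def l_distr r_distr m_assoc)

lemma injective_resolutionD:
  assumes "injective_resolution R M \<epsilon> E \<delta>"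
  shows "injective_module R (E n)" "Module.module R (E n)"
    "\<epsilon> \<in> module_homs R M (E 0)" "inj_on \<epsilon> (carrier M)" "\<delta> n \<in> module_homs R (E n) (E (Suc n))"
    "x \<in> carrier (E 0) \<Longrightarrow> \<delta> 0 x = \<zero>\<^bsub>E 1\<^esub> \<Longrightarrow> x \<in> \<epsilon> ` carrier M"
    "m \<in> carrier M \<Longrightarrow> \<delta> 0 (\<epsilon> m) = \<zero>\<^bsub>E 1\<^esub>"
    "y \<in> carrier (E (Suc n)) \<Longrightarrow> \<delta> (Suc n) y = \<zero>\<^bsub>E (Suc (Suc n))\<^esub> \<Longrightarrow> y \<in> \<delta> n ` carrier (E n)"
    "z \<in> carrier (E n) \<Longrightarrow> \<delta> (Suc n) (\<delta> n z) = \<zero>\<^bsub>E (Suc (Suc n))\<^esub>"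
proof -
  show "injective_module R (E n)" "\<epsilon> \<in> module_homs R M (E 0)" "inj_on \<epsilon> (carrier M)"
    "\<delta> n \<in> module_homs R (E n) (E (Suc n))"
    using assms by (simp_all add: injective_resolution_def)
  then show "Module.module R (E n)" by (simp add: injective_module_def)
  have im: "\<epsilon> ` carrier M = {x \<in> carrier (E 0). \<delta> 0 x = \<zero>\<^bsub>E 1\<^esub>}"
    "\<delta> n ` carrier (E n) = {x \<in> carrier (E (Suc n)). \<delta> (Suc n) x = \<zero>\<^bsub>E (Suc (Suc n))\<^esub>}"
    using assms by (simp_all only: injective_resolution_def)
  show "x \<in> carrier (E 0) \<Longrightarrow> \<delta> 0 x = \<zero>\<^bsub>E 1\<^esub> \<Longrightarrow> x \<in> \<epsilon> ` carrier M"
    "m \<in> carrier M \<Longrightarrow> \<delta> 0 (\<epsilon> m) = \<zero>\<^bsub>E 1\<^esub>"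
    "y \<in> carrier (E (Suc n)) \<Longrightarrow> \<delta> (Suc n) y = \<zero>\<^bsub>E (Suc (Suc n))\<^esub> \<Longrightarrow> y \<in> \<delta> n ` carrier (E n)"
    "z \<in> carrier (E n) \<Longrightarrow> \<delta> (Suc n) (\<delta> n z) = \<zero>\<^bsub>E (Suc (Suc n))\<^esub>"
    using im by blast+
qed

text \<open>
  The assumption \<open>ext\<close> says that \<open>a\<close> kills the cohomology of \<open>R\<close>-valued cochains on the free
  resolution; the claim is that it kills the cohomology of the double complex of homomorphisms from
  the free to the injective resolution, along one edge. A cocycle \<open>\<phi>\<close> with values in \<open>E (Suc k)\<close> is
  \<open>\<delta> u\<close> with \<open>u\<close> defined one step further down, and the restriction of \<open>u\<close> to boundaries is a cocycle
  with values in \<open>E k\<close>. Repeating this ends with values in \<open>E 0\<close>, that is in the kernel of \<open>\<delta> 0\<close>, a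
  copy of \<open>R\<close>.
\<close>
lemma cocycle_boundary:
  fixes E :: "nat \<Rightarrow> ('a, 'm) module"
  assumes res: "injective_resolution R (ring_module R) \<epsilon> E \<delta>" and p: "free_resolution K p"
    and fin: "countable (carrier R)" "infinite (UNIV :: 'm set)"
    and a: "a \<in> carrier R"
    and ext: "\<And>i \<psi>. i < d \<Longrightarrow> \<psi> \<in> module_homs R F (ring_module R) \<Longrightarrow>
      (\<And>x. x \<in> carrier F \<Longrightarrow> \<psi> (p (Suc i) x) = \<zero>) \<Longrightarrow>
      \<exists>w\<in>module_homs R F (ring_module R). \<forall>x\<in>carrier F. a \<otimes> \<psi> x = w (p i x)"
  shows cocycle_boundary_0: "\<phi> \<in> module_homs R F (E 0) \<Longrightarrow> i < d \<Longrightarrow>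
      (\<And>x. x \<in> carrier F \<Longrightarrow> \<delta> 0 (\<phi> x) = \<zero>\<^bsub>E 1\<^esub>) \<Longrightarrow>
      (\<And>x. x \<in> carrier F \<Longrightarrow> \<phi> (p (Suc i) x) = \<zero>\<^bsub>E 0\<^esub>) \<Longrightarrow>
      \<exists>W\<in>module_homs R F (E 0). \<forall>x\<in>carrier F.
        a \<odot>\<^bsub>E 0\<^esub> \<phi> x = W (p i x) \<and> \<delta> 0 (W x) = \<zero>\<^bsub>E 1\<^esub>"
    and cocycle_boundary_Suc: "\<phi> \<in> module_homs R F (E (Suc k)) \<Longrightarrow> Suc k + i < d \<Longrightarrow>
      (\<And>x. x \<in> carrier F \<Longrightarrow> \<delta> (Suc k) (\<phi> x) = \<zero>\<^bsub>E (Suc (Suc k))\<^esub>) \<Longrightarrow>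
      (\<And>x. x \<in> carrier F \<Longrightarrow> \<phi> (p (Suc i) x) = \<zero>\<^bsub>E (Suc k)\<^esub>) \<Longrightarrow>
      \<exists>\<chi>\<in>module_homs R F (E k). \<forall>x\<in>carrier F.
        a \<odot>\<^bsub>E (Suc k)\<^esub> \<phi> x = \<delta> k (\<chi> x) \<and> \<chi> (p (Suc i) x) = \<zero>\<^bsub>E k\<^esub>"
proof -
  note Fm = free_module_module and Rm = ring_module_module
  interpret F: Module.module R F by (rule Fm)
  note ph = free_resolution_hom[OF p] and pc = free_resolution_closed[OF p]
  note rD = injective_resolutionD[OF res]
  note \<delta> = rD(5)
  show zero: "\<exists>W\<in>module_homs R F (E 0). \<forall>x\<in>carrier F.
        a \<odot>\<^bsub>E 0\<^esub> \<phi> x = W (p i x) \<and> \<delta> 0 (W x) = \<zero>\<^bsub>E 1\<^esub>"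
    if \<phi>: "\<phi> \<in> module_homs R F (E 0)" and i: "i < d"
      and d\<phi>: "\<And>x. x \<in> carrier F \<Longrightarrow> \<delta> 0 (\<phi> x) = \<zero>\<^bsub>E 1\<^esub>"
      and \<phi>p: "\<And>x. x \<in> carrier F \<Longrightarrow> \<phi> (p (Suc i) x) = \<zero>\<^bsub>E 0\<^esub>" for \<phi> i
  proof -
    have "\<phi> x \<in> \<epsilon> ` carrier (ring_module R)" if "x \<in> carrier F" for x
      using rD(6) d\<phi>[OF that] module_homs_closed[OF \<phi> that] by blast
    then obtain \<psi> where \<psi>: "\<psi> \<in> module_homs R F (ring_module R)"
        "\<And>x. x \<in> carrier F \<Longrightarrow> \<epsilon> (\<psi> x) = \<phi> x"
      using free_module_lift[OF rD(2) Rm rD(3) \<phi>] by metis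
    have \<psi>c: "\<psi> x \<in> carrier R" if "x \<in> carrier F" for x
      using module_homs_closed[OF \<psi>(1) that] by (simp add: ring_module_def)
    have \<epsilon>0: "\<epsilon> \<zero> = \<zero>\<^bsub>E 0\<^esub>" using module_homs_zero[OF Rm rD(2) rD(3)] by (simp add: ring_module_def)
    have "\<psi> (p (Suc i) x) = \<zero>" if x: "x \<in> carrier F" for x
    proof (rule inj_onD[OF rD(4)])
      show "\<epsilon> (\<psi> (p (Suc i) x)) = \<epsilon> \<zero>" using \<phi>p[OF x] \<psi>(2)[OF pc[OF x]] \<epsilon>0 by simp
    qed (use \<psi>c pc x in \<open>auto simp: ring_module_def\<close>)
    then obtain w where w: "w \<in> module_homs R F (ring_module R)"
        "\<And>x. x \<in> carrier F \<Longrightarrow> a \<otimes> \<psi> x = w (p i x)"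
      using ext[OF i \<psi>(1)] by metis
    have "a \<odot>\<^bsub>E 0\<^esub> \<phi> x = \<epsilon> (w (p i x))" if x: "x \<in> carrier F" for x
      using module_homs_smult[OF rD(3) a, of "\<psi> x"] \<psi>(2)[OF x] \<psi>c[OF x] w(2)[OF x]
      by (simp add: ring_module_def)
    moreover have "\<delta> 0 (\<epsilon> (w x)) = \<zero>\<^bsub>E 1\<^esub>" if x: "x \<in> carrier F" for x
      using rD(7) module_homs_closed[OF w(1) x] by simp
    ultimately show ?thesis
      using module_homs_comp[OF rD(3) w(1)] by (intro bexI[of _ "\<lambda>x. \<epsilon> (w x)"]) auto
  qed
  have lift: "\<exists>u\<in>module_homs R F (E k). \<forall>x\<in>carrier F. \<delta> k (u x) = \<phi> x"
    if \<phi>: "\<phi> \<in> module_homs R F (E (Suc k))"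
      and d\<phi>: "\<And>x. x \<in> carrier F \<Longrightarrow> \<delta> (Suc k) (\<phi> x) = \<zero>\<^bsub>E (Suc (Suc k))\<^esub>" for \<phi> k
  proof -
    have "\<phi> x \<in> \<delta> k ` carrier (E k)" if "x \<in> carrier F" for x
      using rD(8) d\<phi>[OF that] module_homs_closed[OF \<phi> that] by blast
    then show ?thesis using free_module_lift[OF rD(2) rD(2) \<delta> \<phi>] by metis
  qed
  \<comment> \<open>if \<open>a u = W\<close> on boundaries, then \<open>a u - W\<close> is the required cochain\<close>
  have correct: "\<exists>\<chi>\<in>module_homs R F (E k). \<forall>x\<in>carrier F.
        a \<odot>\<^bsub>E (Suc k)\<^esub> \<phi> x = \<delta> k (\<chi> x) \<and> \<chi> (p i x) = \<zero>\<^bsub>E k\<^esub>"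
    if u: "u \<in> module_homs R F (E k)" "\<And>x. x \<in> carrier F \<Longrightarrow> \<delta> k (u x) = \<phi> x"
      and W: "W \<in> module_homs R F (E k)" "\<And>x. x \<in> carrier F \<Longrightarrow> \<delta> k (W x) = \<zero>\<^bsub>E (Suc k)\<^esub>"
        "\<And>x. x \<in> carrier F \<Longrightarrow> a \<odot>\<^bsub>E k\<^esub> u (p i x) = W (p i x)" for u W \<phi> k i
  proof -
    interpret Ek: Module.module R "E k" by (rule rD(2))
    interpret ESk: Module.module R "E (Suc k)" by (rule rD(2))
    note uc = module_homs_closed[OF u(1)] and Wc = module_homs_closed[OF W(1)]
    have "\<delta> k (a \<odot>\<^bsub>E k\<^esub> u x \<ominus>\<^bsub>E k\<^esub> W x) = a \<odot>\<^bsub>E (Suc k)\<^esub> \<phi> x" if x: "x \<in> carrier F" for x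
    proof -
      have "\<delta> k (a \<odot>\<^bsub>E k\<^esub> u x \<ominus>\<^bsub>E k\<^esub> W x) = \<delta> k (a \<odot>\<^bsub>E k\<^esub> u x) \<ominus>\<^bsub>E (Suc k)\<^esub> \<delta> k (W x)"
        using a uc[OF x] Wc[OF x] by (intro module_homs_minus[OF rD(2) rD(2) \<delta>]) auto
      also have "\<dots> = a \<odot>\<^bsub>E (Suc k)\<^esub> \<phi> x \<ominus>\<^bsub>E (Suc k)\<^esub> \<zero>\<^bsub>E (Suc k)\<^esub>"
        using u(2)[OF x] W(2)[OF x] module_homs_smult[OF \<delta> a uc[OF x]] by simp
      also have "\<dots> = a \<odot>\<^bsub>E (Suc k)\<^esub> \<phi> x"
        using a module_homs_closed[OF \<delta> uc[OF x]] u(2)[OF x] by (simp add: a_minus_def)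
      finally show ?thesis .
    qed
    moreover have "a \<odot>\<^bsub>E k\<^esub> u (p i x) \<ominus>\<^bsub>E k\<^esub> W (p i x) = \<zero>\<^bsub>E k\<^esub>" if x: "x \<in> carrier F" for x
      using W(3)[OF x] a uc[OF pc[OF x]] Wc[OF pc[OF x]] by (simp add: Ek.M.diff_eq_zero_iff)
    moreover have "(\<lambda>x. a \<odot>\<^bsub>E k\<^esub> u x \<ominus>\<^bsub>E k\<^esub> W x) \<in> module_homs R F (E k)"
      by (intro module_homs_diff module_homs_scale rD(2) u(1) W(1) a)
    ultimately show ?thesis by (intro bexI[of _ "\<lambda>x. a \<odot>\<^bsub>E k\<^esub> u x \<ominus>\<^bsub>E k\<^esub> W x"]) auto
  qed
  \<comment> \<open>\<open>a \<phi>\<close> extends along \<open>p (Suc i)\<close> to a cochain with values in cocycles\<close>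
  have descent: "\<exists>W\<in>module_homs R F (E k). \<forall>x\<in>carrier F.
        a \<odot>\<^bsub>E k\<^esub> \<phi> x = W (p (Suc i) x) \<and> \<delta> k (W x) = \<zero>\<^bsub>E (Suc k)\<^esub>"
    if "\<phi> \<in> module_homs R F (E k)" "k + Suc i < d"
      "\<And>x. x \<in> carrier F \<Longrightarrow> \<delta> k (\<phi> x) = \<zero>\<^bsub>E (Suc k)\<^esub>"
      "\<And>x. x \<in> carrier F \<Longrightarrow> \<phi> (p (Suc (Suc i)) x) = \<zero>\<^bsub>E k\<^esub>" for \<phi> k i
    using that
  proof (induction k arbitrary: \<phi> i)
    case 0
    then show ?case using zero[of \<phi> "Suc i"] by simp
  next
    case (Suc k)
    obtain u where u: "u \<in> module_homs R F (E k)" "\<And>x. x \<in> carrier F \<Longrightarrow> \<delta> k (u x) = \<phi> x"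
      using lift[OF Suc.prems(1,3)] by blast
    have "\<delta> k (u (p (Suc (Suc i)) x)) = \<zero>\<^bsub>E (Suc k)\<^esub>" if "x \<in> carrier F" for x
      using u(2)[OF pc[OF that]] Suc.prems(4)[OF that] by simp
    moreover have "u (p (Suc (Suc i)) (p (Suc (Suc (Suc i))) x)) = \<zero>\<^bsub>E k\<^esub>" if "x \<in> carrier F" for x
      by (simp add: free_resolution_complex[OF p that] module_homs_zero[OF Fm rD(2) u(1)])
    ultimately obtain W where W: "W \<in> module_homs R F (E k)"
        "\<And>x. x \<in> carrier F \<Longrightarrow> a \<odot>\<^bsub>E k\<^esub> u (p (Suc (Suc i)) x) = W (p (Suc (Suc i)) x)"
        "\<And>x. x \<in> carrier F \<Longrightarrow> \<delta> k (W x) = \<zero>\<^bsub>E (Suc k)\<^esub>"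
      using Suc.IH[OF module_homs_comp[OF u(1) ph], of "Suc i" "Suc (Suc i)"] Suc.prems(2) by auto
    obtain \<chi> where \<chi>: "\<chi> \<in> module_homs R F (E k)"
        "\<And>x. x \<in> carrier F \<Longrightarrow> a \<odot>\<^bsub>E (Suc k)\<^esub> \<phi> x = \<delta> k (\<chi> x)"
        "\<And>x. x \<in> carrier F \<Longrightarrow> \<chi> (p (Suc (Suc i)) x) = \<zero>\<^bsub>E k\<^esub>"
      using correct[OF u W(1,3,2)] by blast
    have "\<chi> x = \<zero>\<^bsub>E k\<^esub>" if x: "x \<in> carrier F" "p (Suc i) x = \<zero>\<^bsub>F\<^esub>" for x
    proof -
      have "x \<in> p (Suc (Suc i)) ` carrier F" using x p by (simp add: free_resolution_def)
      then show ?thesis using \<chi>(3) by blast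
    qed
    then obtain v where v: "v \<in> module_homs R F (E k)" "\<And>x. x \<in> carrier F \<Longrightarrow> v (p (Suc i) x) = \<chi> x"
      using injective_module_extend[OF rD(1) fin \<chi>(1) ph] by metis
    have "(\<lambda>x. \<delta> k (v x)) \<in> module_homs R F (E (Suc k))" by (rule module_homs_comp[OF \<delta> v(1)])
    moreover have "\<delta> (Suc k) (\<delta> k (v x)) = \<zero>\<^bsub>E (Suc (Suc k))\<^esub>" if "x \<in> carrier F" for x
      using rD(9) module_homs_closed[OF v(1) that] by blast
    ultimately show ?case using \<chi>(2) v(2) by (intro bexI[of _ "\<lambda>x. \<delta> k (v x)"]) auto
  qed
  show "\<exists>\<chi>\<in>module_homs R F (E k). \<forall>x\<in>carrier F.
        a \<odot>\<^bsub>E (Suc k)\<^esub> \<phi> x = \<delta> k (\<chi> x) \<and> \<chi> (p (Suc i) x) = \<zero>\<^bsub>E k\<^esub>"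
    if \<phi>: "\<phi> \<in> module_homs R F (E (Suc k))" and ki: "Suc k + i < d"
      and d\<phi>: "\<And>x. x \<in> carrier F \<Longrightarrow> \<delta> (Suc k) (\<phi> x) = \<zero>\<^bsub>E (Suc (Suc k))\<^esub>"
      and \<phi>p: "\<And>x. x \<in> carrier F \<Longrightarrow> \<phi> (p (Suc i) x) = \<zero>\<^bsub>E (Suc k)\<^esub>"
  proof -
    obtain u where u: "u \<in> module_homs R F (E k)" "\<And>x. x \<in> carrier F \<Longrightarrow> \<delta> k (u x) = \<phi> x"
      using lift[OF \<phi> d\<phi>] by blast
    have "\<delta> k (u (p (Suc i) x)) = \<zero>\<^bsub>E (Suc k)\<^esub>" if "x \<in> carrier F" for x
      using u(2)[OF pc[OF that]] \<phi>p[OF that] by simp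
    moreover have "u (p (Suc i) (p (Suc (Suc i)) x)) = \<zero>\<^bsub>E k\<^esub>" if "x \<in> carrier F" for x
      by (simp add: free_resolution_complex[OF p that] module_homs_zero[OF Fm rD(2) u(1)])
    ultimately obtain W where W: "W \<in> module_homs R F (E k)"
        "\<And>x. x \<in> carrier F \<Longrightarrow> a \<odot>\<^bsub>E k\<^esub> u (p (Suc i) x) = W (p (Suc i) x)"
        "\<And>x. x \<in> carrier F \<Longrightarrow> \<delta> k (W x) = \<zero>\<^bsub>E (Suc k)\<^esub>"
      using descent[OF module_homs_comp[OF u(1) ph], of i "Suc i"] ki by auto
    show ?thesis using correct[OF u W(1,3,2)] by blast
  qed
qed

end

section \<open>Annihilators of local cohomology\<close>

text \<open>
  Weakly regular: the ring modulo the sequence may be zero, as for a sequence of units.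
\<close>
definition regular_sequence :: "nat \<Rightarrow> (nat \<Rightarrow> 'r::comm_ring_1) \<Rightarrow> bool" where
  "regular_sequence d t \<longleftrightarrow>
     (\<forall>m<d. \<forall>a. t m * a \<in> ideal_span (t ` {..<m}) \<longrightarrow> a \<in> ideal_span (t ` {..<m}))"

context cring begin

lemma ideal_power_simps:
  "I [^]\<^bsub>ideals_set R\<^esub> (0::nat) = carrier R"
  "I [^]\<^bsub>ideals_set R\<^esub> Suc n = ideal_prod R (I [^]\<^bsub>ideals_set R\<^esub> n) I"
proof -
  interpret ideals: comm_monoid "ideals_set R" by (rule ideals_set_is_comm_monoid)
  show "I [^]\<^bsub>ideals_set R\<^esub> (0::nat) = carrier R"
    "I [^]\<^bsub>ideals_set R\<^esub> Suc n = ideal_prod R (I [^]\<^bsub>ideals_set R\<^esub> n) I"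
    by (simp_all add: ideals.nat_pow_0 ideals.nat_pow_Suc) (simp_all add: ideals_set_def)
qed

lemma ideal_power_closed:
  assumes "I \<subseteq> carrier R"
  shows "I [^]\<^bsub>ideals_set R\<^esub> (n::nat) \<subseteq> carrier R"
proof (induction n)
  case (Suc n)
  have "s \<in> carrier R" if "s \<in> ideal_prod R (I [^]\<^bsub>ideals_set R\<^esub> n) I" for s
    using that by (induction s rule: ideal_prod.induct) (use Suc assms in auto)
  then show ?case unfolding ideal_power_simps by blast
qed (simp only: ideal_power_simps)

text \<open>
  Stated for annihilators rather than as an inclusion of powers, so that \<open>I\<close> may be any set of
  ring elements.
\<close>
lemma ideal_power_annihilates_mono:
  assumes "Module.module R M" "I \<subseteq> carrier R" "x \<in> carrier M"
    and "\<forall>a\<in>I [^]\<^bsub>ideals_set R\<^esub> (n::nat). a \<odot>\<^bsub>M\<^esub> x = \<zero>\<^bsub>M\<^esub>" "n \<le> k"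
  shows "\<forall>a\<in>I [^]\<^bsub>ideals_set R\<^esub> k. a \<odot>\<^bsub>M\<^esub> x = \<zero>\<^bsub>M\<^esub>"
  using assms(5)
proof (induction k rule: dec_induct)
  case base
  then show ?case by (rule assms(4))
next
  case (step k)
  interpret M: Module.module R M by fact
  have "s \<in> carrier R \<and> s \<odot>\<^bsub>M\<^esub> x = \<zero>\<^bsub>M\<^esub>" if "s \<in> ideal_prod R (I [^]\<^bsub>ideals_set R\<^esub> k) I" for s
    using that
  proof (induction s rule: ideal_prod.induct)
    case (prod i j)
    have ij: "i \<in> carrier R" "j \<in> carrier R"
      using prod ideal_power_closed[OF assms(2)] assms(2) by auto
    have "(i \<otimes> j) \<odot>\<^bsub>M\<^esub> x = j \<odot>\<^bsub>M\<^esub> (i \<odot>\<^bsub>M\<^esub> x)"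
      using ij assms(3) by (simp add: m_comm[of i j] M.smult_assoc1)
    then show ?case using ij prod step.IH by simp
  next
    case (sum s1 s2)
    then show ?case using assms(3) by (simp add: M.smult_l_distr)
  qed
  then show ?case unfolding ideal_power_simps by blast
qed

lemma torsion_submodule:
  assumes "Module.module R M" "I \<subseteq> carrier R"
  shows "submodule_set R M (carrier (torsion R I M))"
proof -
  interpret M: Module.module R M by fact
  note closed = ideal_power_closed[OF assms(2), THEN subsetD]
  have "x \<oplus>\<^bsub>M\<^esub> y \<in> carrier (torsion R I M)"
    if xy: "x \<in> carrier (torsion R I M)" "y \<in> carrier (torsion R I M)" for x y
  proof -
    obtain n k where x: "x \<in> carrier M" "\<forall>a\<in>I [^]\<^bsub>ideals_set R\<^esub> (n::nat). a \<odot>\<^bsub>M\<^esub> x = \<zero>\<^bsub>M\<^esub>"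
      and y: "y \<in> carrier M" "\<forall>a\<in>I [^]\<^bsub>ideals_set R\<^esub> (k::nat). a \<odot>\<^bsub>M\<^esub> y = \<zero>\<^bsub>M\<^esub>"
      using xy by (auto simp: torsion_def)
    have "a \<odot>\<^bsub>M\<^esub> (x \<oplus>\<^bsub>M\<^esub> y) = \<zero>\<^bsub>M\<^esub>" if "a \<in> I [^]\<^bsub>ideals_set R\<^esub> (max n k)" for a
      using ideal_power_annihilates_mono[OF assms x, of "max n k"]
        ideal_power_annihilates_mono[OF assms y, of "max n k"] closed[OF that] that x(1) y(1)
      by (simp add: M.smult_r_distr)
    then show ?thesis using x(1) y(1) by (auto simp: torsion_def)
  qed
  moreover have "b \<odot>\<^bsub>M\<^esub> x \<in> carrier (torsion R I M)"
    if b: "b \<in> carrier R" and "x \<in> carrier (torsion R I M)" for b x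
  proof -
    obtain n where x: "x \<in> carrier M" "\<forall>a\<in>I [^]\<^bsub>ideals_set R\<^esub> (n::nat). a \<odot>\<^bsub>M\<^esub> x = \<zero>\<^bsub>M\<^esub>"
      using \<open>x \<in> carrier (torsion R I M)\<close> by (auto simp: torsion_def)
    have "a \<odot>\<^bsub>M\<^esub> (b \<odot>\<^bsub>M\<^esub> x) = \<zero>\<^bsub>M\<^esub>" if a: "a \<in> I [^]\<^bsub>ideals_set R\<^esub> n" for a
    proof -
      have "a \<odot>\<^bsub>M\<^esub> (b \<odot>\<^bsub>M\<^esub> x) = b \<odot>\<^bsub>M\<^esub> (a \<odot>\<^bsub>M\<^esub> x)"
        using closed[OF a] b x(1) by (simp add: M.smult_assoc1[symmetric] m_comm[of a b])
      then show ?thesis using a b x by simp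
    qed
    then show ?thesis using x(1) b by (auto simp: torsion_def)
  qed
  moreover have "\<zero>\<^bsub>M\<^esub> \<in> carrier (torsion R I M)" using closed by (auto simp: torsion_def)
  ultimately show ?thesis by (auto simp: submodule_set_def torsion_def)
qed

lemma quotient_module_annihilates:
  assumes "Module.module R M" "submodule_set R M N" "L \<subseteq> carrier M" "a \<in> carrier R"
    and "\<And>x. x \<in> L \<Longrightarrow> a \<odot>\<^bsub>M\<^esub> x \<in> N"
  shows "a \<in> annihilator R (quotient_module (M\<lparr>carrier := L\<rparr>) N)"
proof -
  interpret M: Module.module R M by fact
  have N: "N \<subseteq> carrier M" "\<zero>\<^bsub>M\<^esub> \<in> N" "\<And>x y. x \<in> N \<Longrightarrow> y \<in> N \<Longrightarrow> x \<oplus>\<^bsub>M\<^esub> y \<in> N"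
    "\<And>s x. s \<in> carrier R \<Longrightarrow> x \<in> N \<Longrightarrow> s \<odot>\<^bsub>M\<^esub> x \<in> N"
    using assms(2) by (auto simp: submodule_set_def)
  have coset: "N +>\<^bsub>M\<lparr>carrier := L\<rparr>\<^esub> x = {h \<oplus>\<^bsub>M\<^esub> x | h. h \<in> N}" for x
    by (auto simp: a_r_coset_def r_coset_def)
  have rcosets: "a_rcosets\<^bsub>M\<lparr>carrier := L\<rparr>\<^esub> N = {{h \<oplus>\<^bsub>M\<^esub> x | h. h \<in> N} | x. x \<in> L}"
    unfolding coset[symmetric] unfolding A_RCOSETS_def RCOSETS_def a_r_coset_def by auto
  have coset_N: "{h \<oplus>\<^bsub>M\<^esub> x | h. h \<in> N} = N" if x: "x \<in> N" for x
  proof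
    show "N \<subseteq> {h \<oplus>\<^bsub>M\<^esub> x | h. h \<in> N}"
    proof
      fix y assume y: "y \<in> N"
      have xy: "x \<in> carrier M" "y \<in> carrier M" using x y N(1) by auto
      have "\<ominus>\<^bsub>M\<^esub> x = (\<ominus> \<one>) \<odot>\<^bsub>M\<^esub> x" using xy by (simp add: M.smult_l_minus)
      then have "y \<oplus>\<^bsub>M\<^esub> \<ominus>\<^bsub>M\<^esub> x \<in> N" using x y N(3,4) by simp
      moreover have "(y \<oplus>\<^bsub>M\<^esub> \<ominus>\<^bsub>M\<^esub> x) \<oplus>\<^bsub>M\<^esub> x = y" using xy by (simp add: M.M.a_assoc M.M.l_neg)
      ultimately show "y \<in> {h \<oplus>\<^bsub>M\<^esub> x | h. h \<in> N}" by (metis (mono_tags, lifting) mem_Collect_eq)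
    qed
  qed (use x N(3) in auto)
  have "(\<Union>z\<in>C. N +>\<^bsub>M\<lparr>carrier := L\<rparr>\<^esub> (a \<odot>\<^bsub>M\<^esub> z)) = N"
    if C: "C \<in> a_rcosets\<^bsub>M\<lparr>carrier := L\<rparr>\<^esub> N" for C
  proof -
    obtain x where x: "x \<in> L" "C = {h \<oplus>\<^bsub>M\<^esub> x | h. h \<in> N}"
      using C unfolding rcosets by blast
    have "a \<odot>\<^bsub>M\<^esub> z \<in> N" if z: "z \<in> C" for z
    proof -
      obtain h where h: "h \<in> N" "z = h \<oplus>\<^bsub>M\<^esub> x" using z x(2) by blast
      then have "h \<in> carrier M" "x \<in> carrier M" using N(1) x(1) assms(3) by auto
      then have "a \<odot>\<^bsub>M\<^esub> z = a \<odot>\<^bsub>M\<^esub> h \<oplus>\<^bsub>M\<^esub> a \<odot>\<^bsub>M\<^esub> x"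
        using h(2) assms(4) by (simp add: M.smult_r_distr)
      then show ?thesis using N(3,4) h(1) assms(4,5) x(1) by simp
    qed
    moreover have "C \<noteq> {}" using x N(2) by blast
    ultimately show ?thesis by (simp add: coset coset_N)
  qed
  then show ?thesis using assms(4) by (simp add: annihilator_def quotient_module_def)
qed

lemma span_insert_image:
  fixes t :: "nat \<Rightarrow> 'r::comm_ring_1"
  shows "ideal_span (t ` {..<Suc m}) = {u + t m * v | u v. u \<in> ideal_span (t ` {..<m})}"
proof -
  have "ideal_span (t ` {..<Suc m}) = {x. \<exists>k. x - k * t m \<in> ideal_span (t ` {..<m})}"
    by (simp add: lessThan_Suc ideal_span_insert)
  also have "\<dots> = {u + t m * v | u v. u \<in> ideal_span (t ` {..<m})}"
  proof safe
    fix x k assume "x - k * t m \<in> ideal_span (t ` {..<m})"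
    then show "\<exists>u v. x = u + t m * v \<and> u \<in> ideal_span (t ` {..<m})"
      by (intro exI[of _ "x - k * t m"] exI[of _ k]) (simp add: mult.commute)
  next
    fix u v assume "u \<in> ideal_span (t ` {..<m})"
    then show "\<exists>k. u + t m * v - k * t m \<in> ideal_span (t ` {..<m})"
      by (intro exI[of _ v]) (simp add: mult.commute)
  qed
  finally show ?thesis .
qed

text \<open>
  The cyclic submodule generated by \<open>x\<close> is \<open>F / K\<close>, where \<open>K\<close> is the kernel of \<open>\<phi>\<close>, and \<open>B\<close> kills
  it. The element \<open>y\<close> is the image of the generator under a map \<open>F / K \<rightarrow> E i\<close>, so \<open>B\<close> kills \<open>y\<close> too:
  torsion is not lost.
\<close>
lemma torsion_cocycle_boundary:
  fixes E :: "nat \<Rightarrow> ('a, 'm) module" and \<iota> :: "'a \<Rightarrow> 'r::comm_ring_1"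
  assumes res: "injective_resolution R (ring_module R) \<epsilon> E \<delta>"
    and fin: "countable (carrier R)" "infinite (UNIV :: 'm set)"
    and \<iota>: "ring_hom_into \<iota>" and a: "a \<in> carrier R"
    and \<alpha>: "\<alpha> \<in> module_homs R (ring_module R) (ring_algebra \<iota>)"
    and \<beta>: "\<beta> \<in> module_homs R (ring_algebra \<iota>) (ring_module R)"
    and \<beta>\<alpha>: "\<And>s. s \<in> carrier R \<Longrightarrow> \<beta> (\<alpha> s) = a \<otimes> s"
    and B: "B \<subseteq> carrier R"
    and t: "regular_sequence d t" "\<And>m. m < d \<Longrightarrow> t m \<in> ideal_span (\<iota> ` B)"
    and j: "j < d" and x: "x \<in> carrier (E j)" "\<delta> j x = \<zero>\<^bsub>E (Suc j)\<^esub>"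
    and Bx: "\<And>s. s \<in> B \<Longrightarrow> s \<odot>\<^bsub>E j\<^esub> x = \<zero>\<^bsub>E j\<^esub>"
  shows "j = 0 \<Longrightarrow> a \<odot>\<^bsub>E j\<^esub> x = \<zero>\<^bsub>E j\<^esub>"
    and "j = Suc i \<Longrightarrow> \<exists>y\<in>carrier (E i). (\<forall>s\<in>B. s \<odot>\<^bsub>E i\<^esub> y = \<zero>\<^bsub>E i\<^esub>) \<and> \<delta> i y = a \<odot>\<^bsub>E j\<^esub> x"
proof -
  note Fm = free_module_module and Rm = ring_module_module and Am = ring_algebra_module[OF \<iota>]
  note rD = injective_resolutionD[OF res]
  interpret F: Module.module R F by (rule Fm)
  interpret Ej: Module.module R "E j" by (rule rD(2))
  define \<phi> where "\<phi> f = f 0 \<odot>\<^bsub>E j\<^esub> x" for f :: "nat \<Rightarrow> 'a"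
  have \<phi>: "\<phi> \<in> module_homs R F (E j)"
    using x(1) by (intro module_homsI)
      (auto simp: \<phi>_def free_module_simps Ej.smult_l_distr Ej.smult_assoc1)
  define K where "K = {f \<in> carrier F. \<phi> f = \<zero>\<^bsub>E j\<^esub>}"
  obtain p where p: "free_resolution K p"
    using free_resolution_ex[OF fin(1)] submodule_set_kernel[OF Fm rD(2) \<phi>] K_def by metis
  note ph = free_resolution_hom[OF p] and pc = free_resolution_closed[OF p]
  have BF: "s \<odot>\<^bsub>F\<^esub> f \<in> K" if s: "s \<in> B" and f: "f \<in> carrier F" for s f
  proof -
    have sR: "s \<in> carrier R" and f0: "f 0 \<in> carrier R" using s B f by (auto simp: free_module_simps)
    have "\<phi> (s \<odot>\<^bsub>F\<^esub> f) = f 0 \<odot>\<^bsub>E j\<^esub> (s \<odot>\<^bsub>E j\<^esub> x)"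
      using sR f0 x(1) by (simp add: \<phi>_def free_module_simps m_comm[of s] Ej.smult_assoc1)
    also have "\<dots> = \<zero>\<^bsub>E j\<^esub>" using Bx[OF s] f0 by simp
    finally show ?thesis using sR f by (simp add: K_def)
  qed
  have hom: "null_homotopic \<iota> p (t m)" if "m < d" for m
  proof (rule null_homotopic_span[OF \<iota> p])
    have "\<iota> ` B \<subseteq> \<iota> ` {s \<in> carrier R. \<forall>f\<in>carrier F. s \<odot>\<^bsub>F\<^esub> f \<in> K}" using BF B by blast
    then show "t m \<in> ideal_span (\<iota> ` {s \<in> carrier R. \<forall>f\<in>carrier F. s \<odot>\<^bsub>F\<^esub> f \<in> K})"
      using t(2)[OF that] ideal_span_mono by blast
  qed
  have ext: "\<exists>w\<in>module_homs R F (ring_module R). \<forall>x\<in>carrier F. a \<otimes> \<psi> x = w (p i x)"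
    if i: "i < d" and \<psi>: "\<psi> \<in> module_homs R F (ring_module R)"
      and \<psi>p: "\<And>x. x \<in> carrier F \<Longrightarrow> \<psi> (p (Suc i) x) = \<zero>" for i \<psi>
  proof -
    have \<psi>c: "\<psi> y \<in> carrier R" if "y \<in> carrier F" for y
      using module_homs_closed[OF \<psi> that] by (simp add: ring_module_def)
    have \<alpha>0: "\<alpha> \<zero> = 0" using module_homs_zero[OF Rm Am \<alpha>] by (simp add: ring_module_def)
    have "\<exists>g\<in>cochains \<iota>. \<forall>y\<in>carrier F.
        \<alpha> (\<psi> y) - g (p i y) \<in> ideal_span (t ` {..<0})"
    proof (rule cochain_exact[OF \<iota> p, where J = "\<lambda>m. ideal_span (t ` {..<m})" and d = d and t = t])
      show "ring_ideal (ideal_span (t ` {..<m}))" for m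
        by (rule ring_ideal_span)
      show "\<alpha> (\<psi> (p (Suc i) y)) \<in> ideal_span (t ` {..<0})" if "y \<in> carrier F" for y
        using \<psi>p[OF that] \<alpha>0 by (simp add: ideal_span_zero)
      show "ideal_span (t ` {..<Suc m}) = {u + t m * v |u v. u \<in> ideal_span (t ` {..<m})}" for m
        by (rule span_insert_image)
    qed (use hom t(1) i module_homs_comp[OF \<alpha> \<psi>] in \<open>auto simp: regular_sequence_def\<close>)
    then obtain g where g: "g \<in> cochains \<iota>"
      "\<forall>y\<in>carrier F. \<alpha> (\<psi> y) - g (p i y) \<in> ideal_span (t ` {..<0})"
      by blast
    have "a \<otimes> \<psi> y = \<beta> (g (p i y))" if y: "y \<in> carrier F" for y
      using g(2) y \<beta>\<alpha>[OF \<psi>c[OF y]] by (simp add: ideal_span_empty)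
    then show ?thesis using module_homs_comp[OF \<beta> g(1)] by (intro bexI[of _ "\<lambda>y. \<beta> (g y)"]) auto
  qed
  have \<phi>p: "\<phi> (p (Suc 0) f) = \<zero>\<^bsub>E j\<^esub>" if "f \<in> carrier F" for f
  proof -
    have "p 1 f \<in> K" using p that by (auto simp: free_resolution_def)
    then show ?thesis by (simp add: K_def)
  qed
  have d\<phi>: "\<delta> j (\<phi> f) = \<zero>\<^bsub>E (Suc j)\<^esub>" if "f \<in> carrier F" for f
  proof -
    interpret ESj: Module.module R "E (Suc j)" by (rule rD(2))
    have "f 0 \<in> carrier R" using that by (simp add: free_module_simps)
    then show ?thesis using x by (simp add: \<phi>_def module_homs_smult[OF rD(5)])
  qed
  define e where "e = unit_vector R 0"
  have e: "e \<in> carrier F" "\<phi> e = x"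
    unfolding e_def using x(1) by (simp_all add: \<phi>_def) (simp add: unit_vector_def)
  show "a \<odot>\<^bsub>E j\<^esub> x = \<zero>\<^bsub>E j\<^esub>" if "j = 0"
  proof -
    have "\<exists>W\<in>module_homs R F (E 0). \<forall>f\<in>carrier F.
        a \<odot>\<^bsub>E 0\<^esub> \<phi> f = W (p 0 f) \<and> \<delta> 0 (W f) = \<zero>\<^bsub>E 1\<^esub>"
    proof (rule cocycle_boundary_0[OF res p fin a, where d = d])
      show "\<exists>w\<in>module_homs R F (ring_module R). \<forall>x\<in>carrier F. a \<otimes> \<psi> x = w (p i x)"
        if "i < d" "\<psi> \<in> module_homs R F (ring_module R)"
          "\<And>x. x \<in> carrier F \<Longrightarrow> \<psi> (p (Suc i) x) = \<zero>" for i \<psi>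
        by (rule ext[OF that])
    qed (use \<phi> d\<phi> \<phi>p j \<open>j = 0\<close> in auto)
    then obtain W where W: "W \<in> module_homs R F (E 0)" "\<And>f. f \<in> carrier F \<Longrightarrow> a \<odot>\<^bsub>E 0\<^esub> \<phi> f = W (p 0 f)"
      by blast
    have "p 0 e = \<zero>\<^bsub>F\<^esub>" using p by (simp add: free_resolution_def)
    then show ?thesis using W(2)[OF e(1)] e(2) module_homs_zero[OF Fm rD(2) W(1)] that by simp
  qed
  show "\<exists>y\<in>carrier (E i). (\<forall>s\<in>B. s \<odot>\<^bsub>E i\<^esub> y = \<zero>\<^bsub>E i\<^esub>) \<and> \<delta> i y = a \<odot>\<^bsub>E j\<^esub> x" if ji: "j = Suc i"
  proof -
    have "\<exists>\<chi>\<in>module_homs R F (E i). \<forall>f\<in>carrier F.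
        a \<odot>\<^bsub>E (Suc i)\<^esub> \<phi> f = \<delta> i (\<chi> f) \<and> \<chi> (p (Suc 0) f) = \<zero>\<^bsub>E i\<^esub>"
    proof (rule cocycle_boundary_Suc[OF res p fin a, where d = d])
      show "\<exists>w\<in>module_homs R F (ring_module R). \<forall>x\<in>carrier F. a \<otimes> \<psi> x = w (p i x)"
        if "i < d" "\<psi> \<in> module_homs R F (ring_module R)"
          "\<And>x. x \<in> carrier F \<Longrightarrow> \<psi> (p (Suc i) x) = \<zero>" for i \<psi>
        by (rule ext[OF that])
    qed (use \<phi> d\<phi> \<phi>p j ji in auto)
    then obtain \<chi> where \<chi>: "\<chi> \<in> module_homs R F (E i)"
      "\<And>f. f \<in> carrier F \<Longrightarrow> a \<odot>\<^bsub>E (Suc i)\<^esub> \<phi> f = \<delta> i (\<chi> f)"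
      "\<And>f. f \<in> carrier F \<Longrightarrow> \<chi> (p (Suc 0) f) = \<zero>\<^bsub>E i\<^esub>"
      by blast
    have "s \<odot>\<^bsub>E i\<^esub> \<chi> e = \<zero>\<^bsub>E i\<^esub>" if s: "s \<in> B" for s
    proof -
      have "s \<odot>\<^bsub>F\<^esub> e \<in> p 1 ` carrier F" using BF[OF s e(1)] p by (simp add: free_resolution_def)
      then have "\<chi> (s \<odot>\<^bsub>F\<^esub> e) = \<zero>\<^bsub>E i\<^esub>" using \<chi>(3) by auto
      then show ?thesis using module_homs_smult[OF \<chi>(1) _ e(1), of s] s B by auto
    qed
    then show ?thesis using \<chi>(2)[OF e(1)] e(2) module_homs_closed[OF \<chi>(1) e(1)] ji
      by (intro bexI[of _ "\<chi> e"]) auto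
  qed
qed

text \<open>
  A class is represented by a cocycle \<open>x\<close> that some power \<open>B\<close> of \<open>I\<close> kills, and
  \<open>torsion_cocycle_boundary\<close> exhibits \<open>a x\<close> as the boundary of an element that \<open>B\<close> kills.
\<close>
theorem annihilates_local_cohomology:
  fixes E :: "nat \<Rightarrow> ('a, 'm) module" and \<iota> :: "'a \<Rightarrow> 'r::comm_ring_1"
  assumes res: "injective_resolution R (ring_module R) \<epsilon> E \<delta>"
    and fin: "countable (carrier R)" "infinite (UNIV :: 'm set)"
    and \<iota>: "ring_hom_into \<iota>" and a: "a \<in> carrier R"
    and \<alpha>: "\<alpha> \<in> module_homs R (ring_module R) (ring_algebra \<iota>)"
    and \<beta>: "\<beta> \<in> module_homs R (ring_algebra \<iota>) (ring_module R)"
    and \<beta>\<alpha>: "\<And>s. s \<in> carrier R \<Longrightarrow> \<beta> (\<alpha> s) = a \<otimes> s"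
    and I: "I \<subseteq> carrier R"
    and regular: "\<And>n::nat. \<exists>t. regular_sequence d t \<and>
      (\<forall>m<d. t m \<in> ideal_span (\<iota> ` (I [^]\<^bsub>ideals_set R\<^esub> n)))"
    and j: "j < d"
  shows "a \<in> annihilator R (local_cohomology R I E \<delta> j)"
proof -
  note rD = injective_resolutionD[OF res]
  define N where "N = (case j of 0 \<Rightarrow> {\<zero>\<^bsub>E 0\<^esub>} | Suc i \<Rightarrow> \<delta> i ` carrier (torsion R I (E i)))"
  define L where "L = {x \<in> carrier (torsion R I (E j)). \<delta> j x = \<zero>\<^bsub>E (Suc j)\<^esub>}"
  have eq: "local_cohomology R I E \<delta> j = quotient_module ((E j)\<lparr>carrier := L\<rparr>) N"
    by (simp add: local_cohomology_def cohomology_def L_def N_def torsion_def cong: nat.case_cong)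
  have N: "submodule_set R (E j) N"
  proof (cases j)
    case 0
    interpret E0: Module.module R "E 0" by (rule rD(2))
    show ?thesis using 0 by (auto simp: N_def submodule_set_def)
  next
    case (Suc i)
    have "\<delta> i \<in> module_homs R ((E i)\<lparr>carrier := carrier (torsion R I (E i))\<rparr>) (E (Suc i))"
      using rD(5)[of i] by (auto simp: module_homs_def torsion_def)
    from submodule_set_image[OF submodule_module[OF rD(2) torsion_submodule[OF rD(2) I]] rD(2) this]
    show ?thesis by (simp add: Suc N_def)
  qed
  have "a \<odot>\<^bsub>E j\<^esub> x \<in> N" if x: "x \<in> L" for x
  proof -
    obtain n where n: "x \<in> carrier (E j)" "\<forall>s\<in>I [^]\<^bsub>ideals_set R\<^esub> (n::nat). s \<odot>\<^bsub>E j\<^esub> x = \<zero>\<^bsub>E j\<^esub>"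
      "\<delta> j x = \<zero>\<^bsub>E (Suc j)\<^esub>"
      using x by (auto simp: L_def torsion_def)
    obtain t where t: "regular_sequence d t"
      "\<And>m. m < d \<Longrightarrow> t m \<in> ideal_span (\<iota> ` (I [^]\<^bsub>ideals_set R\<^esub> n))"
      using regular[of n] by blast
    note boundary = torsion_cocycle_boundary[OF res fin \<iota> a \<alpha> \<beta> \<beta>\<alpha> ideal_power_closed[OF I] t j n(1,3)]
    show ?thesis
    proof (cases j)
      case 0
      then show ?thesis using boundary(1)[OF _ _ _ 0] n(2) by (simp add: N_def)
    next
      case (Suc i)
      obtain y where "y \<in> carrier (E i)" "\<forall>s\<in>I [^]\<^bsub>ideals_set R\<^esub> n. s \<odot>\<^bsub>E i\<^esub> y = \<zero>\<^bsub>E i\<^esub>"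
        "\<delta> i y = a \<odot>\<^bsub>E j\<^esub> x"
        using boundary(2)[OF _ _ _ Suc] n(2) by blast
      then show ?thesis unfolding N_def Suc by (auto simp: torsion_def intro!: rev_image_eqI[of y])
    qed
  qed
  then show ?thesis unfolding eq
    using rD(2) N a by (intro quotient_module_annihilates) (auto simp: L_def torsion_def)
qed

end

section \<open>Polynomials and substitution\<close>

lemma Const_simps [simp]: "Const 0 = 0" "Const 1 = 1"
  by (simp_all add: Const_def)

lemma Const_add: "Const (a + b) = Const a + Const b"
  by (simp add: Const_def single_add)

lemma Const_mult: "Const (a * b) = Const a * Const b"
  by (simp add: Const_def mult_single)

lemma poly_mapping_add_induct [case_names zero add]:
  fixes p :: "'a \<Rightarrow>\<^sub>0 'b::comm_monoid_add"
  assumes "P 0" and "\<And>p m c. m \<notin> Poly_Mapping.keys p \<Longrightarrow> c \<noteq> 0 \<Longrightarrow> P p \<Longrightarrow> P (p + Poly_Mapping.single m c)"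
  shows "P p"
proof (induction p rule: update_induct)
  case const
  then show ?case by (rule assms(1))
next
  case (update f a b)
  have "Poly_Mapping.update a b f = f + Poly_Mapping.single a b"
    using update(1)
    by (intro poly_mapping_eqI) (auto simp: lookup_update lookup_add lookup_single in_keys_iff)
  then show ?case using assms(2)[of a f b] update by simp
qed

definition monomial_value :: "('i \<Rightarrow> ('j, 'k::comm_ring_1) mpoly) \<Rightarrow> ('i \<Rightarrow>\<^sub>0 nat) \<Rightarrow> ('j, 'k) mpoly" where
  "monomial_value \<sigma> m = (\<Prod>i\<in>Poly_Mapping.keys m. \<sigma> i ^ Poly_Mapping.lookup m i)"

text \<open>
  The homomorphism of algebras that sends the variable \<open>i\<close> to \<open>\<sigma> i\<close>.
\<close>
definition subst :: "('i \<Rightarrow> ('j, 'k) mpoly) \<Rightarrow> ('i, 'k::comm_ring_1) mpoly \<Rightarrow> ('j, 'k) mpoly" where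
  "subst \<sigma> p = (\<Sum>m\<in>Poly_Mapping.keys p. Const (Poly_Mapping.lookup p m) * monomial_value \<sigma> m)"

lemma rename_eq_subst: "rename \<rho> p = subst (\<lambda>i. Var (\<rho> i)) p"
  by (simp add: rename_def subst_def monomial_value_def)

lemma monomial_value_superset:
  assumes "finite T" "Poly_Mapping.keys m \<subseteq> T"
  shows "monomial_value \<sigma> m = (\<Prod>i\<in>T. \<sigma> i ^ Poly_Mapping.lookup m i)"
  unfolding monomial_value_def using assms
  by (intro prod.mono_neutral_left) (auto simp: in_keys_iff)

lemma monomial_value_add: "monomial_value \<sigma> (m + n) = monomial_value \<sigma> m * monomial_value \<sigma> n"
proof -
  let ?T = "Poly_Mapping.keys m \<union> Poly_Mapping.keys n"
  have "monomial_value \<sigma> (m + n) = (\<Prod>i\<in>?T. \<sigma> i ^ Poly_Mapping.lookup (m + n) i)"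
    by (rule monomial_value_superset) (auto simp: in_keys_iff lookup_add)
  also have "\<dots> = (\<Prod>i\<in>?T. \<sigma> i ^ Poly_Mapping.lookup m i) * (\<Prod>i\<in>?T. \<sigma> i ^ Poly_Mapping.lookup n i)"
    by (simp add: lookup_add power_add prod.distrib)
  also have "\<dots> = monomial_value \<sigma> m * monomial_value \<sigma> n"
    by (subst (1 2) monomial_value_superset[of ?T]) auto
  finally show ?thesis .
qed

lemma monomial_value_0 [simp]: "monomial_value \<sigma> 0 = 1"
  by (simp add: monomial_value_def)

lemma subst_superset:
  assumes "finite T" "Poly_Mapping.keys p \<subseteq> T"
  shows "subst \<sigma> p = (\<Sum>m\<in>T. Const (Poly_Mapping.lookup p m) * monomial_value \<sigma> m)"
  unfolding subst_def using assms
  by (intro sum.mono_neutral_left) (auto simp: in_keys_iff)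

lemma subst_add: "subst \<sigma> (p + q) = subst \<sigma> p + subst \<sigma> q"
proof -
  let ?T = "Poly_Mapping.keys p \<union> Poly_Mapping.keys q"
  have "subst \<sigma> (p + q) = (\<Sum>m\<in>?T. Const (Poly_Mapping.lookup (p + q) m) * monomial_value \<sigma> m)"
    by (rule subst_superset) (use keys_add[of p q] in auto)
  also have "\<dots> = (\<Sum>m\<in>?T. Const (Poly_Mapping.lookup p m) * monomial_value \<sigma> m)
      + (\<Sum>m\<in>?T. Const (Poly_Mapping.lookup q m) * monomial_value \<sigma> m)"
    by (simp add: lookup_add Const_add distrib_right sum.distrib)
  also have "\<dots> = subst \<sigma> p + subst \<sigma> q"
    by (subst (1 2) subst_superset[of ?T]) auto
  finally show ?thesis .
qed

lemma subst_0 [simp]: "subst \<sigma> 0 = 0"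
  by (simp add: subst_def)

lemma subst_single: "subst \<sigma> (Poly_Mapping.single m c) = Const c * monomial_value \<sigma> m"
  by (simp add: subst_def)

lemma subst_mult: "subst \<sigma> (p * q) = subst \<sigma> p * subst \<sigma> q"
proof (induction p rule: poly_mapping_add_induct)
  case (add p m c)
  have "subst \<sigma> (Poly_Mapping.single m c * q) = subst \<sigma> (Poly_Mapping.single m c) * subst \<sigma> q"
  proof (induction q rule: poly_mapping_add_induct)
    case (add q n e)
    then show ?case
      by (simp add: distrib_left mult_single subst_add subst_single monomial_value_add Const_mult ac_simps)
  qed simp
  then show ?case using add by (simp add: distrib_right subst_add)
qed simp

lemma subst_uminus: "subst \<sigma> (- p) = - subst \<sigma> p"
  using subst_add[of \<sigma> "- p" p] by (simp add: eq_neg_iff_add_eq_0)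

lemma subst_diff: "subst \<sigma> (p - q) = subst \<sigma> p - subst \<sigma> q"
  using subst_add[of \<sigma> p "- q"] by (simp add: subst_uminus)

lemma subst_Const [simp]: "subst \<sigma> (Const c) = Const c"
  by (simp add: Const_def subst_single)

lemma subst_1 [simp]: "subst \<sigma> 1 = 1"
  using subst_Const[of \<sigma> 1] by simp

lemma subst_Var [simp]: "subst \<sigma> (Var i) = \<sigma> i"
  by (simp add: Var_def subst_single monomial_value_def)

lemma subst_power: "subst \<sigma> (p ^ n) = subst \<sigma> p ^ n"
  by (induction n) (auto simp: subst_mult)

lemma subst_sum: "subst \<sigma> (sum f I) = (\<Sum>i\<in>I. subst \<sigma> (f i))"
  by (induction I rule: infinite_finite_induct) (auto simp: subst_add)

lemma subst_prod: "subst \<sigma> (prod f I) = (\<Prod>i\<in>I. subst \<sigma> (f i))"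
  by (induction I rule: infinite_finite_induct) (auto simp: subst_mult)

lemma subst_subst: "subst \<sigma> (subst \<tau> p) = subst (\<lambda>i. subst \<sigma> (\<tau> i)) p"
  by (simp add: subst_def[of _ p] subst_sum subst_mult monomial_value_def subst_prod subst_power)

lemma Var_power: "Var i ^ n = (Poly_Mapping.single (Poly_Mapping.single i n) 1 :: ('i, 'k::comm_ring_1) mpoly)"
  by (induction n) (auto simp: Var_def mult_single single_add[symmetric])

lemma monomial_value_Var: "monomial_value Var m = Poly_Mapping.single m 1"
proof (induction m rule: poly_mapping_add_induct)
  case (add m i n)
  have "monomial_value Var (Poly_Mapping.single i n) =
      (Poly_Mapping.single (Poly_Mapping.single i n) 1 :: ('a, 'b) mpoly)"
    by (cases "n = 0") (auto simp: monomial_value_def Var_power)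
  then show ?case using add by (simp add: monomial_value_add mult_single)
qed simp

lemma subst_Var_id [simp]: "subst Var p = p"
proof (induction p rule: poly_mapping_add_induct)
  case (add p m c)
  then show ?case by (simp add: subst_add subst_single monomial_value_Var Const_def mult_single)
qed simp

lemma subst_cong:
  assumes "p \<in> carrier (mpoly_ring U)" "\<And>i. i \<in> U \<Longrightarrow> \<sigma> i = \<tau> i"
  shows "subst \<sigma> p = subst \<tau> p"
  using assms unfolding subst_def monomial_value_def
  by (intro sum.cong arg_cong2[where f = "(*)"] prod.cong refl) (auto simp: mpoly_ring_def subset_iff)

lemma mpoly_ring_simps [simp]:
  "monoid.mult (mpoly_ring U) p q = p * q" "one (mpoly_ring U) = 1" "ring.zero (mpoly_ring U) = 0"
  "add (mpoly_ring U) p q = p + q"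
  by (simp_all add: mpoly_ring_def)

lemma mpoly_ring_UNIV: "p \<in> carrier (mpoly_ring UNIV)"
  by (simp add: mpoly_ring_def)

lemma mpoly_ring_zero [simp]: "0 \<in> carrier (mpoly_ring U)"
  by (simp add: mpoly_ring_def)

lemma mpoly_ring_add: "p \<in> carrier (mpoly_ring U) \<Longrightarrow> q \<in> carrier (mpoly_ring U) \<Longrightarrow> p + q \<in> carrier (mpoly_ring U)"
  using keys_add[of p q] by (auto simp: mpoly_ring_def)

lemma mpoly_ring_uminus: "p \<in> carrier (mpoly_ring U) \<Longrightarrow> - p \<in> carrier (mpoly_ring U)"
  by (auto simp: mpoly_ring_def in_keys_iff)

lemma mpoly_ring_diff: "p \<in> carrier (mpoly_ring U) \<Longrightarrow> q \<in> carrier (mpoly_ring U) \<Longrightarrow> p - q \<in> carrier (mpoly_ring U)"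
  using mpoly_ring_add[of p U "- q"] mpoly_ring_uminus[of q U] by simp

lemma mpoly_ring_mult:
  assumes "p \<in> carrier (mpoly_ring U)" "q \<in> carrier (mpoly_ring U)"
  shows "p * q \<in> carrier (mpoly_ring U)"
proof -
  have "Poly_Mapping.keys m \<subseteq> U" if "m \<in> Poly_Mapping.keys (p * q)" for m
  proof -
    obtain a b where ab: "m = a + b" "a \<in> Poly_Mapping.keys p" "b \<in> Poly_Mapping.keys q"
      using keys_mult[of p q] \<open>m \<in> Poly_Mapping.keys (p * q)\<close> by blast
    then have "Poly_Mapping.keys a \<subseteq> U" "Poly_Mapping.keys b \<subseteq> U"
      using assms by (auto simp: mpoly_ring_def)
    then show ?thesis using keys_add[of a b] ab(1) by blast
  qed
  then show ?thesis by (simp add: mpoly_ring_def)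
qed

lemma mpoly_ring_Const [simp]: "Const c \<in> carrier (mpoly_ring U)"
  by (auto simp: mpoly_ring_def Const_def)

lemma mpoly_ring_1 [simp]: "1 \<in> carrier (mpoly_ring U)"
  using mpoly_ring_Const[of 1] by simp

lemma mpoly_ring_Var: "i \<in> U \<Longrightarrow> Var i \<in> carrier (mpoly_ring U)"
  by (auto simp: mpoly_ring_def Var_def)

lemma mpoly_ring_sum: "(\<And>i. i \<in> I \<Longrightarrow> f i \<in> carrier (mpoly_ring U)) \<Longrightarrow> sum f I \<in> carrier (mpoly_ring U)"
  by (induction I rule: infinite_finite_induct) (auto intro: mpoly_ring_add)

lemma mpoly_ring_prod: "(\<And>i. i \<in> I \<Longrightarrow> f i \<in> carrier (mpoly_ring U)) \<Longrightarrow> prod f I \<in> carrier (mpoly_ring U)"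
  by (induction I rule: infinite_finite_induct) (auto intro: mpoly_ring_mult)

lemma mpoly_ring_power: "p \<in> carrier (mpoly_ring U) \<Longrightarrow> p ^ n \<in> carrier (mpoly_ring U)"
  by (induction n) (auto intro: mpoly_ring_mult)

lemma mpoly_ring_subst:
  assumes "p \<in> carrier (mpoly_ring U)" "\<And>i. i \<in> U \<Longrightarrow> \<sigma> i \<in> carrier (mpoly_ring U')"
  shows "subst \<sigma> p \<in> carrier (mpoly_ring U')"
  unfolding subst_def monomial_value_def
proof (intro mpoly_ring_sum mpoly_ring_mult mpoly_ring_prod mpoly_ring_power mpoly_ring_Const)
  fix m i assume "m \<in> Poly_Mapping.keys p" "i \<in> Poly_Mapping.keys m"
  then have "i \<in> U" using assms(1) by (auto simp: mpoly_ring_def)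
  then show "\<sigma> i \<in> carrier (mpoly_ring U')" by (rule assms(2))
qed

lemma mpoly_ring_cring: "cring (mpoly_ring U)"
proof (rule cringI)
  show "abelian_group (mpoly_ring U)"
  proof (rule abelian_groupI)
    fix x assume "x \<in> carrier (mpoly_ring U)"
    then show "\<exists>y\<in>carrier (mpoly_ring U). y \<oplus>\<^bsub>mpoly_ring U\<^esub> x = \<zero>\<^bsub>mpoly_ring U\<^esub>"
      by (intro bexI[of _ "- x"]) (auto intro: mpoly_ring_uminus)
  qed (auto intro: mpoly_ring_add simp: ac_simps)
  show "comm_monoid (mpoly_ring U)"
    by (rule comm_monoidI) (auto intro: mpoly_ring_mult simp: ac_simps)
qed (auto simp: distrib_right)

lemma mpoly_ring_induct [consumes 1, case_names Const Var add mult]: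
  assumes p: "p \<in> carrier (mpoly_ring U)"
    and Const: "\<And>c. P (Const c)" and Var: "\<And>i. i \<in> U \<Longrightarrow> P (Var i)"
    and add: "\<And>p q. p \<in> carrier (mpoly_ring U) \<Longrightarrow> q \<in> carrier (mpoly_ring U) \<Longrightarrow> P p \<Longrightarrow> P q \<Longrightarrow> P (p + q)"
    and mult: "\<And>p q. p \<in> carrier (mpoly_ring U) \<Longrightarrow> q \<in> carrier (mpoly_ring U) \<Longrightarrow> P p \<Longrightarrow> P q \<Longrightarrow> P (p * q)"
  shows "P p"
proof -
  define Q where "Q p \<longleftrightarrow> p \<in> carrier (mpoly_ring U) \<and> P p" for p
  have Q: "Q (Const c)" "i \<in> U \<Longrightarrow> Q (Var i)" "Q p \<Longrightarrow> Q q \<Longrightarrow> Q (p + q)" "Q p \<Longrightarrow> Q q \<Longrightarrow> Q (p * q)" for c i p q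
    using assms by (auto simp: Q_def intro: mpoly_ring_Var mpoly_ring_add mpoly_ring_mult)
  have sum: "Q (sum f I)" if "\<And>i. i \<in> I \<Longrightarrow> Q (f i)" for f :: "('a \<Rightarrow>\<^sub>0 nat) \<Rightarrow> _" and I
    using that Q(1)[of 0] by (induction I rule: infinite_finite_induct) (auto intro: Q)
  have prod: "Q (prod f I)" if "\<And>i. i \<in> I \<Longrightarrow> Q (f i)" for f :: "'a \<Rightarrow> _" and I
    using that Q(1)[of 1] by (induction I rule: infinite_finite_induct) (auto intro: Q)
  have power: "Q (f ^ n)" if "Q f" for f n
    using that Q(1)[of 1] by (induction n) (auto intro: Q)
  have "Q (subst Var p)"
    unfolding subst_def monomial_value_def using p
    by (intro sum Q(4) Q(1) prod power Q(2)) (auto simp: mpoly_ring_def)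
  then show ?thesis by (simp add: Q_def)
qed

section \<open>Homogeneous polynomials\<close>

definition homogeneous :: "nat \<Rightarrow> ('i, 'k::comm_ring_1) mpoly \<Rightarrow> bool" where
  "homogeneous n p \<longleftrightarrow> (\<forall>m\<in>Poly_Mapping.keys p. mdegree m = n)"

lemma mdegree_superset: "finite T \<Longrightarrow> Poly_Mapping.keys m \<subseteq> T \<Longrightarrow> mdegree m = (\<Sum>i\<in>T. Poly_Mapping.lookup m i)"
  unfolding mdegree_def by (intro sum.mono_neutral_left) (auto simp: in_keys_iff)

lemma mdegree_add: "mdegree (m + n) = mdegree m + mdegree n"
proof -
  let ?T = "Poly_Mapping.keys m \<union> Poly_Mapping.keys n"
  have "mdegree (m + n) = (\<Sum>i\<in>?T. Poly_Mapping.lookup (m + n) i)"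
    by (rule mdegree_superset) (use keys_add[of m n] in auto)
  then show ?thesis
    using mdegree_superset[of ?T m] mdegree_superset[of ?T n] by (simp add: lookup_add sum.distrib)
qed

lemma homogeneous_0 [simp]: "homogeneous n 0"
  by (simp add: homogeneous_def)

lemma homogeneous_Const: "homogeneous 0 (Const c)"
  by (simp add: homogeneous_def Const_def mdegree_def)

lemma homogeneous_1: "homogeneous 0 1"
  using homogeneous_Const[of 1] by simp

lemma homogeneous_Var: "homogeneous 1 (Var i)"
  by (simp add: homogeneous_def Var_def mdegree_def)

lemma homogeneous_add: "homogeneous n p \<Longrightarrow> homogeneous n q \<Longrightarrow> homogeneous n (p + q)"
  using keys_add[of p q] by (auto simp: homogeneous_def)

lemma homogeneous_mult:
  assumes "homogeneous n p" "homogeneous m q"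
  shows "homogeneous (n + m) (p * q)"
  unfolding homogeneous_def
proof
  fix l assume "l \<in> Poly_Mapping.keys (p * q)"
  then obtain a b where "l = a + b" "a \<in> Poly_Mapping.keys p" "b \<in> Poly_Mapping.keys q"
    using keys_mult[of p q] by blast
  then show "mdegree l = n + m" using assms by (simp add: homogeneous_def mdegree_add)
qed

lemma homogeneous_uminus: "homogeneous n p \<Longrightarrow> homogeneous n (- p)"
  by (simp add: homogeneous_def in_keys_iff)

lemma homogeneous_sum: "(\<And>i. i \<in> I \<Longrightarrow> homogeneous n (f i)) \<Longrightarrow> homogeneous n (sum f I)"
  by (induction I rule: infinite_finite_induct) (auto intro: homogeneous_add)

lemma homogeneous_prod: "(\<And>i. i \<in> I \<Longrightarrow> homogeneous (n i) (f i)) \<Longrightarrow> homogeneous (sum n I) (prod f I)"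
  by (induction I rule: infinite_finite_induct) (auto intro: homogeneous_mult homogeneous_1)

lemma homogeneous_power: "homogeneous 1 p \<Longrightarrow> homogeneous n (p ^ n)"
  by (induction n) (use homogeneous_mult[of 1 p] in \<open>auto simp: homogeneous_1\<close>)

lemma homogeneous_subst:
  assumes "homogeneous n p" "\<And>i. homogeneous 1 (\<sigma> i)"
  shows "homogeneous n (subst \<sigma> p)"
  unfolding subst_def
proof (rule homogeneous_sum)
  fix m assume m: "m \<in> Poly_Mapping.keys p"
  have "homogeneous (0 + mdegree m) (Const (Poly_Mapping.lookup p m) * monomial_value \<sigma> m)"
    unfolding monomial_value_def mdegree_def
    by (intro homogeneous_mult homogeneous_prod homogeneous_power assms(2) homogeneous_Const)
  then show "homogeneous n (Const (Poly_Mapping.lookup p m) * monomial_value \<sigma> m)"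
    using assms(1) m by (simp add: homogeneous_def)
qed

lemma countable_poly_mapping:
  assumes "countable (UNIV :: 'a set)" "countable (UNIV :: 'b::zero set)"
  shows "countable (UNIV :: ('a \<Rightarrow>\<^sub>0 'b) set)"
proof -
  let ?graph = "\<lambda>p :: 'a \<Rightarrow>\<^sub>0 'b. (\<lambda>m. (m, Poly_Mapping.lookup p m)) ` Poly_Mapping.keys p"
  have "inj ?graph"
  proof (rule injI)
    fix p q assume eq: "?graph p = ?graph q"
    have mem: "(m, c) \<in> ?graph p \<longleftrightarrow> c \<noteq> 0 \<and> Poly_Mapping.lookup p m = c" for m c and p :: "'a \<Rightarrow>\<^sub>0 'b"
      by (auto simp: in_keys_iff)
    have "Poly_Mapping.lookup p m = Poly_Mapping.lookup q m" for m
    proof (cases "Poly_Mapping.lookup p m = 0")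
      case True
      show ?thesis
      proof (rule ccontr)
        assume "Poly_Mapping.lookup p m \<noteq> Poly_Mapping.lookup q m"
        then have "(m, Poly_Mapping.lookup q m) \<in> ?graph q" unfolding mem using True by simp
        then show False unfolding eq[symmetric] mem using True by simp
      qed
    next
      case False
      then have "(m, Poly_Mapping.lookup p m) \<in> ?graph p" unfolding mem by simp
      then show ?thesis unfolding eq mem by simp
    qed
    then show "p = q" by (rule poly_mapping_eqI)
  qed
  have "countable (UNIV :: ('a \<times> 'b) set)"
    using countable_SIGMA[OF assms(1), of "\<lambda>_. UNIV :: 'b set"] assms(2) by simp
  then have "countable {T. finite T \<and> T \<subseteq> (UNIV :: ('a \<times> 'b) set)}"
    by (rule countable_Collect_finite_subset)
  then have "countable (range ?graph)" by (rule countable_subset[rotated]) auto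
  then show ?thesis by (rule countable_image_inj_on) fact
qed

section \<open>Powers of variables form a regular sequence\<close>

lemma lookup_single_times:
  "Poly_Mapping.lookup (Poly_Mapping.single s 1 * a) (s + m) =
    Poly_Mapping.lookup (a :: ('i, 'k::comm_ring_1) mpoly) m"
proof (induction a rule: poly_mapping_add_induct)
  case (add a n c)
  then show ?case by (simp add: distrib_left lookup_add mult_single lookup_single)
qed simp

text \<open>
  An ideal generated by monomials consists of the polynomials whose monomials all lie in it. This
  reduces questions about \<open>(X\<^sub>0\<^sup>M, \<dots>, X\<^sub>m\<^sub>-\<^sub>1\<^sup>M)\<close> to inequalities between exponents.
\<close>
lemma ideal_span_Var_powers:
  "ideal_span ((\<lambda>i. Var i ^ M) ` T) =
    {p :: ('i, 'k::comm_ring_1) mpoly. \<forall>m\<in>Poly_Mapping.keys p. \<exists>i\<in>T. M \<le> Poly_Mapping.lookup m i}"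
  (is "_ = ?J")
proof
  have "ring_ideal ?J"
    unfolding ring_ideal_iff
  proof (intro conjI ballI allI)
    fix p q :: "('i, 'k) mpoly" assume "p \<in> ?J" "q \<in> ?J"
    then show "p + q \<in> ?J" using keys_add[of p q] by blast
  next
    fix c p :: "('i, 'k) mpoly" assume p: "p \<in> ?J"
    have "\<exists>i\<in>T. M \<le> Poly_Mapping.lookup m i" if m: "m \<in> Poly_Mapping.keys (c * p)" for m
    proof -
      obtain a b where ab: "m = a + b" "b \<in> Poly_Mapping.keys p" using keys_mult[of c p] m by blast
      then obtain i where "i \<in> T" "M \<le> Poly_Mapping.lookup b i" using p by blast
      then show ?thesis using ab(1) by (intro bexI[of _ i]) (auto simp: lookup_add)
    qed
    then show "c * p \<in> ?J" by blast
  qed simp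
  moreover have "Var i ^ M \<in> ?J" if "i \<in> T" for i
    using that by (auto simp: Var_power intro!: bexI[of _ i])
  then have "(\<lambda>i. Var i ^ M) ` T \<subseteq> ?J" by blast
  ultimately show "ideal_span ((\<lambda>i. Var i ^ M) ` T) \<subseteq> ?J"
    by (intro ideal_span_minimal)
  have "p \<in> ideal_span ((\<lambda>i. Var i ^ M) ` T)" if "p \<in> ?J" for p
    using that
  proof (induction p rule: poly_mapping_add_induct)
    case zero
    show ?case by (rule ideal_span_zero)
  next
    case (add p m c)
    have keys: "Poly_Mapping.keys (p + Poly_Mapping.single m c) = insert m (Poly_Mapping.keys p)"
      using add(1,2) by (auto simp: in_keys_iff lookup_add lookup_single when_def split: if_splits)
    then obtain i where i: "i \<in> T" "M \<le> Poly_Mapping.lookup m i" using add.prems by auto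
    \<comment> \<open>truncated subtraction of exponents, exact since \<open>M\<close> is at most the exponent of \<open>i\<close>\<close>
    have "m = (m - Poly_Mapping.single i M) + Poly_Mapping.single i M"
      using i(2) by (intro poly_mapping_eqI)
        (auto simp: lookup_add lookup_single minus_poly_mapping.rep_eq when_def)
    then have "Poly_Mapping.single m c = Poly_Mapping.single (m - Poly_Mapping.single i M) c * Var i ^ M"
      by (simp add: Var_power mult_single)
    moreover have "\<dots> \<in> ideal_span ((\<lambda>i. Var i ^ M) ` T)"
      using i(1) by (intro ideal_span_scale ideal_span_base) auto
    ultimately have "Poly_Mapping.single m c \<in> ideal_span ((\<lambda>i. Var i ^ M) ` T)" by simp
    moreover have "p \<in> ideal_span ((\<lambda>i. Var i ^ M) ` T)" using add.IH add.prems keys by auto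
    ultimately show ?case by (intro ideal_span_add)
  qed
  then show "?J \<subseteq> ideal_span ((\<lambda>i. Var i ^ M) ` T)" by blast
qed

lemma regular_sequence_Var_powers:
  "regular_sequence d (\<lambda>m. Var m ^ M :: (nat, 'k::comm_ring_1) mpoly)"
  unfolding regular_sequence_def
proof (intro allI impI)
  fix m and a :: "(nat, 'k) mpoly"
  assume a: "Var m ^ M * a \<in> ideal_span ((\<lambda>m. Var m ^ M) ` {..<m})"
  have "\<exists>i\<in>{..<m}. M \<le> Poly_Mapping.lookup n i" if n: "n \<in> Poly_Mapping.keys a" for n
  proof -
    have "Poly_Mapping.single m M + n \<in> Poly_Mapping.keys (Var m ^ M * a)"
      using n by (simp add: in_keys_iff Var_power lookup_single_times)
    then obtain i where "i < m" "M \<le> Poly_Mapping.lookup (Poly_Mapping.single m M + n) i"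
      using a unfolding ideal_span_Var_powers by auto
    then show ?thesis by (intro bexI[of _ i]) (auto simp: lookup_add lookup_single)
  qed
  then show "a \<in> ideal_span ((\<lambda>m. Var m ^ M) ` {..<m})" unfolding ideal_span_Var_powers by blast
qed

section \<open>An element whose trace is a power of the Dickson class\<close>

lemma prod_linear_monic:
  fixes S :: "'r::idom set"
  assumes "finite S"
  shows "Polynomial.degree (\<Prod>w\<in>S. [:- w, 1:]) = card S"
    "Polynomial.coeff (\<Prod>w\<in>S. [:- w, 1:]) (card S) = 1"
proof -
  show deg: "Polynomial.degree (\<Prod>w\<in>S. [:- w, 1:]) = card S"
    by (subst degree_prod_eq_sum_degree) auto
  have "Polynomial.lead_coeff (\<Prod>w\<in>S. [:- w, 1:]) = 1"
    by (subst lead_coeff_prod) simp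
  then show "Polynomial.coeff (\<Prod>w\<in>S. [:- w, 1:]) (card S) = 1" by (simp add: deg)
qed

text \<open>
  Lagrange interpolation at the points of \<open>\<Lambda>\<close>. As \<open>\<Lambda>\<close> is an additive group, all denominators
  \<open>\<Prod> (v - w)\<close>, over \<open>w \<noteq> v\<close>, equal the product \<open>D\<close> of the nonzero elements; comparing the coefficients of
  degree \<open>card \<Lambda> - 1\<close> in the interpolation formula gives the claim.
\<close>
lemma sum_monic_eq_prod_nonzero:
  fixes \<Lambda> :: "'r::idom set" and p :: "'r Polynomial.poly"
  assumes \<Lambda>: "finite \<Lambda>" "0 \<in> \<Lambda>" "\<And>x y. x \<in> \<Lambda> \<Longrightarrow> y \<in> \<Lambda> \<Longrightarrow> x - y \<in> \<Lambda>"
    and p: "Polynomial.degree p = card \<Lambda> - 1" "Polynomial.lead_coeff p = 1"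
  shows "(\<Sum>v\<in>\<Lambda>. poly p v) = (\<Prod>u\<in>\<Lambda> - {0}. u)"
proof -
  define D where "D = (\<Prod>u\<in>\<Lambda> - {0}. u)"
  define L where "L v = (\<Prod>w\<in>\<Lambda> - {v}. [:- w, 1:])" for v
  have Lv: "poly (L v) v = D" if v: "v \<in> \<Lambda>" for v
  proof -
    have "poly (L v) v = (\<Prod>w\<in>\<Lambda> - {v}. v - w)" by (simp add: L_def poly_prod)
    also have "\<dots> = D"
      unfolding D_def
    proof (rule prod.reindex_bij_witness[of _ "\<lambda>u. v - u" "\<lambda>w. v - w"])
    qed (use v \<Lambda> in auto)
    finally show ?thesis .
  qed
  have Lx: "poly (L v) x = 0" if "v \<noteq> x" "x \<in> \<Lambda>" for v x
    using that \<Lambda>(1) by (auto simp: L_def poly_prod intro!: prod_zero bexI[of _ x])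
  have card: "card (\<Lambda> - {v}) = card \<Lambda> - 1" if "v \<in> \<Lambda>" for v using \<Lambda>(1) that by simp
  have Lc: "Polynomial.degree (L v) = card \<Lambda> - 1" "Polynomial.coeff (L v) (card \<Lambda> - 1) = 1" if "v \<in> \<Lambda>" for v
    using prod_linear_monic[of "\<Lambda> - {v}"] \<Lambda>(1) card[OF that] by (auto simp: L_def)
  \<comment> \<open>\<open>q\<close> has degree below \<open>card \<Lambda>\<close> and vanishes on \<open>\<Lambda>\<close>\<close>
  define q where "q = smult D p - (\<Sum>v\<in>\<Lambda>. smult (poly p v) (L v))"
  have "poly q x = 0" if x: "x \<in> \<Lambda>" for x
  proof -
    have "(\<Sum>v\<in>\<Lambda>. poly p v * poly (L v) x) = (\<Sum>v\<in>\<Lambda>. if v = x then poly p x * D else 0)"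
      using Lv Lx x by (intro sum.cong) auto
    then show ?thesis using x \<Lambda>(1) by (simp add: q_def poly_sum mult.commute)
  qed
  then have "card \<Lambda> \<le> card {x. poly q x = 0}" if "q \<noteq> 0"
    using that by (intro card_mono poly_roots_finite) auto
  moreover have "Polynomial.degree q \<le> card \<Lambda> - 1"
    unfolding q_def using p Lc
    by (intro degree_diff_le degree_sum_le order.trans[OF degree_smult_le]) (auto simp: \<Lambda>(1))
  moreover have "card \<Lambda> > 0" using \<Lambda> by (auto simp: card_gt_0_iff)
  ultimately have "q = 0"
    using card_poly_roots_bound[of q] by (cases "q = 0") auto
  then have "Polynomial.coeff q (card \<Lambda> - 1) = 0" by simp
  then show ?thesis using p Lc by (simp add: q_def coeff_sum D_def)
qed

text \<open>
  A finite vector space \<open>\<Lambda>\<close> over the finite field \<open>'k\<close> inside an integral domain, which \<open>\<kappa>\<close> makes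
  an algebra over \<open>'k\<close>. The linear forms in a polynomial ring are the intended example.
\<close>
locale linear_forms =
  fixes \<kappa> :: "'k::field \<Rightarrow> 'r::idom" and \<Lambda> :: "'r set"
  assumes finite_field: "finite (UNIV :: 'k set)"
    and \<kappa>_add: "\<kappa> (a + b) = \<kappa> a + \<kappa> b" and \<kappa>_mult: "\<kappa> (a * b) = \<kappa> a * \<kappa> b" and \<kappa>_1: "\<kappa> 1 = 1"
    and \<Lambda>_finite: "finite \<Lambda>" and \<Lambda>_0: "0 \<in> \<Lambda>"
    and \<Lambda>_add: "x \<in> \<Lambda> \<Longrightarrow> y \<in> \<Lambda> \<Longrightarrow> x + y \<in> \<Lambda>" and \<Lambda>_scale: "x \<in> \<Lambda> \<Longrightarrow> \<kappa> c * x \<in> \<Lambda>"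
begin

lemma \<kappa>_0: "\<kappa> 0 = 0"
  using add_cancel_right_left[of "\<kappa> 0" "\<kappa> 0"] \<kappa>_add[of 0 0] by (simp only: add_0_right)

lemma \<kappa>_uminus: "\<kappa> (- c) = - \<kappa> c" using \<kappa>_add[of "- c" c] by (simp add: \<kappa>_0 eq_neg_iff_add_eq_0)

lemma \<Lambda>_diff: "x \<in> \<Lambda> \<Longrightarrow> y \<in> \<Lambda> \<Longrightarrow> x - y \<in> \<Lambda>"
  using \<Lambda>_add[of x "\<kappa> (- 1) * y"] \<Lambda>_scale[of y "- 1"] by (simp add: \<kappa>_uminus \<kappa>_1)

fun list_span :: "'r list \<Rightarrow> 'r set" where
  "list_span [] = {0}"
| "list_span (v # vs) = (\<lambda>(c, w). \<kappa> c * v + w) ` (UNIV \<times> list_span vs)"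

fun independent_list :: "'r list \<Rightarrow> bool" where
  "independent_list [] \<longleftrightarrow> True"
| "independent_list (v # vs) \<longleftrightarrow> v \<notin> list_span vs \<and> independent_list vs"

text \<open>
  A monic polynomial of degree \<open>card \<Lambda> - 1\<close> that vanishes on the span of \<open>vs\<close>, provided that the span
  is smaller than \<open>\<Lambda>\<close>. It depends only on the span, which makes \<open>flag_product\<close> equivariant.
\<close>
definition flag_factor :: "'r list \<Rightarrow> 'r Polynomial.poly" where
  "flag_factor vs = Polynomial.monom 1 (card \<Lambda> - 1 - card (list_span vs)) * (\<Prod>w\<in>list_span vs. [:- w, 1:])"

fun flag_product :: "'r list \<Rightarrow> 'r" where
  "flag_product [] = 1"
| "flag_product (v # vs) = flag_product vs * poly (flag_factor vs) v"

lemma finite_list_span: "finite (list_span vs)"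
  by (induction vs) (auto simp: finite_field)

lemma list_span_subset: "set vs \<subseteq> \<Lambda> \<Longrightarrow> list_span vs \<subseteq> \<Lambda>"
  by (induction vs) (auto simp: \<Lambda>_0 intro!: \<Lambda>_add \<Lambda>_scale)

lemma list_span_add: "x \<in> list_span vs \<Longrightarrow> y \<in> list_span vs \<Longrightarrow> x + y \<in> list_span vs"
proof (induction vs arbitrary: x y)
  case (Cons v vs)
  then obtain a w b u where "x = \<kappa> a * v + w" "w \<in> list_span vs" "y = \<kappa> b * v + u" "u \<in> list_span vs" by auto
  then show ?case using Cons.IH[of w u]
    by (auto simp: \<kappa>_add algebra_simps intro!: image_eqI[of _ _ "(a + b, w + u)"])
qed simp

lemma list_span_scale: "x \<in> list_span vs \<Longrightarrow> \<kappa> c * x \<in> list_span vs"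
proof (induction vs arbitrary: x)
  case (Cons v vs)
  then obtain a w where "x = \<kappa> a * v + w" "w \<in> list_span vs" by auto
  then show ?case using Cons.IH[of w]
    by (auto simp: \<kappa>_mult algebra_simps intro!: image_eqI[of _ _ "(c * a, \<kappa> c * w)"])
qed simp

lemma list_span_diff: "x \<in> list_span vs \<Longrightarrow> y \<in> list_span vs \<Longrightarrow> x - y \<in> list_span vs"
  using list_span_add[of x vs "\<kappa> (- 1) * y"] list_span_scale[of y vs "- 1"] by (simp add: \<kappa>_uminus \<kappa>_1)

lemma card_list_span_le: "card (list_span vs) \<le> card (UNIV :: 'k set) ^ length vs"
proof (induction vs)
  case (Cons v vs)
  have "card (list_span (v # vs)) \<le> card ((UNIV :: 'k set) \<times> list_span vs)"
    unfolding list_span.simps by (intro card_image_le finite_cartesian_product finite_list_span finite_field)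
  also have "\<dots> \<le> card (UNIV :: 'k set) * card (UNIV :: 'k set) ^ length vs"
    using Cons by (simp add: card_cartesian_product)
  finally show ?case by simp
qed simp

lemma card_list_span: "independent_list vs \<Longrightarrow> card (list_span vs) = card (UNIV :: 'k set) ^ length vs"
proof (induction vs)
  case (Cons v vs)
  have "inj_on (\<lambda>(c, w). \<kappa> c * v + w) (UNIV \<times> list_span vs)"
  proof (rule inj_onI, clarify)
    fix a w b u assume wu: "w \<in> list_span vs" "u \<in> list_span vs" and eq: "\<kappa> a * v + w = \<kappa> b * v + u"
    have ab: "a = b"
    proof (rule ccontr)
      assume "a \<noteq> b"
      \<comment> \<open>otherwise \<open>v\<close> could be solved for and would lie in the span\<close>
      have "\<kappa> (a - b) * v = u - w"
        using eq \<kappa>_add[of "a - b" b] by (simp add: algebra_simps)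
      then have "\<kappa> (inverse (a - b)) * (\<kappa> (a - b) * v) \<in> list_span vs"
        using wu by (simp add: list_span_scale list_span_diff)
      moreover have "\<kappa> (inverse (a - b)) * (\<kappa> (a - b) * v) = v"
        using \<open>a \<noteq> b\<close> by (simp add: mult.assoc[symmetric] \<kappa>_mult[symmetric] \<kappa>_1)
      ultimately show False using Cons.prems by simp
    qed
    with eq show "a = b \<and> w = u" by simp
  qed
  then have "card (list_span (v # vs)) = card ((UNIV :: 'k set) \<times> list_span vs)"
    by (simp add: card_image)
  then show ?case using Cons by (simp add: card_cartesian_product)
qed simp

lemma flag_product_independent: "flag_product vs \<noteq> 0 \<Longrightarrow> independent_list vs"
proof (induction vs)
  case (Cons v vs)
  have "poly (flag_factor vs) v = 0" if "v \<in> list_span vs"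
    using that finite_list_span[of vs] by (auto simp: flag_factor_def poly_prod intro!: prod_zero bexI[of _ v])
  then show ?case using Cons by auto
qed simp

text \<open>
  The head of the list, added last, is summed first, by \<open>sum_monic_eq_prod_nonzero\<close>. A list of length
  \<open>n < d\<close> spans fewer than \<open>card \<Lambda>\<close> elements, so the degree is right even for dependent lists.
\<close>
lemma sum_flag_product:
  assumes "card \<Lambda> = card (UNIV :: 'k set) ^ d" "n \<le> d"
  shows "(\<Sum>vs | set vs \<subseteq> \<Lambda> \<and> length vs = n. flag_product vs) = (\<Prod>u\<in>\<Lambda> - {0}. u) ^ n"
  using assms(2)
proof (induction n)
  case 0
  have "{vs. set vs \<subseteq> \<Lambda> \<and> length vs = 0} = {[]}" by auto
  then show ?case by simp
next
  case (Suc n)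
  let ?B = "{vs. set vs \<subseteq> \<Lambda> \<and> length vs = n}"
  have step: "(\<Sum>v\<in>\<Lambda>. poly (flag_factor vs) v) = (\<Prod>u\<in>\<Lambda> - {0}. u)" if vs: "vs \<in> ?B" for vs
  proof (rule sum_monic_eq_prod_nonzero[OF \<Lambda>_finite \<Lambda>_0 \<Lambda>_diff])
    have "card (list_span vs) \<le> card (UNIV :: 'k set) ^ n" using card_list_span_le[of vs] vs by simp
    also have "\<dots> < card (UNIV :: 'k set) ^ d"
    proof (rule power_strict_increasing)
      have "card {0, 1 :: 'k} \<le> card (UNIV :: 'k set)" by (rule card_mono) (auto simp: finite_field)
      then show "1 < card (UNIV :: 'k set)" by simp
    qed (use Suc.prems in simp)
    finally have lt: "card (list_span vs) < card \<Lambda>" using assms(1) by simp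
    have "Polynomial.degree (flag_factor vs) =
        Polynomial.degree (Polynomial.monom (1 :: 'r) (card \<Lambda> - 1 - card (list_span vs))) +
        Polynomial.degree (\<Prod>w\<in>list_span vs. [:- w, 1:])"
      unfolding flag_factor_def using finite_list_span[of vs] by (intro degree_mult_eq) (auto simp: monom_eq_0_iff)
    also have "\<dots> = card \<Lambda> - 1 - card (list_span vs) + card (list_span vs)"
      by (simp only: prod_linear_monic(1)[OF finite_list_span] Polynomial.degree_monom_eq[OF one_neq_zero])
    finally show "Polynomial.degree (flag_factor vs) = card \<Lambda> - 1" using lt by simp
    show "Polynomial.lead_coeff (flag_factor vs) = 1"
      unfolding flag_factor_def lead_coeff_mult lead_coeff_prod lead_coeff_monom by simp
  qed
  have "(\<Sum>vs | set vs \<subseteq> \<Lambda> \<and> length vs = Suc n. flag_product vs) =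
      (\<Sum>(vs, v)\<in>?B \<times> \<Lambda>. flag_product (v # vs))"
    unfolding lists_length_Suc_eq
    by (subst sum.reindex) (auto simp: inj_on_def o_def case_prod_unfold)
  also have "\<dots> = (\<Sum>vs\<in>?B. \<Sum>v\<in>\<Lambda>. flag_product vs * poly (flag_factor vs) v)"
    by (simp add: sum.cartesian_product)
  also have "\<dots> = (\<Sum>vs\<in>?B. flag_product vs * (\<Prod>u\<in>\<Lambda> - {0}. u))"
    by (intro sum.cong refl) (simp only: sum_distrib_left[symmetric] step)
  also have "\<dots> = (\<Prod>u\<in>\<Lambda> - {0}. u) ^ n * (\<Prod>u\<in>\<Lambda> - {0}. u)"
    using Suc by (simp add: sum_distrib_right[symmetric])
  finally show ?case by simp
qed

end

lemma sum_free_action: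
  fixes act :: "'g \<Rightarrow> 'x \<Rightarrow> 'x" and r :: "'x \<Rightarrow> 'r::comm_monoid_add"
  assumes fin: "finite B" "finite G"
    and closed: "\<And>g x. g \<in> G \<Longrightarrow> x \<in> B \<Longrightarrow> act g x \<in> B"
    and id: "\<And>x. x \<in> B \<Longrightarrow> \<exists>g\<in>G. act g x = x"
    and comp: "\<And>g h x. g \<in> G \<Longrightarrow> h \<in> G \<Longrightarrow> x \<in> B \<Longrightarrow> \<exists>k\<in>G. act k x = act g (act h x)"
    and inverse: "\<And>g x. g \<in> G \<Longrightarrow> x \<in> B \<Longrightarrow> \<exists>h\<in>G. act h (act g x) = x"
    and free: "\<And>g h x. g \<in> G \<Longrightarrow> h \<in> G \<Longrightarrow> x \<in> B \<Longrightarrow> act g x = act h x \<Longrightarrow> g = h"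
  obtains T where "T \<subseteq> B" "(\<Sum>x\<in>B. r x) = (\<Sum>g\<in>G. \<Sum>x\<in>T. r (act g x))"
proof -
  define orb where "orb x = (\<lambda>g. act g x) ` G" for x
  \<comment> \<open>the choice depends only on the orbit\<close>
  define rep where "rep x = (SOME y. y \<in> orb x)" for x
  have self: "x \<in> orb x" if "x \<in> B" for x using id[OF that] by (force simp: orb_def)
  have orb_B: "orb x \<subseteq> B" if "x \<in> B" for x using closed that by (auto simp: orb_def)
  have orb_sub: "orb y \<subseteq> orb x" if x: "x \<in> B" and y: "y \<in> orb x" for x y
    using comp[OF _ _ x] y by (force simp: orb_def)
  have orb_sym: "x \<in> orb y" if x: "x \<in> B" and y: "y \<in> orb x" for x y
    using inverse[OF _ x] y by (force simp: orb_def)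
  have orb_eq: "orb y = orb x" if x: "x \<in> B" and y: "y \<in> orb x" for x y
    using orb_sub[OF x y] orb_sub[OF _ orb_sym[OF x y]] orb_B[OF x] y by blast
  have rep: "rep x \<in> orb x" if "x \<in> B" for x
    unfolding rep_def using self[OF that] by (rule someI)
  have rep_eq: "rep y = rep x" if "x \<in> B" "y \<in> orb x" for x y
    using orb_eq[OF that] by (simp add: rep_def)
  define T where "T = rep ` B"
  have TB: "T \<subseteq> B" using rep orb_B by (auto simp: T_def)
  have repT: "rep t = t" if "t \<in> T" for t
    using that rep rep_eq by (auto simp: T_def)
  have inj: "inj_on (\<lambda>(g, x). act g x) (G \<times> T)"
  proof (rule inj_onI, clarify)
    fix g x h y assume gh: "g \<in> G" "h \<in> G" and xy: "x \<in> T" "y \<in> T" and eq: "act g x = act h y"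
    have "rep (act g x) = x" "rep (act h y) = y"
      using rep_eq[of x "act g x"] rep_eq[of y "act h y"] gh xy TB repT by (auto simp: orb_def)
    then have "x = y" using eq by simp
    then show "g = h \<and> x = y" using free[OF gh, of x] eq xy TB by auto
  qed
  have "(\<lambda>(g, x). act g x) ` (G \<times> T) = B"
  proof
    show "(\<lambda>(g, x). act g x) ` (G \<times> T) \<subseteq> B" using closed TB by auto
    show "B \<subseteq> (\<lambda>(g, x). act g x) ` (G \<times> T)"
    proof
      fix x assume x: "x \<in> B"
      have "x \<in> orb (rep x)" by (rule orb_sym[OF x rep[OF x]])
      then show "x \<in> (\<lambda>(g, x). act g x) ` (G \<times> T)" using x by (force simp: orb_def T_def)
    qed
  qed
  then have "(\<Sum>x\<in>B. r x) = (\<Sum>(g, x)\<in>G \<times> T. r (act g x))"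
    using sum.reindex[OF inj, of r] by (simp add: case_prod_unfold o_def)
  also have "\<dots> = (\<Sum>g\<in>G. \<Sum>x\<in>T. r (act g x))" by (simp add: sum.cartesian_product)
  finally show thesis using that TB by blast
qed

context linear_forms begin

text \<open>
  The properties of the action of a group element that make \<open>flag_product\<close> and \<open>esym\<close> equivariant.
\<close>
definition form_hom :: "('r \<Rightarrow> 'r) \<Rightarrow> bool" where
  "form_hom h \<longleftrightarrow> (\<forall>x y. h (x + y) = h x + h y) \<and> (\<forall>x y. h (x * y) = h x * h y) \<and>
     (\<forall>c. h (\<kappa> c) = \<kappa> c) \<and> inj_on h \<Lambda> \<and> h ` \<Lambda> \<subseteq> \<Lambda>"

lemma form_homD:
  assumes "form_hom h"
  shows "h (x + y) = h x + h y" "h (x * y) = h x * h y" "h (\<kappa> c) = \<kappa> c" "inj_on h \<Lambda>"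
    "v \<in> \<Lambda> \<Longrightarrow> h v \<in> \<Lambda>" "h 0 = 0" "h 1 = 1" "h (x - y) = h x - h y" "h (x ^ n) = h x ^ n"
    "h (sum f I) = (\<Sum>i\<in>I. h (f i))" "h (prod f I) = (\<Prod>i\<in>I. h (f i))"
proof -
  show add: "h (x + y) = h x + h y" and mult: "h (x * y) = h x * h y" and "h (\<kappa> c) = \<kappa> c" "inj_on h \<Lambda>"
    "v \<in> \<Lambda> \<Longrightarrow> h v \<in> \<Lambda>" for x y using assms by (auto simp: form_hom_def)
  show 0: "h 0 = 0" and 1: "h 1 = 1" using assms \<kappa>_0 \<kappa>_1 unfolding form_hom_def by metis+
  show "h (x - y) = h x - h y" using add[of "x - y" y] by (simp add: eq_diff_eq)
  show "h (x ^ n) = h x ^ n" by (induction n) (auto simp: 1 mult)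
  show "h (sum f I) = (\<Sum>i\<in>I. h (f i))" by (induction I rule: infinite_finite_induct) (auto simp: 0 add)
  show "h (prod f I) = (\<Prod>i\<in>I. h (f i))" by (induction I rule: infinite_finite_induct) (auto simp: 1 mult)
qed

lemma list_span_map:
  assumes "form_hom h"
  shows "list_span (map h vs) = h ` list_span vs"
proof (induction vs)
  case Nil
  then show ?case by (simp add: form_homD[OF assms])
next
  case (Cons v vs)
  have "list_span (map h (v # vs)) = (\<lambda>(c, w). \<kappa> c * h v + h w) ` (UNIV \<times> list_span vs)"
    by (auto simp: Cons)
  also have "\<dots> = h ` list_span (v # vs)"
    unfolding list_span.simps image_image
    by (intro image_cong refl) (auto simp: form_homD[OF assms])
  finally show ?case .
qed

lemma independent_list_map:
  assumes "form_hom h" "set vs \<subseteq> \<Lambda>" "independent_list vs"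
  shows "independent_list (map h vs)"
  using assms(2,3)
proof (induction vs)
  case (Cons v vs)
  have "h v \<notin> h ` list_span vs"
    using Cons.prems list_span_subset[of vs] form_homD(4)[OF assms(1)] by (auto simp: inj_on_def)
  then show ?case using Cons by (simp add: list_span_map[OF assms(1)])
qed simp

lemma flag_product_map:
  assumes "form_hom h" "set vs \<subseteq> \<Lambda>"
  shows "flag_product (map h vs) = h (flag_product vs)"
  using assms(2)
proof (induction vs)
  case (Cons v vs)
  have inj: "inj_on h (list_span vs)"
    using list_span_subset[of vs] Cons.prems form_homD(4)[OF assms(1)] by (auto intro: inj_on_subset)
  have "poly (flag_factor (map h vs)) (h v) = h (poly (flag_factor vs) v)"
    using inj by (simp add: flag_factor_def poly_monom poly_prod list_span_map[OF assms(1)] card_image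
      prod.reindex o_def form_homD[OF assms(1)])
  then show ?case using Cons by (simp add: form_homD[OF assms(1)])
qed (simp add: form_homD[OF assms(1)])

lemma list_span_eqI:
  assumes "form_hom g" "form_hom h" "map g vs = map h vs" "x \<in> list_span vs"
  shows "g x = h x"
  using assms(3,4)
  by (induction vs arbitrary: x) (auto simp: form_homD[OF assms(1)] form_homD[OF assms(2)])

text \<open>
  Dependent lists contribute zero to \<open>sum_flag_product\<close>. An independent list of length \<open>d\<close> spans
  \<open>\<Lambda>\<close>, so an element of the group that fixes it acts trivially: the action on such lists is free.
\<close>
theorem trace_eq_power:
  assumes card: "card \<Lambda> = card (UNIV :: 'k set) ^ d" and G: "finite G"
    and hom: "\<And>g. g \<in> G \<Longrightarrow> form_hom (act g)"
    and id: "\<exists>g\<in>G. \<forall>x\<in>\<Lambda>. act g x = x"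
    and comp: "\<And>g h. g \<in> G \<Longrightarrow> h \<in> G \<Longrightarrow> \<exists>k\<in>G. \<forall>x\<in>\<Lambda>. act k x = act g (act h x)"
    and inverse: "\<And>g. g \<in> G \<Longrightarrow> \<exists>h\<in>G. \<forall>x\<in>\<Lambda>. act h (act g x) = x"
    and faithful: "\<And>g h. g \<in> G \<Longrightarrow> h \<in> G \<Longrightarrow> \<forall>x\<in>\<Lambda>. act g x = act h x \<Longrightarrow> g = h"
  shows "\<exists>r. (\<Sum>g\<in>G. act g r) = (\<Prod>u\<in>\<Lambda> - {0}. u) ^ d"
proof -
  let ?L = "{vs. set vs \<subseteq> \<Lambda> \<and> length vs = d}"
  define B where "B = {vs \<in> ?L. independent_list vs}"
  have finL: "finite ?L" by (rule finite_lists_length_eq[OF \<Lambda>_finite])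
  have B: "vs \<in> B \<Longrightarrow> set vs \<subseteq> \<Lambda>" "vs \<in> B \<Longrightarrow> x \<in> set vs \<Longrightarrow> x \<in> \<Lambda>" for vs x by (auto simp: B_def)
  obtain T where T: "T \<subseteq> B"
    "(\<Sum>vs\<in>B. flag_product vs) = (\<Sum>g\<in>G. \<Sum>vs\<in>T. flag_product (map (act g) vs))"
  proof (rule sum_free_action[where B = B and G = G and act = "\<lambda>g. map (act g)" and r = flag_product])
    show "finite B" by (rule finite_subset[OF _ finL]) (auto simp: B_def)
    show "map (act g) vs \<in> B" if g: "g \<in> G" and vs: "vs \<in> B" for g vs
      using vs form_homD(5)[OF hom[OF g]] independent_list_map[OF hom[OF g]] by (auto simp: B_def)
    show "\<exists>g\<in>G. map (act g) vs = vs" if "vs \<in> B" for vs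
      using id B(2)[OF that] by (metis map_idI)
    show "\<exists>k\<in>G. map (act k) vs = map (act g) (map (act h) vs)" if gh: "g \<in> G" "h \<in> G" and vs: "vs \<in> B" for g h vs
    proof -
      obtain k where "k \<in> G" "\<forall>x\<in>\<Lambda>. act k x = act g (act h x)" using comp[OF gh] by blast
      then show ?thesis using B(2)[OF vs] by (intro bexI[of _ k]) auto
    qed
    show "\<exists>h\<in>G. map (act h) (map (act g) vs) = vs" if g: "g \<in> G" and vs: "vs \<in> B" for g vs
    proof -
      obtain h where "h \<in> G" "\<forall>x\<in>\<Lambda>. act h (act g x) = x" using inverse[OF g] by blast
      then show ?thesis using B(2)[OF vs] by (intro bexI[of _ h]) (auto intro: map_idI)
    qed
    show "g = h" if gh: "g \<in> G" "h \<in> G" and vs: "vs \<in> B" and eq: "map (act g) vs = map (act h) vs" for g h vs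
    proof (rule faithful[OF gh], rule ballI)
      fix x assume x: "x \<in> \<Lambda>"
      have "list_span vs = \<Lambda>"
        using list_span_subset[of vs] card_list_span[of vs] card vs \<Lambda>_finite
        by (intro card_subset_eq) (auto simp: B_def)
      then show "act g x = act h x" using list_span_eqI[OF hom hom eq] gh x by blast
    qed
  qed (use G in auto)
  have "(\<Sum>vs\<in>?L. flag_product vs) = (\<Sum>vs\<in>B. flag_product vs)"
    using finL flag_product_independent by (intro sum.mono_neutral_right) (auto simp: B_def)
  then have "(\<Prod>u\<in>\<Lambda> - {0}. u) ^ d = (\<Sum>vs\<in>B. flag_product vs)"
    using sum_flag_product[OF card, of d] by simp
  also have "\<dots> = (\<Sum>g\<in>G. act g (\<Sum>vs\<in>T. flag_product vs))"
    unfolding T(2) using T(1) B(1)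
    by (intro sum.cong refl) (auto simp: form_homD(10)[OF hom] flag_product_map[OF hom] subset_iff intro!: sum.cong)
  finally show ?thesis by metis
qed

text \<open>
  Up to sign the elementary symmetric functions of \<open>\<Lambda>\<close>, that is the coefficients of
  \<open>\<Prod> (X - u)\<close>.
\<close>
definition esym :: "nat \<Rightarrow> 'r" where
  "esym k = (\<Sum>T | T \<subseteq> \<Lambda> \<and> card T = k. \<Prod>u\<in>T. - u)"

lemma esym_0: "esym 0 = 1"
proof -
  have "{T. T \<subseteq> \<Lambda> \<and> card T = 0} = {{}}" using \<Lambda>_finite by (auto dest: finite_subset)
  then show ?thesis by (simp add: esym_def)
qed

lemma esym_invariant:
  assumes "form_hom h"
  shows "h (esym k) = esym k"
proof -
  have hL: "h ` \<Lambda> = \<Lambda>"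
    using form_homD(4,5)[OF assms] \<Lambda>_finite by (intro endo_inj_surj) auto
  have neg: "h (- u) = - h u" for u using form_homD(8)[OF assms, of 0 u] by (simp add: form_homD[OF assms])
  have bij: "bij_betw ((`) h) {T. T \<subseteq> \<Lambda> \<and> card T = k} {T. T \<subseteq> \<Lambda> \<and> card T = k}"
  proof (rule bij_betw_imageI)
    show "inj_on ((`) h) {T. T \<subseteq> \<Lambda> \<and> card T = k}"
      by (rule inj_on_subset[OF inj_on_image_Pow[OF form_homD(4)[OF assms]]]) auto
    show "(`) h ` {T. T \<subseteq> \<Lambda> \<and> card T = k} = {T. T \<subseteq> \<Lambda> \<and> card T = k}"
    proof (rule endo_inj_surj)
      show "finite {T. T \<subseteq> \<Lambda> \<and> card T = k}" using \<Lambda>_finite by simp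
      show "(`) h ` {T. T \<subseteq> \<Lambda> \<and> card T = k} \<subseteq> {T. T \<subseteq> \<Lambda> \<and> card T = k}"
        using form_homD(4)[OF assms] hL by (auto simp: card_image inj_on_subset)
    qed fact
  qed
  have "h (esym k) = (\<Sum>T | T \<subseteq> \<Lambda> \<and> card T = k. \<Prod>u\<in>T. - h u)"
    by (simp add: esym_def form_homD[OF assms] neg)
  also have "\<dots> = (\<Sum>T | T \<subseteq> \<Lambda> \<and> card T = k. \<Prod>u\<in>h ` T. - u)"
  proof (intro sum.cong refl)
    fix T assume "T \<in> {T. T \<subseteq> \<Lambda> \<and> card T = k}"
    then have "inj_on h T" using form_homD(4)[OF assms] by (auto intro: inj_on_subset)
    then show "(\<Prod>u\<in>T. - h u) = (\<Prod>u\<in>h ` T. - u)" by (simp add: prod.reindex)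
  qed
  also have "\<dots> = esym k" unfolding esym_def using sum.reindex_bij_betw[OF bij] by simp
  finally show ?thesis .
qed

text \<open>
  Expand the right hand side of \<open>0 = \<Prod> (x - u)\<close>, over \<open>u\<close> in \<open>\<Lambda>\<close>, in powers of \<open>x\<close>.
\<close>
lemma power_card_in_span_esym:
  assumes "x \<in> \<Lambda>"
  shows "x ^ card \<Lambda> \<in> ideal_span (esym ` {1..card \<Lambda>})"
proof -
  let ?f = "\<lambda>T. (\<Prod>u\<in>T. - u) * x ^ (card \<Lambda> - card T)"
  have "0 = (\<Prod>u\<in>\<Lambda>. - u + x)" using assms \<Lambda>_finite by (auto intro!: prod_zero[symmetric] bexI[of _ x])
  also have "\<dots> = (\<Sum>T\<in>Pow \<Lambda>. (\<Prod>u\<in>T. - u) * (\<Prod>u\<in>\<Lambda> - T. x))"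
    by (rule prod_add[OF \<Lambda>_finite])
  also have "\<dots> = (\<Sum>T\<in>Pow \<Lambda>. ?f T)"
    using \<Lambda>_finite by (intro sum.cong) (auto simp: card_Diff_subset finite_subset)
  also have "\<dots> = (\<Sum>k\<in>{0..card \<Lambda>}. \<Sum>T | T \<in> Pow \<Lambda> \<and> card T = k. ?f T)"
    using \<Lambda>_finite by (intro sum.group[symmetric]) (auto intro: card_mono)
  also have "\<dots> = (\<Sum>k\<in>{0..card \<Lambda>}. esym k * x ^ (card \<Lambda> - k))"
    by (intro sum.cong refl) (auto simp: esym_def sum_distrib_right)
  also have "\<dots> = x ^ card \<Lambda> + (\<Sum>k\<in>{1..card \<Lambda>}. esym k * x ^ (card \<Lambda> - k))"
    by (simp add: sum.atLeast_Suc_atMost esym_0)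
  finally have "x ^ card \<Lambda> = - (\<Sum>k\<in>{1..card \<Lambda>}. esym k * x ^ (card \<Lambda> - k))"
    by (simp add: eq_neg_iff_add_eq_0)
  moreover have "(\<Sum>k\<in>{1..card \<Lambda>}. x ^ (card \<Lambda> - k) * esym k) \<in> ideal_span (esym ` {1..card \<Lambda>})"
    by (intro ideal_span_sum ideal_span_scale
        ideal_span_base) auto
  ultimately show ?thesis by (simp add: ideal_span_neg mult.commute)
qed

end

section \<open>Dual bases and the general linear group\<close>

lemma Const_eq_iff: "Const a = Const c \<longleftrightarrow> a = c"
  unfolding Const_def by (metis lookup_single_eq)

lemma vector_space_self: "vector_space ((*) :: 'k::field \<Rightarrow> 'k \<Rightarrow> 'k)"
  by unfold_locales (auto simp: algebra_simps)

lemma dual_space_iff: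
  assumes "vector_space scale"
  shows "f \<in> dual_space scale \<longleftrightarrow> (\<forall>x y. f (x + y) = f x + f y) \<and> (\<forall>c x. f (scale c x) = c * f x)"
  using assms vector_space_self
  by (auto simp: dual_space_def Vector_Spaces.linear_iff)

lemma general_linear_iff:
  assumes "vector_space scale"
  shows "g \<in> carrier (general_linear scale) \<longleftrightarrow>
    (\<forall>x y. g (x + y) = g x + g y) \<and> (\<forall>c x. g (scale c x) = scale c (g x)) \<and> bij g"
  using assms by (auto simp: general_linear_def Vector_Spaces.linear_iff)

lemma general_linear_inv:
  assumes "vector_space scale" "g \<in> carrier (general_linear scale)"
  shows "inv_into UNIV g \<in> carrier (general_linear scale)"
proof -
  have g: "bij g" "\<And>x y. g (x + y) = g x + g y" "\<And>c x. g (scale c x) = scale c (g x)"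
    using assms(2) by (auto simp: general_linear_iff[OF assms(1)])
  have gi: "g (inv_into UNIV g x) = x" "inv_into UNIV g (g x) = x" for x
    using g(1) by (simp_all add: bij_is_surj surj_f_inv_f bij_is_inj inv_f_f)
  have "inv_into UNIV g (x + y) = inv_into UNIV g x + inv_into UNIV g y" for x y
    using gi(2)[of "inv_into UNIV g x + inv_into UNIV g y"] by (simp add: g(2) gi(1))
  moreover have "inv_into UNIV g (scale c x) = scale c (inv_into UNIV g x)" for c x
    using gi(2)[of "scale c (inv_into UNIV g x)"] by (simp add: g(3) gi(1))
  ultimately show ?thesis
    using bij_imp_bij_inv[OF g(1)] by (simp add: general_linear_iff[OF assms(1)])
qed

lemma general_linear_group:
  assumes "vector_space scale"
  shows "group (general_linear scale)"
proof (rule groupI)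
  fix g assume g: "g \<in> carrier (general_linear scale)"
  then have "bij g" by (simp add: general_linear_iff[OF assms])
  then have "inv_into UNIV g \<otimes>\<^bsub>general_linear scale\<^esub> g = \<one>\<^bsub>general_linear scale\<^esub>"
    by (simp add: general_linear_def bij_is_inj)
  then show "\<exists>h\<in>carrier (general_linear scale). h \<otimes>\<^bsub>general_linear scale\<^esub> g = \<one>\<^bsub>general_linear scale\<^esub>"
    using general_linear_inv[OF assms g] by blast
next
  fix g h assume "g \<in> carrier (general_linear scale)" "h \<in> carrier (general_linear scale)"
  moreover have "g \<otimes>\<^bsub>general_linear scale\<^esub> h = g \<circ> h" by (simp add: general_linear_def)
  ultimately show "g \<otimes>\<^bsub>general_linear scale\<^esub> h \<in> carrier (general_linear scale)"
    by (simp add: general_linear_iff[OF assms] bij_comp)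
next
  have "\<one>\<^bsub>general_linear scale\<^esub> = id" by (simp add: general_linear_def)
  then show "\<one>\<^bsub>general_linear scale\<^esub> \<in> carrier (general_linear scale)"
    by (simp add: general_linear_iff[OF assms])
qed (auto simp: general_linear_def)

text \<open>
  A basis \<open>v\<close> of the vector space, indexed by \<open>{..<d}\<close>, with its dual basis \<open>b\<close>.
\<close>
locale dual_basis =
  fixes scale :: "'k::field \<Rightarrow> 'v::ab_group_add \<Rightarrow> 'v" and d :: nat
    and v :: "nat \<Rightarrow> 'v" and b :: "nat \<Rightarrow> 'v \<Rightarrow> 'k"
  assumes vector_space: "vector_space scale"
    and finite_scalars: "finite (UNIV :: 'k set)"
    and b_dual: "i < d \<Longrightarrow> b i \<in> dual_space scale"
    and b_v: "i < d \<Longrightarrow> l < d \<Longrightarrow> b i (v l) = (if i = l then 1 else 0)"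
    and dual_expand: "f \<in> dual_space scale \<Longrightarrow> f x = (\<Sum>i<d. f (v i) * b i x)"
    and separating: "(\<And>f. f \<in> dual_space scale \<Longrightarrow> f x = f y) \<Longrightarrow> x = y"

lemma dual_basis_ex:
  fixes scale :: "'k::field \<Rightarrow> 'v::ab_group_add \<Rightarrow> 'v"
  assumes "finite_dimensional_vector_space scale Basis" "vector_space.dim scale (UNIV :: 'v set) = d"
    and "finite (UNIV :: 'k set)"
  obtains v b where "dual_basis scale d v b"
proof -
  interpret finite_dimensional_vector_space scale Basis by fact
  have "card Basis = d" using assms(2) dim_UNIV by (simp add: dimension_def)
  then obtain v where v: "bij_betw v {0..<d} Basis"
    using ex_bij_betw_nat_finite[OF finite_Basis] by metis
  have vB: "v i \<in> Basis" if "i < d" for i using v that by (auto simp: bij_betw_def)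
  define b where "b i x = representation Basis x (v i)" for i x
  have span: "x \<in> span Basis" for x using span_Basis by simp
  have expand: "x = (\<Sum>i<d. scale (b i x) (v i))" for x
  proof -
    have "x = (\<Sum>w\<in>Basis. scale (representation Basis x w) w)"
      using sum_representation_eq[OF independent_Basis span finite_Basis order_refl, of x] by simp
    also have "\<dots> = (\<Sum>i\<in>{0..<d}. scale (representation Basis x (v i)) (v i))"
      by (rule sum.reindex_bij_betw[OF v, symmetric])
    finally show ?thesis by (simp add: b_def atLeast0LessThan)
  qed
  have b_dual: "b i \<in> dual_space scale" for i
    unfolding dual_space_iff[OF vector_space_axioms]
    by (simp add: b_def representation_add[OF independent_Basis span span]
        representation_scale[OF independent_Basis span])
  have "dual_basis scale d v b"
  proof (rule dual_basis.intro)
    show "vector_space scale" by (rule vector_space_axioms)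
    show "b i (v l) = (if i = l then 1 else 0)" if il: "i < d" "l < d" for i l
    proof -
      have "v l = v i \<longleftrightarrow> l = i" using v il by (auto simp: bij_betw_def inj_on_def)
      then show ?thesis
        using representation_basis[OF independent_Basis vB[OF il(2)]] by (auto simp: b_def)
    qed
    show "f x = (\<Sum>i<d. f (v i) * b i x)" if f: "f \<in> dual_space scale" for f x
    proof -
      have add: "f (x + y) = f x + f y" and sc: "f (scale c x) = c * f x" for x y c
        using f by (auto simp: dual_space_iff[OF vector_space_axioms])
      have "f 0 = 0" using sc[of 0 0] by simp
      then have "f (\<Sum>i\<in>I. scale (b i x) (v i)) = (\<Sum>i\<in>I. f (v i) * b i x)" for I
        by (induction I rule: infinite_finite_induct) (auto simp: add sc mult.commute)
      then show ?thesis using expand[of x] by metis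
    qed
    show "x = y" if "\<And>f. f \<in> dual_space scale \<Longrightarrow> f x = f y" for x y
      using expand[of x] expand[of y] that[OF b_dual] by simp
  qed (use b_dual assms(3) in auto)
  then show thesis by (rule that)
qed

section \<open>The symmetric algebra as a polynomial ring\<close>

context dual_basis begin

abbreviation "W \<equiv> dual_space scale"
abbreviation "GL \<equiv> carrier (general_linear scale)"
abbreviation "R\<^sub>d \<equiv> carrier (mpoly_ring {..<d} :: (nat, 'k) mpoly ring)"

lemmas mem_dual = dual_space_iff[OF vector_space]

lemma dual_add: "f \<in> W \<Longrightarrow> h \<in> W \<Longrightarrow> (\<lambda>x. f x + h x) \<in> W"
  by (auto simp: mem_dual algebra_simps)

lemma dual_scale: "f \<in> W \<Longrightarrow> (\<lambda>x. c * f x) \<in> W"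
  by (auto simp: mem_dual algebra_simps)

lemma dual_zero: "(\<lambda>x. 0) \<in> W"
  by (auto simp: mem_dual)

lemma dual_action_dual: "g \<in> GL \<Longrightarrow> f \<in> W \<Longrightarrow> dual_action g f \<in> W"
  using general_linear_inv[OF vector_space, of g]
  by (auto simp: mem_dual general_linear_iff[OF vector_space] dual_action_def)

lemma dual_action_comp:
  "g \<in> GL \<Longrightarrow> h \<in> GL \<Longrightarrow>
    dual_action g (dual_action h f) = dual_action (g \<circ> h) f"
  by (auto simp: dual_action_def general_linear_iff[OF vector_space] o_inv_distrib o_assoc)

text \<open>
  The linear form \<open>f\<close> written in the coordinates of the dual basis.
\<close>
definition lin :: "('v \<Rightarrow> 'k) \<Rightarrow> (nat, 'k) mpoly" where
  "lin f = (\<Sum>i<d. Const (f (v i)) * Var i)"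

text \<open>
  \<open>to_poly\<close> and \<open>of_poly\<close> induce inverse isomorphisms between the symmetric algebra and the polynomial
  ring in \<open>d\<close> variables.
\<close>
definition to_poly :: "('v \<Rightarrow> 'k, 'k) mpoly \<Rightarrow> (nat, 'k) mpoly" where
  "to_poly = subst lin"

definition of_poly :: "(nat, 'k) mpoly \<Rightarrow> ('v \<Rightarrow> 'k, 'k) mpoly" where
  "of_poly = subst (\<lambda>i. if i < d then Var (b i) else 0)"

text \<open>
  The action on polynomials. Variables with index at least \<open>d\<close> are sent to zero; thus \<open>act g\<close> is
  defined on the whole integral domain of polynomials in variables indexed by \<open>nat\<close>, takes values in
  those in the first \<open>d\<close> variables, and restricts there to the automorphism induced by \<open>g\<close>.
\<close>
definition act :: "('v \<Rightarrow> 'v) \<Rightarrow> (nat, 'k) mpoly \<Rightarrow> (nat, 'k) mpoly" where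
  "act g = subst (\<lambda>i. if i < d then lin (dual_action g (b i)) else 0)"

lemma lin_closed [simp]: "lin f \<in> R\<^sub>d"
  unfolding lin_def by (intro mpoly_ring_sum mpoly_ring_mult mpoly_ring_Const mpoly_ring_Var) auto

lemma lin_add: "lin (\<lambda>x. f x + h x) = lin f + lin h"
  by (simp add: lin_def Const_add distrib_right sum.distrib)

lemma lin_scale: "lin (\<lambda>x. c * f x) = Const c * lin f"
  by (simp add: lin_def Const_mult sum_distrib_left mult.assoc)

lemma lin_zero: "lin (\<lambda>x. 0) = 0"
  by (simp add: lin_def)

lemma lin_sum: "lin (\<lambda>x. \<Sum>i\<in>I. c i * h i x) = (\<Sum>i\<in>I. Const (c i) * lin (h i))"
proof (induction I rule: infinite_finite_induct)
  case (insert i I)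
  then show ?case using lin_add[of "\<lambda>x. c i * h i x" "\<lambda>x. \<Sum>i\<in>I. c i * h i x"] lin_scale by simp
qed (simp_all add: lin_zero)

lemma lin_b: "i < d \<Longrightarrow> lin (b i) = Var i"
proof -
  assume i: "i < d"
  have "lin (b i) = (\<Sum>l<d. if i = l then Var l else 0)"
    unfolding lin_def using i by (intro sum.cong refl) (auto simp: b_v)
  then show ?thesis using i by simp
qed

lemma homogeneous_lin: "homogeneous 1 (lin f)"
  unfolding lin_def
proof (rule homogeneous_sum)
  show "homogeneous 1 (Const (f (v i)) * Var i)" for i
    using homogeneous_mult[OF homogeneous_Const homogeneous_Var, of "f (v i)" i] by simp
qed

lemma lin_inj: "inj_on lin W"
proof (rule inj_onI)
  fix f h assume fh: "f \<in> W" "h \<in> W" and eq: "lin f = lin h"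
  have ev: "subst (\<lambda>i. Const (if i = j then 1 else 0 :: 'k)) (lin f) = (Const (f (v j)) :: (nat, 'k) mpoly)"
    if "j < d" for j f
  proof -
    have "subst (\<lambda>i. Const (if i = j then 1 else 0 :: 'k)) (lin f) =
        (\<Sum>i<d. if i = j then Const (f (v j)) else 0 :: (nat, 'k) mpoly)"
      unfolding lin_def subst_sum by (intro sum.cong) (auto simp: subst_mult)
    then show ?thesis using that by simp
  qed
  have "f (v j) = h (v j)" if "j < d" for j
    using ev[OF that, of f] ev[OF that, of h] eq by (simp add: Const_eq_iff)
  then have "(\<Sum>i<d. f (v i) * b i x) = (\<Sum>i<d. h (v i) * b i x)" for x by (intro sum.cong) auto
  then have "f x = h x" for x unfolding dual_expand[OF fh(1), of x] dual_expand[OF fh(2), of x] .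
  then show "f = h" by blast
qed

lemma act_lin: "f \<in> W \<Longrightarrow> act g (lin f) = lin (dual_action g f)"
proof -
  assume f: "f \<in> W"
  have "act g (lin f) = (\<Sum>i<d. Const (f (v i)) * lin (dual_action g (b i)))"
    by (simp add: act_def lin_def[of f] subst_sum subst_mult)
  also have "\<dots> = lin (\<lambda>x. \<Sum>i<d. f (v i) * dual_action g (b i) x)"
    by (rule lin_sum[symmetric])
  also have "(\<lambda>x. \<Sum>i<d. f (v i) * dual_action g (b i) x) = dual_action g f"
    unfolding dual_action_def comp_def by (rule ext, rule dual_expand[OF f, symmetric])
  finally show ?thesis .
qed

lemma act_closed: "act g a \<in> R\<^sub>d"
  unfolding act_def by (rule mpoly_ring_subst[OF mpoly_ring_UNIV]) auto

lemma act_comp: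
  assumes "g \<in> GL" "h \<in> GL"
  shows "act g (act h a) = act (g \<circ> h) a"
proof -
  have "(\<lambda>i. act g (if i < d then lin (dual_action h (b i)) else 0)) =
      (\<lambda>i. if i < d then lin (dual_action (g \<circ> h) (b i)) else 0)"
    using act_lin[OF dual_action_dual[OF assms(2) b_dual]]
    by (intro ext) (simp add: act_def dual_action_comp[OF assms])
  then show ?thesis by (simp add: act_def[of h] act_def[of "g \<circ> h"] act_def[of g] subst_subst)
qed

lemma act_id: "a \<in> R\<^sub>d \<Longrightarrow> act id a = a"
  unfolding act_def by (subst subst_cong[where \<tau> = Var]) (auto simp: dual_action_def lin_b)

lemma to_poly_closed: "to_poly p \<in> R\<^sub>d"
  unfolding to_poly_def by (rule mpoly_ring_subst[OF mpoly_ring_UNIV]) auto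

lemma of_poly_closed: "of_poly a \<in> carrier (mpoly_ring W)"
  unfolding of_poly_def
  by (rule mpoly_ring_subst[OF mpoly_ring_UNIV]) (auto intro: mpoly_ring_Var b_dual)

lemma to_poly_of_poly: "a \<in> R\<^sub>d \<Longrightarrow> to_poly (of_poly a) = a"
  unfolding to_poly_def of_poly_def subst_subst
  by (subst subst_cong[where \<tau> = Var]) (auto simp: lin_b)

lemma to_poly_rename:
  assumes "p \<in> carrier (mpoly_ring W)"
  shows "to_poly (rename (dual_action g) p) = act g (to_poly p)"
  unfolding to_poly_def rename_eq_subst subst_subst act_def subst_Var
  by (rule subst_cong[OF assms]) (use act_lin in \<open>auto simp: act_def\<close>)

lemma rename_closed:
  assumes "g \<in> GL" "p \<in> carrier (mpoly_ring W)"
  shows "rename (dual_action g) p \<in> carrier (mpoly_ring W)"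
  unfolding rename_eq_subst
  by (rule mpoly_ring_subst[OF assms(2)]) (auto intro: mpoly_ring_Var dual_action_dual[OF assms(1)])

lemma sym_relations_closed: "sym_relations W \<subseteq> carrier (mpoly_ring W)"
  by (auto simp: sym_relations_def
      intro!: mpoly_ring_diff mpoly_ring_mult mpoly_ring_Var dual_add dual_scale)

lemma sym_ideal_ideal: "ideal (sym_ideal W) (mpoly_ring W)"
proof -
  interpret P: cring "mpoly_ring W :: ('v \<Rightarrow> 'k, 'k) mpoly ring" by (rule mpoly_ring_cring)
  show ?thesis unfolding sym_ideal_def by (rule P.genideal_ideal[OF sym_relations_closed])
qed

lemma sym_ideal_closure:
  shows sym_ideal_add: "p \<in> sym_ideal W \<Longrightarrow> q \<in> sym_ideal W \<Longrightarrow> p + q \<in> sym_ideal W"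
    and sym_ideal_mult: "p \<in> sym_ideal W \<Longrightarrow> q \<in> carrier (mpoly_ring W) \<Longrightarrow> q * p \<in> sym_ideal W"
    and sym_ideal_zero: "0 \<in> sym_ideal W"
    and sym_ideal_relation: "p \<in> sym_relations W \<Longrightarrow> p \<in> sym_ideal W"
    and sym_ideal_carrier: "p \<in> sym_ideal W \<Longrightarrow> p \<in> carrier (mpoly_ring W)"
proof -
  interpret P: cring "mpoly_ring W :: ('v \<Rightarrow> 'k, 'k) mpoly ring" by (rule mpoly_ring_cring)
  interpret I: ideal "sym_ideal W" "mpoly_ring W :: ('v \<Rightarrow> 'k, 'k) mpoly ring" by (rule sym_ideal_ideal)
  show "p \<in> sym_ideal W \<Longrightarrow> q \<in> sym_ideal W \<Longrightarrow> p + q \<in> sym_ideal W"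
    using I.a_closed by simp
  show "p \<in> sym_ideal W \<Longrightarrow> q \<in> carrier (mpoly_ring W) \<Longrightarrow> q * p \<in> sym_ideal W"
    using I.I_l_closed by simp
  show "0 \<in> sym_ideal W" using I.zero_closed by simp
  show "p \<in> sym_relations W \<Longrightarrow> p \<in> sym_ideal W"
    using P.genideal_self[OF sym_relations_closed] by (auto simp: sym_ideal_def)
  show "p \<in> sym_ideal W \<Longrightarrow> p \<in> carrier (mpoly_ring W)" by (rule I.Icarr)
qed

lemma to_poly_sym_ideal:
  assumes "p \<in> sym_ideal W"
  shows "to_poly p = 0"
proof -
  interpret P: cring "mpoly_ring W :: ('v \<Rightarrow> 'k, 'k) mpoly ring" by (rule mpoly_ring_cring)
  let ?K = "{p \<in> carrier (mpoly_ring W). to_poly p = 0}"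
  have inv: "inv\<^bsub>add_monoid (mpoly_ring W)\<^esub> p = - p" if "p \<in> carrier (mpoly_ring W)"
    for p :: "('v \<Rightarrow> 'k, 'k) mpoly"
    using P.minus_equality[of "- p" p] that mpoly_ring_uminus[OF that] by (simp add: a_inv_def)
  have "ideal ?K (mpoly_ring W)"
  proof (rule idealI)
    show "ring (mpoly_ring W :: ('v \<Rightarrow> 'k, 'k) mpoly ring)" by (rule P.ring_axioms)
    show "subgroup ?K (add_monoid (mpoly_ring W))"
    proof (rule subgroup.intro)
      fix p assume p: "p \<in> ?K"
      then have "inv\<^bsub>add_monoid (mpoly_ring W)\<^esub> p = - p" by (intro inv) simp
      then show "inv\<^bsub>add_monoid (mpoly_ring W)\<^esub> p \<in> ?K"
        using p mpoly_ring_uminus[of p W] by (simp only: to_poly_def subst_uminus mem_Collect_eq) simp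
    qed (auto simp: to_poly_def subst_add intro: mpoly_ring_add)
  qed (auto simp: to_poly_def subst_mult intro: mpoly_ring_mult)
  moreover have "sym_relations W \<subseteq> ?K"
    using sym_relations_closed
    by (auto simp: sym_relations_def to_poly_def subst_diff subst_mult lin_add lin_scale)
  ultimately have "sym_ideal W \<subseteq> ?K"
    unfolding sym_ideal_def by (rule P.genideal_minimal)
  then show ?thesis using assms by auto
qed

lemma sym_relation_add:
  "f \<in> W \<Longrightarrow> h \<in> W \<Longrightarrow> Var (\<lambda>x. f x + h x) - Var f - Var h \<in> sym_relations W"
  unfolding sym_relations_def by blast

lemma sym_relation_scale:
  "f \<in> W \<Longrightarrow> Var (\<lambda>x. c * f x) - Const c * Var f \<in> sym_relations W"
  unfolding sym_relations_def by blast

text \<open>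
  The defining relations express the variable of any linear form through those of the dual basis.
\<close>
lemma Var_sum_relation:
  assumes "n \<le> d"
  shows "Var (\<lambda>x. \<Sum>i<n. c i * b i x) - (\<Sum>i<n. Const (c i) * Var (b i)) \<in> sym_ideal W"
  using assms
proof (induction n)
  case 0
  have "Var (\<lambda>x. 0 * (0 :: 'k)) - Const 0 * Var (\<lambda>x. 0) \<in> sym_relations W"
    by (rule sym_relation_scale[OF dual_zero])
  then show ?case using sym_ideal_relation by simp
next
  case (Suc n)
  have sum_dual: "(\<lambda>x. \<Sum>i<m. c i * b i x) \<in> W" if "m \<le> d" for m
    using that
  proof (induction m)
    case (Suc m)
    then show ?case using dual_add[OF Suc.IH dual_scale[OF b_dual[of m], of "c m"]] by simp
  qed (simp add: dual_zero)
  have bn: "b n \<in> W" using Suc.prems by (intro b_dual) simp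
  let ?f = "\<lambda>x. \<Sum>i<n. c i * b i x"
  have "Var (\<lambda>x. ?f x + c n * b n x) - Var ?f - Var (\<lambda>x. c n * b n x) \<in> sym_relations W"
    using sum_dual[of n] dual_scale[OF bn] Suc.prems by (intro sym_relation_add) auto
  moreover have "Var (\<lambda>x. c n * b n x) - Const (c n) * Var (b n) \<in> sym_relations W"
    by (rule sym_relation_scale[OF bn])
  ultimately have "(Var ?f - (\<Sum>i<n. Const (c i) * Var (b i))) +
     ((Var (\<lambda>x. ?f x + c n * b n x) - Var ?f - Var (\<lambda>x. c n * b n x)) +
      (Var (\<lambda>x. c n * b n x) - Const (c n) * Var (b n))) \<in> sym_ideal W"
    using Suc by (intro sym_ideal_add) (auto intro: sym_ideal_relation)
  then show ?case by (simp add: algebra_simps)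
qed

lemma of_poly_to_poly:
  assumes "p \<in> carrier (mpoly_ring W)"
  shows "p - of_poly (to_poly p) \<in> sym_ideal W"
  using assms
proof (induction p rule: mpoly_ring_induct)
  case (Const c)
  then show ?case by (simp add: of_poly_def to_poly_def sym_ideal_zero)
next
  case (Var f)
  have "of_poly (to_poly (Var f)) = (\<Sum>i<d. Const (f (v i)) * Var (b i))"
    by (simp add: of_poly_def to_poly_def lin_def subst_sum subst_mult)
  moreover have "(\<lambda>x. \<Sum>i<d. f (v i) * b i x) = f"
    by (rule ext, rule dual_expand[OF Var, symmetric])
  ultimately show ?case using Var_sum_relation[of d "\<lambda>i. f (v i)"] by (simp only: order_refl simp_thms)
next
  case (add p q)
  then show ?case
    using sym_ideal_add[OF add(3,4)] by (simp add: of_poly_def to_poly_def subst_add algebra_simps)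
next
  case (mult p q)
  have "q * (p - of_poly (to_poly p)) + of_poly (to_poly p) * (q - of_poly (to_poly q)) \<in> sym_ideal W"
    using mult by (intro sym_ideal_add sym_ideal_mult of_poly_closed)
  then show ?case by (simp add: of_poly_def to_poly_def subst_mult algebra_simps)
qed

text \<open>
  The element of the symmetric algebra that corresponds to the polynomial \<open>a\<close>: a coset of the ideal of
  relations is a fibre of \<open>to_poly\<close>.
\<close>
definition fibre :: "(nat, 'k) mpoly \<Rightarrow> ('v \<Rightarrow> 'k, 'k) mpoly set" where
  "fibre a = {p \<in> carrier (mpoly_ring W). to_poly p = a}"

text \<open>
  The ideal of relations is the whole kernel of \<open>to_poly\<close>, because every \<open>p\<close> is congruent to
  \<open>of_poly (to_poly p)\<close>.
\<close>
lemma sym_class_eq_fibre: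
  assumes p: "p \<in> carrier (mpoly_ring W)"
  shows "sym_class W p = fibre (to_poly p)"
proof -
  have eq: "sym_class W p = {h + p | h. h \<in> sym_ideal W}"
    by (auto simp: sym_class_def a_r_coset_def r_coset_def)
  show ?thesis
  proof
    show "sym_class W p \<subseteq> fibre (to_poly p)"
      unfolding eq fibre_def using p to_poly_sym_ideal sym_ideal_carrier
      by (auto simp: to_poly_def subst_add intro: mpoly_ring_add)
    show "fibre (to_poly p) \<subseteq> sym_class W p"
    proof
      fix q assume "q \<in> fibre (to_poly p)"
      then have q: "q \<in> carrier (mpoly_ring W)" "to_poly (q - p) = 0"
        by (auto simp: fibre_def to_poly_def subst_diff)
      have "q - p \<in> sym_ideal W"
        using of_poly_to_poly[OF mpoly_ring_diff[OF q(1) p]] q(2) by (simp add: of_poly_def)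
      then show "q \<in> sym_class W p" unfolding eq by (intro CollectI exI[of _ "q - p"]) simp
    qed
  qed
qed

lemma fibre_eq_sym_class: "a \<in> R\<^sub>d \<Longrightarrow> fibre a = sym_class W (of_poly a)"
  by (simp add: sym_class_eq_fibre of_poly_closed to_poly_of_poly)

lemma of_poly_fibre: "a \<in> R\<^sub>d \<Longrightarrow> of_poly a \<in> fibre a"
  by (simp add: fibre_def of_poly_closed to_poly_of_poly)

lemma fibre_inj: "a \<in> R\<^sub>d \<Longrightarrow> fibre a = fibre c \<Longrightarrow> a = c"
  using of_poly_fibre[of a] by (auto simp: fibre_def)

lemma sym_algebra_carrier: "carrier (sym_algebra W) = fibre ` R\<^sub>d"
proof -
  have "carrier (sym_algebra W) = sym_class W ` carrier (mpoly_ring W)"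
    by (auto simp: sym_algebra_def FactRing_def A_RCOSETS_def RCOSETS_def sym_class_def a_r_coset_def)
  also have "\<dots> = fibre ` R\<^sub>d"
  proof
    show "sym_class W ` carrier (mpoly_ring W) \<subseteq> fibre ` R\<^sub>d"
      using sym_class_eq_fibre to_poly_closed by auto
    show "fibre ` R\<^sub>d \<subseteq> sym_class W ` carrier (mpoly_ring W)"
      using fibre_eq_sym_class of_poly_closed by auto
  qed
  finally show ?thesis .
qed

lemma sym_algebra_ops:
  shows "\<one>\<^bsub>sym_algebra W\<^esub> = fibre 1" "\<zero>\<^bsub>sym_algebra W\<^esub> = fibre 0"
    and "a \<in> R\<^sub>d \<Longrightarrow> c \<in> R\<^sub>d \<Longrightarrow> fibre a \<otimes>\<^bsub>sym_algebra W\<^esub> fibre c = fibre (a * c)"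
    and "a \<in> R\<^sub>d \<Longrightarrow> c \<in> R\<^sub>d \<Longrightarrow> fibre a \<oplus>\<^bsub>sym_algebra W\<^esub> fibre c = fibre (a + c)"
proof -
  interpret P: cring "mpoly_ring W :: ('v \<Rightarrow> 'k, 'k) mpoly ring" by (rule mpoly_ring_cring)
  interpret I: ideal "sym_ideal W" "mpoly_ring W :: ('v \<Rightarrow> 'k, 'k) mpoly ring" by (rule sym_ideal_ideal)
  have "\<one>\<^bsub>sym_algebra W\<^esub> = sym_class W 1" by (simp add: sym_algebra_def FactRing_def sym_class_def)
  then show "\<one>\<^bsub>sym_algebra W\<^esub> = fibre 1" by (simp add: sym_class_eq_fibre to_poly_def)
  have "\<zero>\<^bsub>sym_algebra W\<^esub> = sym_class W 0"
    using sym_ideal_zero by (auto simp: sym_algebra_def FactRing_def sym_class_def a_r_coset_def r_coset_def)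
  then show "\<zero>\<^bsub>sym_algebra W\<^esub> = fibre 0" by (simp add: sym_class_eq_fibre to_poly_def)
  assume ac: "a \<in> R\<^sub>d" "c \<in> R\<^sub>d"
  have "fibre a \<otimes>\<^bsub>sym_algebra W\<^esub> fibre c = sym_class W (of_poly a * of_poly c)"
    using I.rcoset_mult_add[OF of_poly_closed of_poly_closed, of a c] ac
    by (simp add: fibre_eq_sym_class sym_class_def sym_algebra_def FactRing_def)
  also have "\<dots> = fibre (to_poly (of_poly a) * to_poly (of_poly c))"
    by (subst sym_class_eq_fibre) (auto intro: mpoly_ring_mult of_poly_closed simp: to_poly_def subst_mult)
  finally show "fibre a \<otimes>\<^bsub>sym_algebra W\<^esub> fibre c = fibre (a * c)" using ac by (simp add: to_poly_of_poly)
  have "fibre a \<oplus>\<^bsub>sym_algebra W\<^esub> fibre c = sym_class W (of_poly a + of_poly c)"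
    using I.a_rcos_sum[OF of_poly_closed of_poly_closed, of a c] ac
    by (simp add: fibre_eq_sym_class sym_class_def sym_algebra_def FactRing_def)
  also have "\<dots> = fibre (to_poly (of_poly a) + to_poly (of_poly c))"
    by (subst sym_class_eq_fibre) (auto intro: mpoly_ring_add of_poly_closed simp: to_poly_def subst_add)
  finally show "fibre a \<oplus>\<^bsub>sym_algebra W\<^esub> fibre c = fibre (a + c)" using ac by (simp add: to_poly_of_poly)
qed

lemma sym_subalgebra_cring:
  assumes T: "T \<subseteq> R\<^sub>d" "0 \<in> T" "1 \<in> T" "\<And>x y. x \<in> T \<Longrightarrow> y \<in> T \<Longrightarrow> x + y \<in> T"
    "\<And>x y. x \<in> T \<Longrightarrow> y \<in> T \<Longrightarrow> x * y \<in> T" "\<And>x. x \<in> T \<Longrightarrow> - x \<in> T"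
  shows "cring ((sym_algebra W)\<lparr>carrier := fibre ` T\<rparr>)" (is "cring ?S")
proof -
  note ops = sym_algebra_ops(1,2) sym_algebra_ops(3,4)[OF T(1)[THEN subsetD] T(1)[THEN subsetD]]
  show ?thesis
  proof (rule cringI)
    show "abelian_group ?S"
    proof (rule abelian_groupI)
      fix x assume "x \<in> carrier ?S"
      then obtain a where a: "a \<in> T" "x = fibre a" by auto
      then have "fibre (- a) \<oplus>\<^bsub>?S\<^esub> x = \<zero>\<^bsub>?S\<^esub>" using T(6)[OF a(1)] by (simp add: ops)
      moreover have "fibre (- a) \<in> carrier ?S" using a T(6) by simp
      ultimately show "\<exists>y\<in>carrier ?S. y \<oplus>\<^bsub>?S\<^esub> x = \<zero>\<^bsub>?S\<^esub>" by blast
    qed (auto simp: ops T(2-6) ac_simps)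
    show "comm_monoid ?S" by (rule comm_monoidI) (auto simp: ops T(2-6) ac_simps)
  qed (auto simp: ops T(2-6) distrib_right)
qed

end

section \<open>Invariants\<close>

lemma ideal_span_mult:
  fixes A B C :: "'r::comm_ring_1 set"
  assumes "a \<in> ideal_span A" "c \<in> ideal_span B" and AB: "\<And>x y. x \<in> A \<Longrightarrow> y \<in> B \<Longrightarrow> x * y \<in> ideal_span C"
  shows "a * c \<in> ideal_span C"
proof -
  note add = ideal_span_add and scale = ideal_span_scale
    and zero = ideal_span_zero
  have left: "x * c \<in> ideal_span C" if x: "x \<in> A" for x
    by (rule ideal_span_induct[OF assms(2)])
      (use AB[OF x] scale[of _ C] in \<open>auto simp: ring_ideal_iff distrib_left add zero mult.left_commute\<close>)
  show ?thesis
    by (rule ideal_span_induct[OF assms(1)])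
      (use left scale[of _ C] in \<open>auto simp: ring_ideal_iff distrib_right add zero mult.assoc\<close>)
qed

text \<open>
  A product of \<open>n\<close> elements of \<open>I\<close> lies in the \<open>n\<close>-th power of \<open>I\<close>.
\<close>
lemma (in cring) power_in_span_ideal_power:
  assumes \<iota>: "ring_hom_into \<iota>" and I: "I \<subseteq> carrier R" and t: "t \<in> ideal_span (\<iota> ` I)"
  shows "t ^ n \<in> ideal_span (\<iota> ` (I [^]\<^bsub>ideals_set R\<^esub> n))"
proof (induction n)
  case 0
  have "1 \<in> \<iota> ` carrier R" using \<iota> one_closed by (force simp: ring_hom_into_def)
  then show ?case unfolding ideal_power_simps by (simp add: ideal_span_base)
next
  case (Suc n)
  have "t ^ n * t \<in> ideal_span (\<iota> ` (I [^]\<^bsub>ideals_set R\<^esub> Suc n))"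
  proof (rule ideal_span_mult[OF Suc t])
    fix x y assume "x \<in> \<iota> ` (I [^]\<^bsub>ideals_set R\<^esub> n)" "y \<in> \<iota> ` I"
    then obtain i j where ij: "i \<in> I [^]\<^bsub>ideals_set R\<^esub> n" "j \<in> I" "x = \<iota> i" "y = \<iota> j" by blast
    have "i \<in> carrier R" "j \<in> carrier R" using ij ideal_power_closed[OF I] I by auto
    then have "x * y = \<iota> (i \<otimes> j)" using \<iota> ij by (simp add: ring_hom_into_def)
    moreover have "i \<otimes> j \<in> I [^]\<^bsub>ideals_set R\<^esub> Suc n"
      unfolding ideal_power_simps using ij by (intro ideal_prod.prod)
    ultimately show "x * y \<in> ideal_span (\<iota> ` (I [^]\<^bsub>ideals_set R\<^esub> Suc n))"
      using ideal_span_base by (metis imageI)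
  qed
  then show ?case by (simp only: power_Suc mult.commute)
qed

locale invariant_setting = dual_basis scale d v b
  for scale :: "'k::field \<Rightarrow> 'v::ab_group_add \<Rightarrow> 'v" and d :: nat
    and v :: "nat \<Rightarrow> 'v" and b :: "nat \<Rightarrow> 'v \<Rightarrow> 'k" +
  fixes G :: "('v \<Rightarrow> 'v) set"
  assumes G: "subgroup G (general_linear scale)"
begin

lemma G_GL: "g \<in> G \<Longrightarrow> g \<in> GL"
  using subgroup.subset[OF G] by blast

lemma G_comp: "g \<in> G \<Longrightarrow> h \<in> G \<Longrightarrow> g \<circ> h \<in> G"
  using subgroup.m_closed[OF G] by (simp add: general_linear_def)

lemma G_id: "id \<in> G"
  using subgroup.one_closed[OF G] by (simp add: general_linear_def)

lemma G_bij: "g \<in> G \<Longrightarrow> bij g"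
  using G_GL by (simp add: general_linear_iff[OF vector_space])

lemma G_inverse:
  assumes "g \<in> G"
  obtains h where "h \<in> G" "h \<circ> g = id" "g \<circ> h = id"
proof -
  interpret gl: group "general_linear scale" by (rule general_linear_group[OF vector_space])
  let ?h = "inv\<^bsub>general_linear scale\<^esub> g"
  have "?h \<in> G" by (rule subgroup.m_inv_closed[OF G assms])
  moreover have "?h \<circ> g = id" "g \<circ> ?h = id"
    using gl.l_inv[OF G_GL[OF assms]] gl.r_inv[OF G_GL[OF assms]] by (simp_all add: general_linear_def)
  ultimately show thesis by (rule that)
qed

lemma finite_V: "finite (UNIV :: 'v set)"
proof -
  let ?c = "\<lambda>x. \<lambda>i\<in>{..<d}. b i x"
  have "inj ?c"
  proof (rule injI)
    fix x y assume eq: "?c x = ?c y"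
    have "b i x = b i y" if "i < d" for i using fun_cong[OF eq, of i] that by simp
    then have "(\<Sum>i<d. f (v i) * b i x) = (\<Sum>i<d. f (v i) * b i y)" for f by simp
    then have "f x = f y" if "f \<in> W" for f
      unfolding dual_expand[OF that, of x] dual_expand[OF that, of y] .
    then show "x = y" by (rule separating)
  qed
  moreover have "range ?c \<subseteq> (\<Pi>\<^sub>E i\<in>{..<d}. UNIV)" by (simp add: image_subset_iff restrict_PiE_iff)
  moreover have "finite (\<Pi>\<^sub>E i\<in>{..<d}. UNIV :: 'k set)" using finite_scalars by (intro finite_PiE) auto
  ultimately show ?thesis using finite_subset finite_imageD by blast
qed

lemma finite_G: "finite G"
proof -
  have "finite ((UNIV :: 'v set) \<rightarrow>\<^sub>E (UNIV :: 'v set))" using finite_V by (intro finite_PiE) auto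
  then show ?thesis by (rule finite_subset[rotated]) auto
qed

lemma dual_card: "finite W" "card W = card (UNIV :: 'k set) ^ d"
proof -
  let ?c = "\<lambda>f. \<lambda>i\<in>{..<d}. f (v i)"
  have "bij_betw ?c W (\<Pi>\<^sub>E i\<in>{..<d}. UNIV)"
  proof (rule bij_betwI[where g = "\<lambda>c x. \<Sum>i<d. c i * b i x"])
    show "?c \<in> W \<rightarrow> (\<Pi>\<^sub>E i\<in>{..<d}. UNIV)" by (simp add: restrict_PiE_iff)
    show "(\<lambda>c x. \<Sum>i<d. c i * b i x) \<in> (\<Pi>\<^sub>E i\<in>{..<d}. UNIV) \<rightarrow> W"
      using b_dual
      by (auto simp: mem_dual sum.distrib distrib_left sum_distrib_left algebra_simps)
    show "(\<lambda>x. \<Sum>i<d. ?c f i * b i x) = f" if "f \<in> W" for f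
    proof
      show "(\<Sum>i<d. ?c f i * b i x) = f x" for x
        by (rule trans[OF _ dual_expand[OF that, symmetric]]) (auto intro: sum.cong)
    qed
    show "?c (\<lambda>x. \<Sum>i<d. c i * b i x) = c" if c: "c \<in> (\<Pi>\<^sub>E i\<in>{..<d}. UNIV)" for c
    proof
      fix l
      have "(\<Sum>i<d. c i * b i (v l)) = c l" if "l < d"
      proof -
        have "(\<Sum>i<d. c i * b i (v l)) = (\<Sum>i<d. if i = l then c l else 0)"
          using that by (intro sum.cong) (auto simp: b_v)
        then show ?thesis using that by simp
      qed
      then show "?c (\<lambda>x. \<Sum>i<d. c i * b i x) l = c l" using c by (auto simp: PiE_def extensional_def)
    qed
  qed
  then show "card W = card (UNIV :: 'k set) ^ d" "finite W"
    using bij_betw_same_card[of ?c W] bij_betw_finite[of ?c W] finite_scalars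
    by (auto simp: card_PiE intro!: finite_PiE)
qed

sublocale linear_forms "Const :: 'k \<Rightarrow> (nat, 'k) mpoly" "lin ` W"
proof
  show "x + y \<in> lin ` W" if "x \<in> lin ` W" "y \<in> lin ` W" for x y
    using that dual_add by (auto simp: lin_add[symmetric])
  show "Const c * x \<in> lin ` W" if "x \<in> lin ` W" for c x
    using that dual_scale by (auto simp: lin_scale[symmetric])
  show "0 \<in> lin ` W" using dual_zero lin_zero by (metis imageI)
qed (use finite_scalars dual_card in \<open>auto simp: Const_add Const_mult\<close>)

lemma card_forms: "card (lin ` W) = card (UNIV :: 'k set) ^ d"
  using card_image[OF lin_inj] dual_card by simp

lemma dual_action_inj:
  assumes "g \<in> GL" "dual_action g f = dual_action g h"
  shows "f = h"
proof
  fix x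
  have "inv_into UNIV g (g x) = x"
    using assms(1) by (simp add: general_linear_iff[OF vector_space] bij_is_inj)
  then show "f x = h x" using fun_cong[OF assms(2), of "g x"] by (simp add: dual_action_def)
qed

lemma form_hom_act: "g \<in> G \<Longrightarrow> form_hom (act g)"
proof -
  assume g: "g \<in> G"
  have "inj_on (act g) (lin ` W)"
  proof (rule inj_onI)
    fix x y assume "x \<in> lin ` W" "y \<in> lin ` W" and eq: "act g x = act g y"
    then obtain f h where fh: "f \<in> W" "x = lin f" "h \<in> W" "y = lin h" by blast
    then have "dual_action g f = dual_action g h"
      using eq dual_action_dual[OF G_GL[OF g]] by (intro inj_onD[OF lin_inj]) (auto simp: act_lin)
    then show "x = y" using dual_action_inj[OF G_GL[OF g]] fh by blast
  qed
  then show ?thesis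
    using dual_action_dual[OF G_GL[OF g]]
    by (auto simp: form_hom_def act_lin) (simp_all add: act_def subst_add subst_mult)
qed

text \<open>
  An element of the group that fixes all linear forms is the identity, as linear forms separate
  points; so the general result on traces applies.
\<close>
lemma trace_power: "\<exists>r. (\<Sum>g\<in>G. act g r) = (\<Prod>u\<in>lin ` W - {0}. u) ^ d"
proof (rule trace_eq_power[OF card_forms finite_G form_hom_act])
  show "\<exists>g\<in>G. \<forall>x\<in>lin ` W. act g x = x" using G_id act_id lin_closed by (intro bexI[of _ id]) auto
  show "\<exists>k\<in>G. \<forall>x\<in>lin ` W. act k x = act g (act h x)" if "g \<in> G" "h \<in> G" for g h
    using that G_comp by (intro bexI[of _ "g \<circ> h"]) (auto simp: act_comp G_GL)
  show "\<exists>h\<in>G. \<forall>x\<in>lin ` W. act h (act g x) = x" if g: "g \<in> G" for g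
  proof -
    obtain h where h: "h \<in> G" "h \<circ> g = id" using G_inverse[OF g] by blast
    then show ?thesis using g act_id lin_closed by (intro bexI[of _ h]) (auto simp: act_comp G_GL)
  qed
  show "g = h" if g: "g \<in> G" and h: "h \<in> G" and eq: "\<forall>x\<in>lin ` W. act g x = act h x" for g h
  proof -
    have same: "dual_action g f = dual_action h f" if f: "f \<in> W" for f
      using eq f dual_action_dual[OF G_GL[OF g] f] dual_action_dual[OF G_GL[OF h] f]
      by (intro inj_onD[OF lin_inj]) (auto simp: act_lin)
    have "f (inv_into UNIV g x) = f (inv_into UNIV h x)" if "f \<in> W" for f x
      using fun_cong[OF same[OF that], of x] by (simp add: dual_action_def)
    then have "inv_into UNIV g x = inv_into UNIV h x" for x by (intro separating)
    then have "inv_into UNIV g = inv_into UNIV h" by blast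
    then show "g = h" using G_bij[OF g] G_bij[OF h] by (metis inv_inv_eq)
  qed
qed

definition invariant_polys :: "(nat, 'k) mpoly set" where
  "invariant_polys = {a \<in> R\<^sub>d. \<forall>g\<in>G. act g a = a}"

text \<open>
  Surjectivity uses the inverse of \<open>g\<close>: every representative of the class of \<open>act g a\<close> is itself renamed
  from a representative of the class of \<open>a\<close>.
\<close>
lemma sym_action_fibre:
  assumes g: "g \<in> G" and a: "a \<in> R\<^sub>d"
  shows "sym_action g (fibre a) = fibre (act g a)"
proof
  show "sym_action g (fibre a) \<subseteq> fibre (act g a)"
    using rename_closed[OF G_GL[OF g]] to_poly_rename by (auto simp: sym_action_def fibre_def)
  show "fibre (act g a) \<subseteq> sym_action g (fibre a)"
  proof
    fix q assume "q \<in> fibre (act g a)"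
    then have q: "q \<in> carrier (mpoly_ring W)" "to_poly q = act g a" by (auto simp: fibre_def)
    obtain h where h: "h \<in> G" "h \<circ> g = id" "g \<circ> h = id" using G_inverse[OF g] .
    have "rename (dual_action g) (rename (dual_action h) q) = subst (\<lambda>f. Var (dual_action (g \<circ> h) f)) q"
      by (simp add: rename_eq_subst subst_subst dual_action_comp G_GL g h(1))
    also have "\<dots> = q" by (simp add: h(3) dual_action_def)
    finally have "rename (dual_action g) (rename (dual_action h) q) = q" .
    moreover have "rename (dual_action h) q \<in> fibre a"
      using q rename_closed[OF G_GL[OF h(1)] q(1)] to_poly_rename[OF q(1), of h] act_id[OF a]
      by (simp add: fibre_def act_comp G_GL g h)
    ultimately show "q \<in> sym_action g (fibre a)" unfolding sym_action_def by (metis imageI)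
  qed
qed

abbreviation "S \<equiv> invariant_ring scale G"

lemma invariant_ring_eq: "S = (sym_algebra W)\<lparr>carrier := fibre ` invariant_polys\<rparr>"
proof -
  have "{x \<in> carrier (sym_algebra W). \<forall>g\<in>G. sym_action g x = x} = fibre ` invariant_polys"
  proof
    show "{x \<in> carrier (sym_algebra W). \<forall>g\<in>G. sym_action g x = x} \<subseteq> fibre ` invariant_polys"
    proof
      fix x assume x: "x \<in> {x \<in> carrier (sym_algebra W). \<forall>g\<in>G. sym_action g x = x}"
      then obtain a where a: "a \<in> R\<^sub>d" "x = fibre a" by (auto simp: sym_algebra_carrier)
      have "act g a = a" if "g \<in> G" for g
        using x a sym_action_fibre[OF that a(1)] that by (intro fibre_inj act_closed) auto
      then show "x \<in> fibre ` invariant_polys" using a by (auto simp: invariant_polys_def)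
    qed
    show "fibre ` invariant_polys \<subseteq> {x \<in> carrier (sym_algebra W). \<forall>g\<in>G. sym_action g x = x}"
      using sym_action_fibre by (auto simp: sym_algebra_carrier invariant_polys_def)
  qed
  then show ?thesis by (simp add: invariant_ring_def)
qed

lemma invariant_polys_closed: "invariant_polys \<subseteq> R\<^sub>d"
  by (auto simp: invariant_polys_def)

lemma invariant_polys_ring:
  "0 \<in> invariant_polys" "1 \<in> invariant_polys"
  "a \<in> invariant_polys \<Longrightarrow> c \<in> invariant_polys \<Longrightarrow> a + c \<in> invariant_polys"
  "a \<in> invariant_polys \<Longrightarrow> c \<in> invariant_polys \<Longrightarrow> a * c \<in> invariant_polys"
  "a \<in> invariant_polys \<Longrightarrow> - a \<in> invariant_polys"
  by (auto simp: invariant_polys_def act_def subst_add subst_mult subst_uminus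
      intro: mpoly_ring_add mpoly_ring_mult mpoly_ring_uminus)

lemma invariant_ring_cring: "cring S"
  unfolding invariant_ring_eq by (intro sym_subalgebra_cring invariant_polys_closed invariant_polys_ring)

lemma carrier_S: "carrier S = fibre ` invariant_polys"
  by (simp add: invariant_ring_eq)

lemma S_ops:
  "\<one>\<^bsub>S\<^esub> = fibre 1" "\<zero>\<^bsub>S\<^esub> = fibre 0"
  "a \<in> invariant_polys \<Longrightarrow> c \<in> invariant_polys \<Longrightarrow> fibre a \<otimes>\<^bsub>S\<^esub> fibre c = fibre (a * c)"
  "a \<in> invariant_polys \<Longrightarrow> c \<in> invariant_polys \<Longrightarrow> fibre a \<oplus>\<^bsub>S\<^esub> fibre c = fibre (a + c)"
  using sym_algebra_ops(3,4)[of a c] invariant_polys_closed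
  by (auto simp: invariant_ring_eq sym_algebra_ops(1,2))

definition dickson :: "(nat, 'k) mpoly" where
  "dickson = (\<Prod>u\<in>lin ` W - {0}. u)"

lemma dickson_invariant: "dickson \<in> invariant_polys"
proof -
  have "act g dickson = dickson" if g: "g \<in> G" for g
  proof -
    note h = form_homD[OF form_hom_act[OF g]]
    have "act g ` (lin ` W) = lin ` W" using h(4,5) \<Lambda>_finite by (intro endo_inj_surj) auto
    then have im: "act g ` (lin ` W - {0}) = lin ` W - {0}"
      using inj_on_image_set_diff[OF h(4), of "lin ` W" "{0}"] \<Lambda>_0 by (simp add: h(6))
    have "act g dickson = (\<Prod>u\<in>lin ` W - {0}. act g u)" by (simp add: dickson_def h(11))
    also have "\<dots> = (\<Prod>u\<in>act g ` (lin ` W - {0}). u)"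
      by (subst prod.reindex) (auto intro: inj_on_subset[OF h(4)])
    finally show ?thesis by (simp add: im dickson_def)
  qed
  moreover have "dickson \<in> R\<^sub>d" unfolding dickson_def by (intro mpoly_ring_prod) auto
  ultimately show ?thesis by (simp add: invariant_polys_def)
qed

lemma top_dickson_eq: "top_dickson scale = fibre dickson"
proof -
  have "cring ((sym_algebra W)\<lparr>carrier := fibre ` R\<^sub>d\<rparr>)"
    by (rule sym_subalgebra_cring) (auto intro: mpoly_ring_add mpoly_ring_mult mpoly_ring_uminus)
  then interpret A: cring "sym_algebra W" by (simp add: sym_algebra_carrier[symmetric])
  have sym_class: "sym_class W (Var f) = fibre (lin f)" if "f \<in> W" for f
    using sym_class_eq_fibre[OF mpoly_ring_Var[OF that]] by (simp add: to_poly_def)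
  have "finprod (sym_algebra W) (\<lambda>f. sym_class W (Var f)) A = fibre (\<Prod>f\<in>A. lin f)"
    if "finite A" "A \<subseteq> W" for A
    using that
  proof (induction A rule: finite_induct)
    case empty
    then show ?case by (simp add: sym_algebra_ops)
  next
    case (insert f A)
    have "(\<lambda>f. sym_class W (Var f)) \<in> insert f A \<rightarrow> carrier (sym_algebra W)"
      using insert.prems by (auto simp: sym_class sym_algebra_carrier)
    then have "finprod (sym_algebra W) (\<lambda>f. sym_class W (Var f)) (insert f A) =
        fibre (lin f) \<otimes>\<^bsub>sym_algebra W\<^esub> fibre (\<Prod>f\<in>A. lin f)"
      using insert by (subst A.finprod_insert) (auto simp: sym_class)
    also have "\<dots> = fibre (lin f * (\<Prod>f\<in>A. lin f))"
      by (intro sym_algebra_ops mpoly_ring_prod) auto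
    finally show ?case using insert by simp
  qed
  then have "top_dickson scale = fibre (\<Prod>f\<in>W - {\<lambda>_. 0}. lin f)"
    unfolding top_dickson_def using dual_card(1) by simp
  also have "(\<Prod>f\<in>W - {\<lambda>_. 0}. lin f) = (\<Prod>u\<in>lin ` (W - {\<lambda>_. 0}). u)"
    by (subst prod.reindex) (auto intro: inj_on_subset[OF lin_inj])
  also have "lin ` (W - {\<lambda>_. 0}) = lin ` W - {0}"
    using inj_on_image_set_diff[OF lin_inj, of W "{\<lambda>_. 0}"] dual_zero by (simp add: lin_zero)
  finally show ?thesis by (simp add: dickson_def)
qed

lemma fibre_power: "fibre dickson [^]\<^bsub>S\<^esub> (n::nat) = fibre (dickson ^ n)" "dickson ^ n \<in> invariant_polys"
proof -
  interpret S: cring S by (rule invariant_ring_cring)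
  show pow: "dickson ^ n \<in> invariant_polys" for n
    by (induction n) (auto intro: invariant_polys_ring dickson_invariant)
  show "fibre dickson [^]\<^bsub>S\<^esub> n = fibre (dickson ^ n)"
    by (induction n) (auto simp: S_ops dickson_invariant pow mult.commute)
qed

lemma dickson_nonzero: "dickson \<noteq> 0"
  using \<Lambda>_finite by (auto simp: dickson_def)

lemma homogeneous_dickson: "homogeneous (card (lin ` W) - 1) dickson"
proof -
  have "homogeneous (\<Sum>u\<in>lin ` W - {0}. 1) (\<Prod>u\<in>lin ` W - {0}. u)"
    by (rule homogeneous_prod) (auto intro: homogeneous_lin[unfolded One_nat_def])
  then show ?thesis using \<Lambda>_0 \<Lambda>_finite by (simp add: dickson_def)
qed

text \<open>
  The powers of the Dickson class are nonzero and of different degrees.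
\<close>
lemma infinite_S:
  assumes "0 < d"
  shows "infinite (carrier S)"
proof -
  have "card {0, 1 :: 'k} \<le> card (UNIV :: 'k set)" by (rule card_mono) (auto simp: finite_scalars)
  then have "1 < card (UNIV :: 'k set) ^ d" using assms by (intro one_less_power) auto
  then have Q: "0 < card (lin ` W) - 1" by (simp add: card_forms)
  have homogeneous_pow: "homogeneous ((card (lin ` W) - 1) * n) (dickson ^ n)" for n
    by (induction n) (auto intro: homogeneous_1 homogeneous_mult homogeneous_dickson[unfolded One_nat_def])
  have "inj (\<lambda>n. fibre (dickson ^ n))"
  proof (rule injI)
    fix m n assume "fibre (dickson ^ m) = fibre (dickson ^ n)"
    then have eq: "dickson ^ m = dickson ^ n"
      using fibre_power(2) invariant_polys_closed by (intro fibre_inj) auto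
    have "dickson ^ m \<noteq> 0" using dickson_nonzero by simp
    then obtain l where "l \<in> Poly_Mapping.keys (dickson ^ m)" by (metis keys_eq_empty all_not_in_conv)
    then have "mdegree l = (card (lin ` W) - 1) * m" "mdegree l = (card (lin ` W) - 1) * n"
      using homogeneous_pow[of m] homogeneous_pow[of n] unfolding homogeneous_def eq by blast+
    then have "(card (lin ` W) - 1) * m = (card (lin ` W) - 1) * n" by metis
    then show "m = n" using Q by simp
  qed
  then have "infinite (range (\<lambda>n. fibre (dickson ^ n)))" by (rule range_inj_infinite)
  moreover have "range (\<lambda>n. fibre (dickson ^ n)) \<subseteq> carrier S" using fibre_power(2) by (auto simp: carrier_S)
  ultimately show ?thesis using finite_subset by blast
qed

lemma countable_S: "countable (carrier S)"
proof -
  have "countable (UNIV :: 'k set)" using finite_scalars by (rule countable_finite)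
  moreover have "countable (UNIV :: (nat \<Rightarrow>\<^sub>0 nat) set)" by (rule countable_poly_mapping) auto
  ultimately have "countable (UNIV :: (nat, 'k) mpoly set)" using countable_poly_mapping by blast
  then have "countable invariant_polys" by (rule countable_subset[OF subset_UNIV])
  then show ?thesis unfolding carrier_S by (rule countable_image)
qed

definition poly_of :: "('v \<Rightarrow> 'k, 'k) mpoly set \<Rightarrow> (nat, 'k) mpoly" where
  "poly_of C = to_poly (SOME p. p \<in> C)"

lemma poly_of_fibre:
  assumes "a \<in> R\<^sub>d"
  shows "poly_of (fibre a) = a"
proof -
  have "(SOME p. p \<in> fibre a) \<in> fibre a" using of_poly_fibre[OF assms] by (rule someI)
  then show ?thesis by (simp add: poly_of_def fibre_def)
qed

lemma poly_of_invariant: "s \<in> carrier S \<Longrightarrow> poly_of s \<in> invariant_polys" "s \<in> carrier S \<Longrightarrow> fibre (poly_of s) = s"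
  using invariant_polys_closed by (auto simp: carrier_S poly_of_fibre subset_iff)

lemma poly_of_hom: "cring.ring_hom_into S poly_of"
proof -
  interpret S: cring S by (rule invariant_ring_cring)
  show ?thesis
    unfolding S.ring_hom_into_def
    using invariant_polys_closed invariant_polys_ring
    by (auto simp: S_ops carrier_S poly_of_fibre subset_iff)
qed

lemma irrelevant_ideal_closed: "irrelevant_ideal scale G \<subseteq> carrier S"
proof -
  interpret S: cring S by (rule invariant_ring_cring)
  show ?thesis
    by (auto simp: irrelevant_ideal_def invariant_degree_def intro!: S.finsum_closed)
qed

lemma homogeneous_in_irrelevant_ideal:
  assumes a: "a \<in> invariant_polys" "homogeneous n a" and n: "1 \<le> n"
  shows "fibre a \<in> irrelevant_ideal scale G"
proof -
  interpret S: cring S by (rule invariant_ring_cring)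
  have deg: "fibre c \<in> invariant_degree scale G m" if c: "c \<in> invariant_polys" "homogeneous m c" for c m
  proof -
    have "of_poly c = subst (\<lambda>i. Var (b i)) c"
      using c(1) invariant_polys_closed unfolding of_poly_def by (intro subst_cong) auto
    then have "homogeneous m (of_poly c)" by (simp only: homogeneous_subst[OF c(2) homogeneous_Var])
    then have "fibre c \<in> sym_degree W m"
      using c(1) invariant_polys_closed of_poly_closed[of c]
      by (auto simp: sym_degree_def fibre_eq_sym_class homogeneous_def subset_iff)
    then show ?thesis using c(1) by (simp add: invariant_degree_def carrier_S)
  qed
  define s where "s m = (if m = n then fibre a else \<zero>\<^bsub>S\<^esub>)" for m
  have "s m \<in> invariant_degree scale G m" for m
    using deg[OF a] deg[OF invariant_polys_ring(1)] by (simp add: s_def S_ops)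
  moreover have "finsum S s {1..n} = fibre a"
    unfolding s_def using a n by (intro S.add.finprod_singleton_swap) (auto simp: carrier_S)
  ultimately show ?thesis unfolding irrelevant_ideal_def by blast
qed

lemma esym_irrelevant:
  assumes "1 \<le> k"
  shows "fibre (esym k) \<in> irrelevant_ideal scale G" "esym k \<in> invariant_polys"
proof -
  have "homogeneous k (\<Prod>u\<in>T. - u)" if "T \<subseteq> lin ` W" "card T = k" for T
  proof -
    have "homogeneous (\<Sum>u\<in>T. 1) (\<Prod>u\<in>T. - u)"
      using that(1) homogeneous_lin by (intro homogeneous_prod homogeneous_uminus) auto
    then show ?thesis using that(2) by simp
  qed
  then have "homogeneous k (esym k)" unfolding esym_def by (intro homogeneous_sum) auto
  moreover show "esym k \<in> invariant_polys"
    unfolding invariant_polys_def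
  proof (intro CollectI conjI ballI esym_invariant form_hom_act)
    show "esym k \<in> R\<^sub>d"
      unfolding esym_def by (intro mpoly_ring_sum mpoly_ring_prod mpoly_ring_uminus) auto
  qed
  ultimately show "fibre (esym k) \<in> irrelevant_ideal scale G"
    using homogeneous_in_irrelevant_ideal assms by blast
qed

text \<open>
  A variable is a root of \<open>\<Prod> (X - u)\<close>, so its power with exponent \<open>card (lin ` W)\<close> is a combination of
  the lower coefficients, which lie in the irrelevant ideal.
\<close>
lemma Var_power_in_span:
  assumes "m < d"
  shows "Var m ^ (card (lin ` W) * n) \<in>
    ideal_span (poly_of ` (irrelevant_ideal scale G [^]\<^bsub>ideals_set S\<^esub> n))"
proof -
  interpret S: cring S by (rule invariant_ring_cring)
  have "esym k \<in> poly_of ` irrelevant_ideal scale G" if "1 \<le> k" for k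
  proof (rule image_eqI)
    show "fibre (esym k) \<in> irrelevant_ideal scale G" by (rule esym_irrelevant(1)[OF that])
    show "esym k = poly_of (fibre (esym k))"
      using esym_irrelevant(2)[OF that] invariant_polys_closed by (simp add: poly_of_fibre subset_iff)
  qed
  then have "ideal_span (esym ` {1..card (lin ` W)}) \<subseteq> ideal_span (poly_of ` irrelevant_ideal scale G)"
    by (intro ideal_span_mono) auto
  moreover have "Var m \<in> lin ` W" using lin_b[OF assms] b_dual[OF assms] by (metis imageI)
  then have "Var m ^ card (lin ` W) \<in> ideal_span (esym ` {1..card (lin ` W)})"
    by (rule power_card_in_span_esym)
  ultimately show ?thesis
    unfolding power_mult
    using S.power_in_span_ideal_power[OF poly_of_hom irrelevant_ideal_closed] by blast
qed

lemma trace_invariant: "(\<Sum>g\<in>G. act g a) \<in> invariant_polys"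
proof -
  have "act h (\<Sum>g\<in>G. act g a) = (\<Sum>g\<in>G. act g a)" if h: "h \<in> G" for h
  proof -
    obtain k where k: "k \<in> G" "k \<circ> h = id" "h \<circ> k = id" using G_inverse[OF h] .
    have "act h (\<Sum>g\<in>G. act g a) = (\<Sum>g\<in>G. act (h \<circ> g) a)"
      using h by (simp add: form_homD(10)[OF form_hom_act] act_comp G_GL)
    also have "\<dots> = (\<Sum>g\<in>G. act g a)"
      by (rule sum.reindex_bij_witness[of _ "\<lambda>g. k \<circ> g" "\<lambda>g. h \<circ> g"])
        (use h k G_comp in \<open>auto simp: o_assoc\<close>)
    finally show ?thesis .
  qed
  then show ?thesis by (auto simp: invariant_polys_def intro: mpoly_ring_sum act_closed)
qed

text \<open>
  The factorization is \<open>\<alpha>\<close>, multiplication by an element of trace \<open>dickson ^ d\<close>, followed by \<open>\<beta>\<close>, the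
  trace. An injective resolution embeds \<open>S\<close> into \<open>'m\<close>, so that type is infinite.
\<close>
theorem dickson_power_annihilates:
  assumes res: "injective_resolution S (ring_module S) \<epsilon> (E :: nat \<Rightarrow> (_, 'm) module) \<delta>" and j: "j < d"
  shows "fibre (dickson ^ d) \<in> annihilator S (local_cohomology S (irrelevant_ideal scale G) E \<delta> j)"
proof -
  interpret S: cring S by (rule invariant_ring_cring)
  obtain r where r: "(\<Sum>g\<in>G. act g r) = dickson ^ d" using trace_power dickson_def by auto
  define \<alpha> where "\<alpha> s = r * poly_of s" for s
  define \<beta> where "\<beta> a = fibre (\<Sum>g\<in>G. act g a)" for a
  have hom: "poly_of (s \<oplus>\<^bsub>S\<^esub> t) = poly_of s + poly_of t" "poly_of (s \<otimes>\<^bsub>S\<^esub> t) = poly_of s * poly_of t"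
    if "s \<in> carrier S" "t \<in> carrier S" for s t
    using poly_of_hom that by (auto simp: S.ring_hom_into_def)
  have \<beta>_linear: "\<beta> (poly_of s * a) = s \<otimes>\<^bsub>S\<^esub> \<beta> a" if s: "s \<in> carrier S" for s a
  proof -
    have "act g (poly_of s * a) = poly_of s * act g a" if g: "g \<in> G" for g
      using poly_of_invariant(1)[OF s] g by (simp add: invariant_polys_def form_homD(2)[OF form_hom_act[OF g]])
    then have "\<beta> (poly_of s * a) = fibre (poly_of s * (\<Sum>g\<in>G. act g a))"
      by (simp add: \<beta>_def sum_distrib_left)
    also have "\<dots> = s \<otimes>\<^bsub>S\<^esub> \<beta> a"
      using S_ops(3)[OF poly_of_invariant(1)[OF s] trace_invariant[of a]] poly_of_invariant(2)[OF s]
      by (simp add: \<beta>_def)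
    finally show ?thesis .
  qed
  show ?thesis
  proof (rule S.annihilates_local_cohomology[OF res countable_S _ poly_of_hom _ _ _ _ irrelevant_ideal_closed _ j])
    have "inj_on \<epsilon> (carrier S)" "infinite (carrier S)"
      using res infinite_S j by (auto simp: injective_resolution_def ring_module_def)
    then show "infinite (UNIV :: 'm set)" using finite_imageD finite_subset[OF subset_UNIV] by metis
    show "fibre (dickson ^ d) \<in> carrier S" using fibre_power(2) by (simp add: carrier_S)
    show "\<alpha> \<in> module_homs S (ring_module S) (ring_algebra poly_of)"
      by (rule module_homsI) (auto simp: \<alpha>_def ring_module_def hom algebra_simps)
    show "\<beta> \<in> module_homs S (ring_algebra poly_of) (ring_module S)"
    proof (rule module_homsI)
      show "\<beta> x \<in> carrier (ring_module S)" for x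
        using trace_invariant by (simp add: \<beta>_def ring_module_def carrier_S)
      show "\<beta> (x \<oplus>\<^bsub>ring_algebra poly_of\<^esub> y) = \<beta> x \<oplus>\<^bsub>ring_module S\<^esub> \<beta> y" for x y
        using S_ops(4)[OF trace_invariant[of x] trace_invariant[of y]]
        by (simp add: \<beta>_def ring_module_def form_homD(1)[OF form_hom_act] sum.distrib)
      show "\<beta> (a \<odot>\<^bsub>ring_algebra poly_of\<^esub> x) = a \<odot>\<^bsub>ring_module S\<^esub> \<beta> x" if "a \<in> carrier S" for a x
        using \<beta>_linear[OF that] by (simp add: ring_module_def)
    qed
    show "\<beta> (\<alpha> s) = fibre (dickson ^ d) \<otimes>\<^bsub>S\<^esub> s" if s: "s \<in> carrier S" for s
    proof -
      have "fibre (dickson ^ d) \<in> carrier S" using fibre_power(2) by (simp add: carrier_S)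
      then show ?thesis using \<beta>_linear[OF s, of r] s by (simp add: \<alpha>_def \<beta>_def r mult.commute S.m_comm)
    qed
    show "\<exists>t. regular_sequence d t \<and>
        (\<forall>m<d. t m \<in> ideal_span (poly_of ` (irrelevant_ideal scale G [^]\<^bsub>ideals_set S\<^esub> n)))" for n :: nat
      using regular_sequence_Var_powers[of d "card (lin ` W) * n"] Var_power_in_span
      by (intro exI[of _ "\<lambda>m. Var m ^ (card (lin ` W) * n)"]) auto
  qed
qed

end

theorem theorem1p3:
  fixes p e q d j :: nat
    and scale :: "'k::field \<Rightarrow> 'v::ab_group_add \<Rightarrow> 'v"
    and G :: "('v \<Rightarrow> 'v) set"
    and \<epsilon> :: "('v \<Rightarrow> 'k, 'k) mpoly set \<Rightarrow> 'm"
    and E :: "nat \<Rightarrow> (('v \<Rightarrow> 'k, 'k) mpoly set, 'm) module"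
    and \<delta> :: "nat \<Rightarrow> 'm \<Rightarrow> 'm"
  assumes "Factorial_Ring.prime p" and "e > 0" and "q = p ^ e"
    and "card (UNIV :: 'k set) = q"
    and "\<exists>Basis. finite_dimensional_vector_space scale Basis"
    and "vector_space.dim scale (UNIV :: 'v set) = d"
    and "subgroup G (general_linear scale)"
    and "injective_resolution (invariant_ring scale G) (ring_module (invariant_ring scale G)) \<epsilon> E \<delta>"
    and "j < d"
  shows "top_dickson scale \<in> ideal_radical (invariant_ring scale G)
    (annihilator (invariant_ring scale G)
      (local_cohomology (invariant_ring scale G) (irrelevant_ideal scale G) E \<delta> j))"
proof -
  have "q > 0" using assms(1,3) by (simp add: prime_gt_0_nat)
  then have fin: "finite (UNIV :: 'k set)" using assms(4) by (metis card.infinite less_numeral_extra(3))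
  obtain v b where "dual_basis scale d v b"
    using assms(5) dual_basis_ex[OF _ assms(6) fin] by blast
  then interpret invariant_setting scale d v b G
    using assms(7) by (simp add: invariant_setting_def invariant_setting_axioms_def)
  have "top_dickson scale [^]\<^bsub>S\<^esub> d \<in> annihilator S (local_cohomology S (irrelevant_ideal scale G) E \<delta> j)"
    using dickson_power_annihilates[OF assms(8,9)] by (simp add: top_dickson_eq fibre_power)
  moreover have "top_dickson scale \<in> carrier S"
    using dickson_invariant by (simp add: top_dickson_eq carrier_S)
  ultimately show ?thesis unfolding ideal_radical_def by blast
qed

end
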